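(* Consider the irreducible representations of $Spin(7)$ given by $V_{(0,0,0)},\ V_{(1,0,0)},\ V_{(0,0,1)},\ V_{(0,1,0)},\ V_{(2,0,0)},\ V_{(1,0,1)}$. If $V_\gamma$ is an irreducible representation of $Spin(7)$ which is not one of these, then the twisted Dirac operator $$(D^0_{A_\Sigma})_\gamma:\mathrm{Hom}(V_\gamma,\Delta\otimes\mathfrak{spin}(7)_{\mathbb C})^{G_2}\to\mathrm{Hom}(V_\gamma,\Delta\otimes\mathfrak{spin}(7)_{\mathbb C})^{G_2}$$ has no eigenvalues in the interval $\left(-\frac52,\frac52\right)$.
   Context: $V_{(a,b,c)}$ is the irreducible complex representation of $Spin(7)$ with highest weight (Dynkin labels) $(a,b,c)$: $V_{(1,0,0)}$ is the 7-dimensional vector representation, $V_{(0,1,0)}=\mathfrak{spin}(7)_{\mathbb C}$, $V_{(0,0,1)}$ the 8-dimensional spin representation. Write $\mathfrak{spin}(7)=\mathfrak g_2\oplus\mathfrak m$, orthogonal for the Killing form $K$; use the inner product $-\frac3{40}K$ and let $\{I_a\}_{a=1}^7$ be an orthonormal basis of $\mathfrak m$. The $G_2$-invariant 3-form $\phi$ on $\mathfrak m$ is normalised by $[Y,Z]_{\mathfrak m}=-\frac23\phi(Y,Z,\cdot)$ (using the metric), i.e. $\phi(Y,Z,W)=-\frac32\langle[Y,Z]_{\mathfrak m},W\rangle$. The complex spinor space is $\Delta=\mathbb{C}\oplus\mathfrak m^*_{\mathbb C}$ with Clifford multiplication by $u\in\mathfrak m\cong\mathfrak m^*$ $$u\cdot(f,v)=(\langle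 u,v\rangle,\,-fu-\phi(u,v,\cdot)),$$ under which $\phi$ acts as $7$ on $\mathbb{C}$ and as $-1$ on $\mathfrak m^*_{\mathbb C}$. $G_2$ acts on $\mathfrak{spin}(7)_{\mathbb C}$ by the restricted adjoint representation. The operator is $$(D^0_{A_\Sigma})_\gamma\,\eta=-\sum_{a=1}^7 I_a\cdot(\eta\circ\rho_{V_\gamma}(I_a))-\frac12\,\phi\cdot\eta,$$ Clifford multiplication acting on the $\Delta$ factor. *)

theory Defs
  imports "HOL-Analysis.Analysis"
begin

section \<open>Matrices\<close>

type_synonym 'n rmat = "real^'n^'n"
type_synonym 'n cmat = "complex^'n^'n"

definition mscale :: "complex \<Rightarrow> 'n::finite cmat \<Rightarrow> 'n cmat" where
  "mscale c A = (\<chi> i j. c * A $ i $ j)"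

definition complex_mat :: "'n::finite rmat \<Rightarrow> 'n cmat" where
  "complex_mat A = (\<chi> i j. complex_of_real (A $ i $ j))"

definition Re_mat :: "'n::finite cmat \<Rightarrow> 'n rmat" where
  "Re_mat A = (\<chi> i j. Re (A $ i $ j))"

definition Im_mat :: "'n::finite cmat \<Rightarrow> 'n rmat" where
  "Im_mat A = (\<chi> i j. Im (A $ i $ j))"

text \<open>The product \<open>*\<close> and the powers of the type \<open>real^'n^'n\<close> are componentwise, so
  the library's \<open>exp\<close> is not the matrix exponential.\<close>

definition mat_power :: "'n::finite rmat \<Rightarrow> nat \<Rightarrow> 'n rmat" where
  "mat_power A k = (((**) A) ^^ k) (mat 1)"

definition mat_exp :: "'n::finite rmat \<Rightarrow> 'n rmat" where
  "mat_exp A = (\<Sum>k. (1 / fact k) *\<^sub>R mat_power A k)"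

definition bracket :: "'a::ring_1^'n::finite^'n \<Rightarrow> 'a^'n^'n \<Rightarrow> 'a^'n^'n" where
  "bracket A B = A ** B - B ** A"

definition lie_algebra :: "'n::finite rmat set \<Rightarrow> 'n rmat set" where
  "lie_algebra G = {X. \<forall>t. mat_exp (t *\<^sub>R X) \<in> G}"

definition trace_on :: "'v::real_vector set \<Rightarrow> ('v \<Rightarrow> 'v) \<Rightarrow> real" where
  "trace_on S T =
    (let B = (SOME B. independent B \<and> span B = S) in \<Sum>b\<in>B. representation B (T b) b)"

definition killing :: "'n::finite rmat set \<Rightarrow> 'n rmat \<Rightarrow> 'n rmat \<Rightarrow> real" where
  "killing \<gg> X Y = trace_on \<gg> (\<lambda>Z. bracket X (bracket Y Z))"

section \<open>The groups Spin(7) and \<open>G\<^sub>2\<close>\<close>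

text \<open>
  Spin(7) is realised inside the invertible real matrices of size 8 by its (faithful) real spin
  representation.  The spin space is \<open>\<real> \<oplus> \<real>\<^sup>7\<close>: index \<open>None\<close> stands for the summand \<open>\<real>\<close>,
  index \<open>Some i\<close> for the \<open>i\<close>-th coordinate of \<open>\<real>\<^sup>7\<close>, and the vector \<open>u\<close> of \<open>\<real>\<^sup>7\<close> acts by
  \<open>(f, v) \<mapsto> (\<langle>u, v\<rangle>, - f u - \<phi>\<^sub>0 (u, v, \<cdot>))\<close>, which squares to \<open>- \<bar>u\<bar>\<^sup>2\<close>. Here
  \<open>\<phi>\<^sub>0 = e\<^sup>123 + e\<^sup>145 + e\<^sup>167 + e\<^sup>246 - e\<^sup>257 - e\<^sup>347 - e\<^sup>356\<close> is the standard 3-form on \<open>\<real>\<^sup>7\<close>.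
  In the index type \<open>7\<close> the numerals are read modulo 7; \<open>1, \<dots>, 7\<close> are its seven elements.\<close>

type_synonym ix = "7 option"

definition coord_form3 :: "7 \<Rightarrow> 7 \<Rightarrow> 7 \<Rightarrow> real^7 \<Rightarrow> real^7 \<Rightarrow> real^7 \<Rightarrow> real" where
  "coord_form3 i j k u v w =
      u $ i * (v $ j * w $ k - v $ k * w $ j)
    - u $ j * (v $ i * w $ k - v $ k * w $ i)
    + u $ k * (v $ i * w $ j - v $ j * w $ i)"

definition phi0 :: "real^7 \<Rightarrow> real^7 \<Rightarrow> real^7 \<Rightarrow> real" where
  "phi0 u v w =
      coord_form3 1 2 3 u v w + coord_form3 1 4 5 u v w + coord_form3 1 6 7 u v w
    + coord_form3 2 4 6 u v w - coord_form3 2 5 7 u v w - coord_form3 3 4 7 u v w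
    - coord_form3 3 5 6 u v w"

definition gam :: "real^7 \<Rightarrow> ix rmat" where
  "gam u = (\<chi> i j. case i of
      None \<Rightarrow> (case j of None \<Rightarrow> 0 | Some b \<Rightarrow> u $ b)
    | Some a \<Rightarrow> (case j of None \<Rightarrow> - u $ a | Some b \<Rightarrow> - phi0 u (axis b 1) (axis a 1)))"

inductive_set Spin7 :: "ix rmat set" where
  one: "mat 1 \<in> Spin7"
| pair: "norm u = 1 \<Longrightarrow> norm w = 1 \<Longrightarrow> A \<in> Spin7 \<Longrightarrow> gam u ** gam w ** A \<in> Spin7"

text \<open>\<open>G\<^sub>2\<close> is the stabiliser of the unit spinor \<open>(1, 0)\<close>, so that Spin(7)/\<open>G\<^sub>2\<close> is the 7-sphere.\<close>

definition G2 :: "ix rmat set" where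
  "G2 = {g \<in> Spin7. g *v axis None 1 = axis None 1}"

definition spin7 :: "ix rmat set" where
  "spin7 = lie_algebra Spin7"

definition g2 :: "ix rmat set" where
  "g2 = lie_algebra G2"

definition ip :: "ix rmat \<Rightarrow> ix rmat \<Rightarrow> real" where
  "ip X Y = - (3 / 40) * killing spin7 X Y"

definition m7 :: "ix rmat set" where
  "m7 = {X \<in> spin7. \<forall>Y\<in>g2. killing spin7 X Y = 0}"

definition proj_m :: "ix rmat \<Rightarrow> ix rmat" where
  "proj_m X = (THE Y. Y \<in> m7 \<and> X - Y \<in> g2)"

definition phi :: "ix rmat \<Rightarrow> ix rmat \<Rightarrow> ix rmat \<Rightarrow> real" where
  "phi Y Z W = - (3 / 2) * ip (proj_m (bracket Y Z)) W"

definition orthonormal_basis_m :: "(7 \<Rightarrow> ix rmat) \<Rightarrow> bool" where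
  "orthonormal_basis_m I \<longleftrightarrow>
    span (range I) = m7 \<and> (\<forall>a b. ip (I a) (I b) = (if a = b then 1 else 0))"

text \<open>The complexification of the real matrix Lie algebra \<open>spin7\<close>, inside the complex matrices.\<close>

definition spin7C :: "ix cmat set" where
  "spin7C = {complex_mat X + mscale \<i> (complex_mat Y) | X Y. X \<in> spin7 \<and> Y \<in> spin7}"

section \<open>Representations of Spin(7)\<close>

definition spin7_rep :: "(ix rmat \<Rightarrow> 'n::finite cmat) \<Rightarrow> bool" where
  "spin7_rep \<rho> \<longleftrightarrow>
    \<rho> (mat 1) = mat 1 \<and> (\<forall>g\<in>Spin7. \<forall>h\<in>Spin7. \<rho> (g ** h) = \<rho> g ** \<rho> h) \<and>
    continuous_on Spin7 \<rho>"

definition irreducible_spin7_rep :: "(ix rmat \<Rightarrow> 'n::finite cmat) \<Rightarrow> bool" where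
  "irreducible_spin7_rep \<rho> \<longleftrightarrow> spin7_rep \<rho> \<and>
    (\<forall>W. vec.subspace W \<and> (\<forall>g\<in>Spin7. \<forall>w\<in>W. \<rho> g *v w \<in> W) \<longrightarrow> W = {0} \<or> W = UNIV)"

definition diff_rep :: "(ix rmat \<Rightarrow> 'n::finite cmat) \<Rightarrow> ix rmat \<Rightarrow> 'n cmat" where
  "diff_rep \<rho> X = vector_derivative (\<lambda>t. \<rho> (mat_exp (t *\<^sub>R X))) (at 0)"

definition diff_repC :: "(ix rmat \<Rightarrow> 'n::finite cmat) \<Rightarrow> ix cmat \<Rightarrow> 'n cmat" where
  "diff_repC \<rho> Z = diff_rep \<rho> (Re_mat Z) + mscale \<i> (diff_rep \<rho> (Im_mat Z))"

text \<open>
  The matrix \<open>1/2 gam e\<^sub>i gam e\<^sub>j\<close> (\<open>i \<noteq> j\<close>) is the generator of the rotations in the plane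
  \<open>e\<^sub>i, e\<^sub>j\<close>.  The Cartan subalgebra is spanned by the elements \<open>cartan k\<close>, \<open>k = 1, 2, 3\<close>,
  attached to the planes \<open>e\<^sub>1, e\<^sub>2\<close>; \<open>e\<^sub>3, e\<^sub>4\<close>; \<open>e\<^sub>5, e\<^sub>6\<close>; weights are given by
  their values on these elements, i.e. in the coordinates \<open>\<epsilon>\<^sub>1, \<epsilon>\<^sub>2, \<epsilon>\<^sub>3\<close> in which the simple roots
  of \<open>B\<^sub>3\<close> are \<open>\<epsilon>\<^sub>1 - \<epsilon>\<^sub>2, \<epsilon>\<^sub>2 - \<epsilon>\<^sub>3, \<epsilon>\<^sub>3\<close>.  The coroots of these are \<open>cartan 1 - cartan 2\<close>,
  \<open>cartan 2 - cartan 3\<close> and \<open>2 cartan 3\<close>.\<close>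

definition cartan :: "nat \<Rightarrow> ix cmat" where
  "cartan k =
    mscale (\<i> / 2) (complex_mat (gam (axis (of_nat (2 * k - 1)) 1) ** gam (axis (of_nat (2 * k)) 1)))"

definition root_space :: "int \<times> int \<times> int \<Rightarrow> ix cmat set" where
  "root_space = (\<lambda>(a1, a2, a3). {Z \<in> spin7C.
      bracket (cartan 1) Z = mscale (of_int a1) Z \<and>
      bracket (cartan 2) Z = mscale (of_int a2) Z \<and>
      bracket (cartan 3) Z = mscale (of_int a3) Z})"

definition positive_roots :: "(int \<times> int \<times> int) set" where
  "positive_roots =
    {(1, -1, 0), (1, 0, -1), (0, 1, -1), (1, 1, 0), (1, 0, 1), (0, 1, 1), (1, 0, 0), (0, 1, 0), (0, 0, 1)}"

text \<open>Among the irreducible representations, \<open>has_highest_weight \<rho> (a, b, c)\<close> singles out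
  \<open>V\<^bsub>(a,b,c)\<^esub>\<close>, the one whose highest weight has the Dynkin labels \<open>(a, b, c)\<close>.\<close>

definition has_highest_weight :: "(ix rmat \<Rightarrow> 'n::finite cmat) \<Rightarrow> nat \<times> nat \<times> nat \<Rightarrow> bool" where
  "has_highest_weight \<rho> = (\<lambda>(a, b, c). \<exists>v. v \<noteq> 0 \<and>
      (\<forall>\<alpha>\<in>positive_roots. \<forall>Z\<in>root_space \<alpha>. diff_repC \<rho> Z *v v = 0) \<and>
      diff_repC \<rho> (cartan 1 - cartan 2) *v v = of_nat a *s v \<and>
      diff_repC \<rho> (cartan 2 - cartan 3) *v v = of_nat b *s v \<and>
      diff_repC \<rho> (mscale 2 (cartan 3)) *v v = of_nat c *s v)"

section \<open>Spinors with values in \<open>spin(7)\<^sub>\<complex>\<close>\<close>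

text \<open>
  An element \<open>(f, v)\<close> of \<open>\<Delta> = \<complex> \<oplus> m\<^sup>*\<^sub>\<complex>\<close> is stored as the number \<open>f\<close> together with the
  coordinates \<open>v(I\<^sub>a)\<close> of \<open>v\<close>, where \<open>I\<close> is an orthonormal basis of \<open>m\<close>.\<close>

type_synonym delta = "complex \<times> (complex^7)"

definition dscale :: "complex \<Rightarrow> delta \<Rightarrow> delta" where
  "dscale c = (\<lambda>(f, v). (c * f, c *s v))"

definition clifford :: "(7 \<Rightarrow> ix rmat) \<Rightarrow> ix rmat \<Rightarrow> delta \<Rightarrow> delta" where
  "clifford I u = (\<lambda>(f, v).
    (\<Sum>a\<in>UNIV. of_real (ip u (I a)) * v $ a,
     \<chi> b. - f * of_real (ip u (I b)) - (\<Sum>a\<in>UNIV. v $ a * of_real (phi u (I a) (I b)))))"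

text \<open>The Clifford action of \<open>\<phi> = 1/6 \<Sum> \<phi>(I\<^sub>a, I\<^sub>b, I\<^sub>c) I\<^sub>a \<and> I\<^sub>b \<and> I\<^sub>c\<close>.\<close>

definition clifford_phi :: "(7 \<Rightarrow> ix rmat) \<Rightarrow> delta \<Rightarrow> delta" where
  "clifford_phi I s = (\<Sum>a\<in>UNIV. \<Sum>b\<in>UNIV. \<Sum>c\<in>UNIV.
    (phi (I a) (I b) (I c) / 6) *\<^sub>R clifford I (I a) (clifford I (I b) (clifford I (I c) s)))"

text \<open>The action of \<open>G\<^sub>2\<close>: trivial on \<open>\<complex>\<close>, and \<open>(g v)(Y) = v(g\<^sup>-\<^sup>1 Y g)\<close> on \<open>m\<^sup>*\<^sub>\<complex>\<close>.\<close>

definition delta_act :: "(7 \<Rightarrow> ix rmat) \<Rightarrow> ix rmat \<Rightarrow> delta \<Rightarrow> delta" where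
  "delta_act I g = (\<lambda>(f, v).
    (f, \<chi> b. \<Sum>a\<in>UNIV. of_real (ip (matrix_inv g ** I b ** g) (I a)) * v $ a))"

definition Ad :: "ix rmat \<Rightarrow> ix cmat \<Rightarrow> ix cmat" where
  "Ad g X = complex_mat g ** X ** complex_mat (matrix_inv g)"

text \<open>
  The tensor product of \<open>\<Delta>\<close> with the space of all complex matrices is the space of matrices with
  entries in \<open>\<Delta>\<close>, a pure tensor \<open>s \<otimes> X\<close> having the entries \<open>X\<^sub>i\<^sub>j s\<close>.
  \<open>tensor_map A B\<close> is the linear map \<open>A \<otimes> B\<close>.\<close>

type_synonym delta_mat = "delta^ix^ix"

definition tscale :: "complex \<Rightarrow> delta_mat \<Rightarrow> delta_mat" where
  "tscale c \<psi> = (\<chi> i j. dscale c (\<psi> $ i $ j))"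

definition tensor :: "delta \<Rightarrow> ix cmat \<Rightarrow> delta_mat" where
  "tensor s X = (\<chi> i j. dscale (X $ i $ j) s)"

definition mat_unit :: "'n::finite \<Rightarrow> 'n \<Rightarrow> 'n cmat" where
  "mat_unit k l = (\<chi> i j. if i = k \<and> j = l then 1 else 0)"

definition tensor_map ::
  "(delta \<Rightarrow> delta) \<Rightarrow> (ix cmat \<Rightarrow> ix cmat) \<Rightarrow> delta_mat \<Rightarrow> delta_mat" where
  "tensor_map A B \<psi> = (\<Sum>k\<in>UNIV. \<Sum>l\<in>UNIV. tensor (A (\<psi> $ k $ l)) (B (mat_unit k l)))"

definition delta_spin7C :: "delta_mat set" where
  "delta_spin7C = module.span tscale {tensor s X | s X. X \<in> spin7C}"

lemma vector_space_tscale: "vector_space tscale"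
  by unfold_locales
    (auto simp: tscale_def dscale_def vec_eq_iff prod_eq_iff split_beta algebra_simps)

section \<open>The twisted Dirac operator\<close>

definition Hom_G2 ::
  "(7 \<Rightarrow> ix rmat) \<Rightarrow> (ix rmat \<Rightarrow> 'n::finite cmat) \<Rightarrow> (complex^'n \<Rightarrow> delta_mat) set" where
  "Hom_G2 I \<rho> = {\<eta>. Vector_Spaces.linear (*s) tscale \<eta> \<and> (\<forall>v. \<eta> v \<in> delta_spin7C) \<and>
    (\<forall>g\<in>G2. \<forall>v. \<eta> (\<rho> g *v v) = tensor_map (delta_act I g) (Ad g) (\<eta> v))}"

definition dirac ::
  "(7 \<Rightarrow> ix rmat) \<Rightarrow> (ix rmat \<Rightarrow> 'n::finite cmat) \<Rightarrow>
    (complex^'n \<Rightarrow> delta_mat) \<Rightarrow> complex^'n \<Rightarrow> delta_mat" where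
  "dirac I \<rho> \<eta> v =
    - (\<Sum>a\<in>UNIV. tensor_map (clifford I (I a)) id (\<eta> (diff_rep \<rho> (I a) *v v)))
    - (1 / 2) *\<^sub>R tensor_map (clifford_phi I) id (\<eta> v)"

definition dirac_eigenvalue ::
  "(7 \<Rightarrow> ix rmat) \<Rightarrow> (ix rmat \<Rightarrow> 'n::finite cmat) \<Rightarrow> real \<Rightarrow> bool" where
  "dirac_eigenvalue I \<rho> r \<longleftrightarrow>
    (\<exists>\<eta>\<in>Hom_G2 I \<rho>. \<eta> \<noteq> (\<lambda>v. 0) \<and> dirac I \<rho> \<eta> = (\<lambda>v. r *\<^sub>R \<eta> v))"

end

theory Submission
  imports Defs "HOL-Computational_Algebra.Fundamental_Theorem_Algebra"
begin

text \<open>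
  Fix an eigenvector \<open>\<eta>\<close> with eigenvalue \<open>r\<close>, \<open>\<bar>r\<bar> < 5/2\<close>. The operator of the theorem is compared
  with Kostant's cubic Dirac operator \<open>D\<close>, in which the coefficient \<open>1/2\<close> of \<open>\<phi>\<close> is replaced by
  \<open>1/3\<close>. The point of this coefficient is that \<open>D\<^sup>2\<close> contains no first order terms: on equivariant
  maps into \<open>\<Delta> \<otimes> E\<close>, where \<open>E\<close> is one of the two \<open>G\<^sub>2\<close>-summands \<open>m\<close> and \<open>g\<^sub>2\<close> of \<open>spin(7)\<close>, it is the
  scalar \<open>K = C + 49/9 - c\<close> (lemma \<open>kostant_square\<close>). Here \<open>C\<close> is the Casimir eigenvalue of the
  representation and \<open>c\<close> that of \<open>E\<close>, which is \<open>16/3\<close> for \<open>m\<close> and \<open>32/3\<close> for \<open>g\<^sub>2\<close>.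

  Let \<open>P\<close> be the projection of \<open>\<Delta>\<close> to its trivial summand, so that \<open>\<phi> = 8 P - 1\<close>. The equation of
  the eigenvector reads \<open>D \<eta> = (r - 1/6) \<eta> + (4/3) P \<eta>\<close>. Applying \<open>D\<close> once more and then \<open>P\<close>, and
  using \<open>P D P = - (7/3) P\<close> (a vector maps the trivial summand of \<open>\<Delta>\<close> to the other one), one finds
  \<open>K = (r + 1/2)\<^sup>2 - 32/9 < 49/9\<close> when \<open>P \<eta> \<noteq> 0\<close>. When \<open>P \<eta> = 0\<close>, already
  \<open>K = (r - 1/6)\<^sup>2 < 64/9\<close>. In both cases \<open>C < c + 5/3 \<le> 37/3\<close> (lemma \<open>no_small_eigenvalue\<close>).
  On the other hand \<open>C = 4/3 \<langle>\<lambda>, \<lambda> + 2 \<delta>\<rangle>\<close> for the highest weight \<open>\<lambda>\<close>, \<open>2 \<delta> = (5, 3, 1)\<close> being the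
  sum of the positive roots, and for a highest weight outside the list this is at least \<open>37/3\<close>
  (lemmas \<open>highest_weight_casimir\<close>, \<open>casimir_scalar\<close> and \<open>weight_bound\<close>).

  All identities behind \<open>kostant_square\<close> hold between real matrices of size 8. Evaluation at the
  unit spinor \<open>(1, 0)\<close> identifies \<open>m\<close> with \<open>\<real>\<^sup>7\<close> and \<open>\<Delta>\<close> with the complexified spin space, in such a
  way that \<open>u\<close> acts by \<open>gam u\<close> and \<open>G\<^sub>2\<close> by its own matrices. They follow from one formula for a
  product of two Clifford vectors (lemma \<open>cliff_mult\<close>), which contains the Clifford relation,
  together with the antisymmetry of \<open>\<phi>\<^sub>0\<close> and one contraction of its coefficients (lemma \<open>eps_eps\<close>).

  Two bridges lead from the group-theoretic definitions to this algebra. First, Spin(7) is the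
  group of all orthogonal matrices normalising the Clifford vectors, by the argument of Cartan and
  Dieudonne; this makes its Lie algebra computable. Second, a continuous homomorphism is
  differentiable along one-parameter groups, and by the Trotter product formula its derivative is
  linear on the Lie algebra. A highest weight vector is found as a joint eigenvector of
  the Cartan subalgebra on which a regular element has nearly the largest real part of all its
  eigenvalues.\<close>

section \<open>The Banach algebra of square matrices\<close>

text \<open>The multiplication of the type \<open>'a^'n^'n\<close> being componentwise, a copy of this type carries
  the ring structure of matrices and the operator norm. In it the library's \<open>exp\<close> is the matrix
  exponential (lemma \<open>mat_exp_eq\<close>).\<close>
typedef (overloaded) ('a, 'n::finite) sqmat = "UNIV :: ('a^'n^'n) set"
  morphisms to_mat of_mat by simp

setup_lifting type_definition_sqmat

declare of_mat_inverse [simp] to_mat_inverse [simp]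

lemma of_mat_to_mat [simp]: "to_mat (of_mat A) = A"
  by (simp add: of_mat_inverse)

lemma sqmat_eq_iff: "A = B \<longleftrightarrow> to_mat A = to_mat B"
  by (simp add: to_mat_inject)

instantiation sqmat :: (ring_1, finite) ring_1
begin
lift_definition zero_sqmat :: "('a,'b) sqmat" is 0 .
lift_definition one_sqmat :: "('a,'b) sqmat" is "mat 1" .
lift_definition plus_sqmat :: "('a,'b) sqmat \<Rightarrow> ('a,'b) sqmat \<Rightarrow> ('a,'b) sqmat" is "(+)" .
lift_definition minus_sqmat :: "('a,'b) sqmat \<Rightarrow> ('a,'b) sqmat \<Rightarrow> ('a,'b) sqmat" is "(-)" .
lift_definition uminus_sqmat :: "('a,'b) sqmat \<Rightarrow> ('a,'b) sqmat" is "uminus" .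
lift_definition times_sqmat :: "('a,'b) sqmat \<Rightarrow> ('a,'b) sqmat \<Rightarrow> ('a,'b) sqmat" is "(**)" .
instance
proof
  show "(0::('a,'b) sqmat) \<noteq> 1"
    by transfer (auto simp: vec_eq_iff mat_def)
  fix A B C :: "('a,'b) sqmat"
  show "A * B * C = A * (B * C)" by transfer (simp add: matrix_mul_assoc)
  show "1 * A = A" "A * 1 = A" by (transfer, simp)+
  show "(A + B) * C = A * C + B * C"
    by transfer (simp add: vec_eq_iff matrix_matrix_mult_def algebra_simps sum.distrib)
  show "A * (B + C) = A * B + A * C"
    by transfer (simp add: vec_eq_iff matrix_matrix_mult_def algebra_simps sum.distrib)
qed (transfer; simp add: algebra_simps)+
end

instantiation sqmat :: (real_normed_field, finite) real_algebra_1
begin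
lift_definition scaleR_sqmat :: "real \<Rightarrow> ('a,'b) sqmat \<Rightarrow> ('a,'b) sqmat" is "scaleR" .
instance
  by standard (transfer; simp add: vec_eq_iff matrix_matrix_mult_def algebra_simps scaleR_sum_right)+
end

lemma norm_matvec_le:
  fixes A :: "'a::real_normed_field^'n::finite^'m::finite"
  shows "norm (A *v v) \<le> (\<Sum>i\<in>UNIV. \<Sum>j\<in>UNIV. norm (A $ i $ j)) * norm v"
proof -
  have "norm (A *v v) \<le> (\<Sum>i\<in>UNIV. norm ((A *v v) $ i))"
    unfolding norm_vec_def by (rule L2_set_le_sum) simp
  also have "\<dots> \<le> (\<Sum>i\<in>UNIV. (\<Sum>j\<in>UNIV. norm (A $ i $ j)) * norm v)"
  proof (rule sum_mono)
    fix i
    have "norm ((A *v v) $ i) \<le> (\<Sum>j\<in>UNIV. norm (A $ i $ j * v $ j))"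
      by (simp add: matrix_vector_mult_def norm_sum)
    also have "\<dots> \<le> (\<Sum>j\<in>UNIV. norm (A $ i $ j) * norm v)"
      by (intro sum_mono) (simp add: norm_mult mult_left_mono Finite_Cartesian_Product.norm_nth_le)
    finally show "norm ((A *v v) $ i) \<le> (\<Sum>j\<in>UNIV. norm (A $ i $ j)) * norm v"
      by (simp add: sum_distrib_right)
  qed
  finally show ?thesis by (simp add: sum_distrib_right)
qed

lemma matvec_scaleR: "(A::'a::real_normed_field^'n::finite^'m::finite) *v (r *\<^sub>R v) = r *\<^sub>R (A *v v)"
  by (simp add: vec_eq_iff matrix_vector_mult_def scaleR_sum_right)

lemma bounded_linear_matvec: "bounded_linear ((*v) (A::'a::real_normed_field^'n::finite^'m::finite))"
proof (rule bounded_linear_intro)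
  show "norm (A *v v) \<le> norm v * (\<Sum>i\<in>UNIV. \<Sum>j\<in>UNIV. norm (A $ i $ j))" for v
    using norm_matvec_le[of A v] by (simp add: mult.commute)
qed (simp_all add: matrix_vector_right_distrib matvec_scaleR)

instantiation sqmat :: (real_normed_field, finite) real_normed_algebra_1
begin
definition norm_sqmat :: "('a,'b) sqmat \<Rightarrow> real" where
  "norm_sqmat A = onorm ((*v) (to_mat A))"
definition dist_sqmat :: "('a,'b) sqmat \<Rightarrow> ('a,'b) sqmat \<Rightarrow> real" where
  "dist_sqmat A B = norm (A - B)"
definition sgn_sqmat :: "('a,'b) sqmat \<Rightarrow> ('a,'b) sqmat" where
  "sgn_sqmat A = A /\<^sub>R norm A"
definition uniformity_sqmat :: "(('a,'b) sqmat \<times> ('a,'b) sqmat) filter" where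
  "uniformity_sqmat = (INF e\<in>{0 <..}. principal {(x, y). dist x y < e})"
definition open_sqmat :: "('a,'b) sqmat set \<Rightarrow> bool" where
  "open_sqmat U \<longleftrightarrow> (\<forall>x\<in>U. \<forall>\<^sub>F (x', y) in uniformity. x' = x \<longrightarrow> y \<in> U)"
instance
proof
  fix A B :: "('a,'b) sqmat" and r :: real
  show "dist A B = norm (A - B)" "sgn A = A /\<^sub>R norm A"
    "uniformity = (INF e\<in>{0 <..}. principal {(x, y). dist (x::('a,'b) sqmat) y < e})"
    "open U \<longleftrightarrow> (\<forall>x\<in>U. \<forall>\<^sub>F (x', y) in uniformity. x' = x \<longrightarrow> y \<in> U)" for U :: "('a,'b) sqmat set"
    by (simp_all add: dist_sqmat_def sgn_sqmat_def uniformity_sqmat_def open_sqmat_def)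
  show "(norm A = 0) = (A = 0)"
  proof -
    have "norm A = 0 \<longleftrightarrow> (\<forall>v. to_mat A *v v = 0)"
      unfolding norm_sqmat_def by (rule onorm_eq_0[OF bounded_linear_matvec])
    also have "\<dots> \<longleftrightarrow> A = 0"
    proof
      assume *: "\<forall>v. to_mat A *v v = 0"
      have "to_mat A = 0"
        using * unfolding vec_eq_iff[of "to_mat A"]
        by (metis (mono_tags, lifting) * matrix_eq matrix_vector_mult_0)
      then show "A = 0" by (simp add: sqmat_eq_iff zero_sqmat.rep_eq)
    qed (simp add: zero_sqmat.rep_eq)
    finally show ?thesis .
  qed
  have pl: "(*v) (to_mat (A + B)) = (\<lambda>v. to_mat A *v v + to_mat B *v v)"
    by (simp add: plus_sqmat.rep_eq matrix_vector_mult_add_rdistrib fun_eq_iff)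
  show "norm (A + B) \<le> norm A + norm B"
    unfolding norm_sqmat_def pl
    by (rule onorm_triangle[OF bounded_linear_matvec bounded_linear_matvec])
  have sc: "(*v) (to_mat (r *\<^sub>R A)) = (\<lambda>v. r *\<^sub>R (to_mat A *v v))"
    by (simp add: scaleR_sqmat.rep_eq fun_eq_iff vec_eq_iff matrix_vector_mult_def scaleR_sum_right)
  show "norm (r *\<^sub>R A) = \<bar>r\<bar> * norm A"
    unfolding norm_sqmat_def sc by (rule onorm_scaleR[OF bounded_linear_matvec])
  have ti: "(*v) (to_mat (A * B)) = (*v) (to_mat A) \<circ> (*v) (to_mat B)"
    by (simp add: times_sqmat.rep_eq matrix_vector_mul_assoc fun_eq_iff)
  show "norm (A * B) \<le> norm A * norm B"
    unfolding norm_sqmat_def ti by (rule onorm_compose[OF bounded_linear_matvec bounded_linear_matvec])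
  have "(*v) (to_mat (1::('a,'b) sqmat)) = (\<lambda>v. v)"
    by (simp add: one_sqmat.rep_eq fun_eq_iff)
  moreover have "\<exists>x::'a^'b. x \<noteq> 0"
    by (rule exI[of _ "axis undefined 1"]) (simp add: axis_eq_0_iff)
  ultimately show "norm (1::('a,'b) sqmat) = 1"
    unfolding norm_sqmat_def by (simp add: onorm_id) 
qed
end

lemma norm_entry_le: "norm (to_mat A $ i $ j) \<le> norm (A::('a::real_normed_field,'n::finite) sqmat)"
proof -
  have "norm (to_mat A $ i $ j) = norm ((to_mat A *v axis j 1) $ i)"
    by (simp add: matrix_vector_mult_def axis_def if_distrib[of "\<lambda>x. _ * x"] cong: if_cong)
  also have "\<dots> \<le> norm (to_mat A *v axis j 1)"
    by (rule Finite_Cartesian_Product.norm_nth_le)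
  also have "\<dots> \<le> norm A * norm (axis j (1::'a) :: 'a^'n)"
    unfolding norm_sqmat_def by (rule onorm[OF bounded_linear_matvec])
  also have "norm (axis j (1::'a) :: 'a^'n) = 1"
    by (simp add: norm_vec_def L2_set_def axis_def if_distrib[of norm] if_distrib[of "\<lambda>x. x ^ 2"] cong: if_cong)
  finally show ?thesis by simp
qed

lemma norm_le_sum_entries:
  "norm (A::('a::real_normed_field,'n::finite) sqmat) \<le> (\<Sum>i\<in>UNIV. \<Sum>j\<in>UNIV. norm (to_mat A $ i $ j))"
  unfolding norm_sqmat_def by (rule onorm_le[OF norm_matvec_le])

lemma bounded_linear_to_mat:
  "bounded_linear (to_mat :: ('a::real_normed_field,'n::finite) sqmat \<Rightarrow> 'a^'n^'n)"
proof (rule bounded_linear_intro[where K = "real CARD('n) * real CARD('n)"])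
  fix A :: "('a,'n) sqmat"
  have "norm (to_mat A) \<le> (\<Sum>i\<in>UNIV. norm (to_mat A $ i))"
    unfolding norm_vec_def by (rule L2_set_le_sum) simp
  also have "\<dots> \<le> (\<Sum>i\<in>UNIV. \<Sum>j\<in>UNIV. norm (to_mat A $ i $ j))"
    by (intro sum_mono) (simp add: norm_vec_def[of "to_mat A $ _"] L2_set_le_sum)
  also have "\<dots> \<le> (\<Sum>i\<in>(UNIV::'n set). \<Sum>j\<in>(UNIV::'n set). norm A)"
    by (intro sum_mono norm_entry_le)
  finally show "norm (to_mat A) \<le> norm A * (real CARD('n) * real CARD('n))"
    by (simp add: algebra_simps)
qed (simp_all add: plus_sqmat.rep_eq scaleR_sqmat.rep_eq)

lemma bounded_linear_of_mat:
  "bounded_linear (of_mat :: 'a^'n^'n \<Rightarrow> ('a::real_normed_field,'n::finite) sqmat)"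
proof (rule bounded_linear_intro[where K = "real CARD('n) * real CARD('n)"])
  fix A :: "'a^'n^'n"
  have "norm (of_mat A) \<le> (\<Sum>i\<in>UNIV. \<Sum>j\<in>UNIV. norm (A $ i $ j))"
    using norm_le_sum_entries[of "of_mat A"] by simp
  also have "\<dots> \<le> (\<Sum>i\<in>(UNIV::'n set). \<Sum>j\<in>(UNIV::'n set). norm A)"
    by (intro sum_mono) (meson Finite_Cartesian_Product.norm_nth_le order_trans)
  finally show "norm (of_mat A) \<le> norm A * (real CARD('n) * real CARD('n))"
    by (simp add: algebra_simps)
qed (simp_all add: sqmat_eq_iff plus_sqmat.rep_eq scaleR_sqmat.rep_eq)

instance sqmat :: ("{real_normed_field,banach}", finite) banach
proof
  fix X :: "nat \<Rightarrow> ('a,'b) sqmat"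
  assume "Cauchy X"
  then have "Cauchy (\<lambda>n. to_mat (X n))"
    by (rule bounded_linear.Cauchy[OF bounded_linear_to_mat])
  then obtain L where "(\<lambda>n. to_mat (X n)) \<longlonglongrightarrow> L"
    using Cauchy_convergent_iff convergent_def by blast
  then have "(\<lambda>n. of_mat (to_mat (X n))) \<longlonglongrightarrow> (of_mat L :: ('a,'b) sqmat)"
    by (rule bounded_linear.tendsto[OF bounded_linear_of_mat])
  then show "convergent X" by (auto simp: convergent_def)
qed

lemma to_mat_power: "to_mat (A ^ k) = mat_power (to_mat A) k"
  by (induction k) (simp_all add: mat_power_def one_sqmat.rep_eq times_sqmat.rep_eq)

lemma mat_exp_eq: "mat_exp A = to_mat (exp (of_mat A))"
proof -
  have "(\<lambda>k. of_mat A ^ k /\<^sub>R fact k) sums exp (of_mat A :: (real,'a) sqmat)"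
    unfolding exp_def by (rule summable_sums[OF summable_exp_generic])
  then have "(\<lambda>k. to_mat (of_mat A ^ k /\<^sub>R fact k)) sums to_mat (exp (of_mat A :: (real,'a) sqmat))"
    by (rule bounded_linear.sums[OF bounded_linear_to_mat])
  then have "(\<lambda>k. (1 / fact k) *\<^sub>R mat_power A k) sums to_mat (exp (of_mat A))"
    by (simp add: scaleR_sqmat.rep_eq to_mat_power divide_inverse)
  then show ?thesis unfolding mat_exp_def by (rule sums_unique[symmetric])
qed

section \<open>One-parameter groups and the Trotter product formula\<close>
lemma ex_inverse_near_one:
  fixes x :: "'a::{real_normed_algebra_1,banach}"
  assumes "norm (1 - x) < 1"
  shows "\<exists>y. x * y = 1"
proof -
  define z where "z = 1 - x"
  have s: "summable (\<lambda>i. z ^ i)"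
    unfolding z_def using assms by (rule complete_algebra_summable_geometric)
  have "suminf (\<lambda>i. z ^ i) = 1 + suminf (\<lambda>i. z * z ^ i)"
    using suminf_split_head[OF s] by simp
  also have "suminf (\<lambda>i. z * z ^ i) = z * suminf (\<lambda>i. z ^ i)"
    by (rule suminf_mult[OF s])
  finally have "x * suminf (\<lambda>i. z ^ i) = 1"
    by (simp add: z_def algebra_simps)
  then show ?thesis by blast
qed

lemma has_vector_derivative_zero_constant_real:
  fixes f :: "real \<Rightarrow> 'a::real_normed_vector"
  assumes "\<And>t. (f has_vector_derivative 0) (at t)"
  shows "f t = f 0"
proof -
  have "\<And>x. x \<in> UNIV \<Longrightarrow> (f has_derivative (\<lambda>h. 0)) (at x within UNIV)"
    using assms by (simp add: has_vector_derivative_def)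
  then obtain c where "\<And>x. x \<in> UNIV \<Longrightarrow> f x = c"
    using has_derivative_zero_constant[of UNIV f] by auto
  then show ?thesis by simp
qed

lemma exp_scaleR_minus_right: "exp (t *\<^sub>R A) * exp (- (t *\<^sub>R A)) = (1::'a::{real_normed_algebra_1,banach})"
  by (rule exp_minus_inverse)

lemma exp_minus_inverse_left: "exp (- A) * exp A = (1::'a::{real_normed_algebra_1,banach})"
  using exp_minus_inverse[of "- A"] by simp

lemma exp_neg_has_vector_derivative:
  fixes A :: "'a::{real_normed_algebra_1,banach}"
  shows "((\<lambda>t. exp (- (t *\<^sub>R A))) has_vector_derivative - (A * exp (- (t *\<^sub>R A)))) (at t)"
  using exp_scaleR_has_vector_derivative_left[of "- A" t] by simp

lemma has_vector_derivative_at_0_quotient: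
  fixes f :: "real \<Rightarrow> 'a::real_normed_vector"
  assumes "(f has_vector_derivative d) (at 0)"
  shows "((\<lambda>t. (f t - f 0) /\<^sub>R t) \<longlongrightarrow> d) (at 0)"
proof -
  have "((\<lambda>t. norm (f t - f 0 - t *\<^sub>R d) / norm t) \<longlongrightarrow> 0) (at 0)"
    using assms by (simp add: has_vector_derivative_def has_derivative_at)
  moreover have "\<forall>\<^sub>F t in at 0. norm (f t - f 0 - t *\<^sub>R d) / norm t = norm ((f t - f 0) /\<^sub>R t - d)"
    unfolding eventually_at_filter
  proof (intro always_eventually allI impI)
    fix t :: real assume "t \<noteq> 0"
    then have "(f t - f 0) /\<^sub>R t - d = (f t - f 0 - t *\<^sub>R d) /\<^sub>R t"
      by (simp add: scaleR_right_diff_distrib)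
    then show "norm (f t - f 0 - t *\<^sub>R d) / norm t = norm ((f t - f 0) /\<^sub>R t - d)"
      by (simp add: divide_inverse mult.commute)
  qed
  ultimately have "((\<lambda>t. norm ((f t - f 0) /\<^sub>R t - d)) \<longlongrightarrow> 0) (at 0)"
    by (rule Lim_transform_eventually)
  then have "((\<lambda>t. (f t - f 0) /\<^sub>R t - d) \<longlongrightarrow> 0) (at 0)" by (rule tendsto_norm_zero_cancel)
  then show ?thesis by (rule LIM_zero_cancel)
qed

text \<open>Averaging makes \<open>\<sigma>\<close> smooth: if \<open>M\<close> is the integral of \<open>\<sigma>\<close> over a short interval \<open>[0, \<delta>]\<close>, then
  \<open>\<sigma> t * M\<close> is the integral over \<open>[t, t + \<delta>]\<close>, a differentiable function of \<open>t\<close>, and \<open>M\<close> is invertible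
  because \<open>M / \<delta>\<close> is close to \<open>1\<close>.\<close>
lemma one_parameter_group_exp:
  fixes \<sigma> :: "real \<Rightarrow> 'a::{real_normed_algebra_1,banach}"
  assumes cont: "continuous_on UNIV \<sigma>" and one: "\<sigma> 0 = 1"
    and hom: "\<And>s t. \<sigma> (s + t) = \<sigma> s * \<sigma> t"
  obtains A where "\<And>t. \<sigma> t = exp (t *\<^sub>R A)"
proof -
  have shifted: "((\<lambda>s. f (c + s)) has_vector_derivative D) (at x)"
    if "(f has_vector_derivative D) (at (c + x))" for f :: "real \<Rightarrow> 'a" and c x D
  proof -
    have "((\<lambda>s. c + s) has_vector_derivative 0 + 1) (at x)"
      by (intro has_vector_derivative_add has_vector_derivative_const has_vector_derivative_id)
    then have "(f \<circ> (\<lambda>s. c + s) has_vector_derivative (0 + 1) *\<^sub>R D) (at x)"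
      using that by (rule vector_diff_chain_at)
    then show ?thesis by (simp add: o_def)
  qed
  define F where "F x = integral {-3..x} \<sigma>" for x
  have F: "(F has_vector_derivative \<sigma> x) (at x)" if "-3 < x" "x < 3" for x
  proof -
    have "(F has_vector_derivative \<sigma> x) (at x within {-3..3})"
      unfolding F_def
      by (rule integral_has_vector_derivative) (use that cont continuous_on_subset in auto)
    moreover have "x \<in> interior {-3..3}" using that by simp
    ultimately show ?thesis by (metis at_within_interior)
  qed
  have "((\<lambda>x. (F x - F 0) /\<^sub>R x) \<longlongrightarrow> 1) (at 0)"
    using has_vector_derivative_at_0_quotient[OF F[of 0]] one by simp
  then have "\<forall>\<^sub>F x in at 0. dist ((F x - F 0) /\<^sub>R x) 1 < 1"
    by (rule tendstoD) simp
  then obtain d where d: "d > 0" "\<And>x. x \<noteq> 0 \<Longrightarrow> dist x 0 < d \<Longrightarrow> dist ((F x - F 0) /\<^sub>R x) 1 < 1"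
    by (auto simp: eventually_at)
  \<comment> \<open>The bound \<open>1\<close> keeps \<open>t + \<delta>\<close> in the interior of \<open>[-3, 3]\<close>, where \<open>F\<close> is an antiderivative, for \<open>\<bar>t\<bar> < 1\<close>.\<close>
  define \<delta> where "\<delta> = min (d / 2) 1"
  have \<delta>: "0 < \<delta>" "\<delta> < d" "\<delta> \<le> 1" using d(1) by (auto simp: \<delta>_def)
  define M where "M = F \<delta> - F 0"
  have "norm (1 - M /\<^sub>R \<delta>) < 1"
    using d(2)[of \<delta>] \<delta> by (simp add: M_def dist_norm norm_minus_commute)
  then obtain y where "(M /\<^sub>R \<delta>) * y = 1" using ex_inverse_near_one by blast
  then obtain N where N: "M * N = 1"
    by (metis mult_scaleR_left mult_scaleR_right)
  have int: "(\<sigma> has_integral M) {0..\<delta>}"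
    unfolding M_def
  proof (rule fundamental_theorem_of_calculus)
    fix x assume "x \<in> {0..\<delta>}"
    then have "(F has_vector_derivative \<sigma> x) (at x)" using \<delta> by (intro F) auto
    then show "(F has_vector_derivative \<sigma> x) (at x within {0..\<delta>})" by (rule has_vector_derivative_at_within)
  qed (use \<delta> in simp)
  have shift: "F (t + \<delta>) - F t = \<sigma> t * M" if "\<bar>t\<bar> < 1" for t
  proof -
    have "((\<lambda>s. \<sigma> (t + s)) has_integral (F (t + \<delta>) - F (t + 0))) {0..\<delta>}"
    proof (rule fundamental_theorem_of_calculus)
      fix x assume x: "x \<in> {0..\<delta>}"
      have "((\<lambda>s. F (t + s)) has_vector_derivative \<sigma> (t + x)) (at x)"
        using that \<delta> x by (intro shifted F) auto
      then show "((\<lambda>s. F (t + s)) has_vector_derivative \<sigma> (t + x)) (at x within {0..\<delta>})"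
        by (rule has_vector_derivative_at_within)
    qed (use \<delta> in auto)
    moreover have "((\<lambda>s. \<sigma> t * \<sigma> s) has_integral \<sigma> t * M) {0..\<delta>}"
      using has_integral_linear[OF int bounded_linear_mult_right[of "\<sigma> t"]] by (simp add: o_def)
    ultimately show ?thesis
      by (simp add: hom) (metis has_integral_unique)
  qed
  define A where "A = (\<sigma> \<delta> - \<sigma> 0) * N"
  have der0: "(\<sigma> has_vector_derivative A) (at 0)"
  proof (rule has_vector_derivative_transform_within_open[where S="{-1<..<1}"])
    have "((\<lambda>t. F (t + \<delta>)) has_vector_derivative \<sigma> \<delta>) (at 0)"
      using shifted[OF F[of "\<delta> + 0"]] \<delta> by (simp add: add.commute)
    then show "((\<lambda>t. (F (t + \<delta>) - F t) * N) has_vector_derivative A) (at 0)"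
      unfolding A_def
      by (intro bounded_linear.has_vector_derivative[OF bounded_linear_mult_left] has_vector_derivative_diff F) auto
    show "(F (t + \<delta>) - F t) * N = \<sigma> t" if "t \<in> {-1<..<1}" for t
    proof -
      have "(F (t + \<delta>) - F t) * N = \<sigma> t * (M * N)" using that by (subst shift) (auto simp: mult.assoc)
      then show ?thesis by (simp add: N)
    qed
  qed auto
  have der: "(\<sigma> has_vector_derivative \<sigma> t * A) (at t)" for t
  proof -
    have "((\<lambda>s. \<sigma> (- t + s)) has_vector_derivative A) (at t)"
      using der0 by (intro shifted) simp
    then have "((\<lambda>s. \<sigma> t * \<sigma> (- t + s)) has_vector_derivative \<sigma> t * A) (at t)"
      by (intro bounded_linear.has_vector_derivative[OF bounded_linear_mult_right])
    then show ?thesis by (simp add: hom[symmetric])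
  qed
  have "\<sigma> t * exp (- (t *\<^sub>R A)) = \<sigma> 0 * exp (- (0 *\<^sub>R A))" for t
  proof (rule has_vector_derivative_zero_constant_real)
    fix t
    show "((\<lambda>t. \<sigma> t * exp (- (t *\<^sub>R A))) has_vector_derivative 0) (at t)"
      by (rule has_vector_derivative_eq_rhs[OF has_vector_derivative_mult[OF der exp_neg_has_vector_derivative]])
        (simp add: algebra_simps)
  qed
  then have "\<sigma> t * (exp (- (t *\<^sub>R A)) * exp (t *\<^sub>R A)) = exp (t *\<^sub>R A)" for t
    by (simp add: one mult.assoc[symmetric])
  then have "\<sigma> t = exp (t *\<^sub>R A)" for t by (simp add: exp_minus_inverse_left)
  then show thesis by (rule that)
qed

lemma exp_scaleR_inject:
  fixes A B :: "'a::{real_normed_algebra_1,banach}"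
  assumes "\<And>t. exp (t *\<^sub>R A) = exp (t *\<^sub>R B)"
  shows "A = B"
proof -
  have "((\<lambda>t. exp (t *\<^sub>R A)) has_vector_derivative A) (at 0)"
    using exp_scaleR_has_vector_derivative_left[of A 0] by simp
  moreover have "((\<lambda>t. exp (t *\<^sub>R A)) has_vector_derivative B) (at 0)"
    unfolding assms using exp_scaleR_has_vector_derivative_left[of B 0] by simp
  ultimately show ?thesis by (rule vector_derivative_unique_at)
qed

lemma norm_power_diff_le:
  fixes a b :: "'a::real_normed_algebra_1"
  assumes "norm a \<le> K" "norm b \<le> K"
  shows "norm (a ^ n - b ^ n) \<le> real n * K ^ (n - 1) * norm (a - b)"
proof (induction n)
  case (Suc n)
  have K: "K \<ge> 0" using assms(1) norm_ge_zero order_trans by blast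
  have "a ^ Suc n - b ^ Suc n = a * (a ^ n - b ^ n) + (a - b) * b ^ n"
    by (simp add: algebra_simps)
  also have "norm \<dots> \<le> norm a * norm (a ^ n - b ^ n) + norm (a - b) * norm b ^ n"
    by (intro order_trans[OF norm_triangle_ineq] add_mono order_trans[OF norm_mult_ineq]
         mult_left_mono norm_power_ineq) auto
  also have "\<dots> \<le> K * (real n * K ^ (n - 1) * norm (a - b)) + norm (a - b) * K ^ n"
    by (intro add_mono mult_mono Suc power_mono assms) (use K in auto)
  also have "\<dots> = real (Suc n) * K ^ (Suc n - 1) * norm (a - b)"
    by (cases n) (simp_all add: algebra_simps)
  finally show ?case .
qed simp

lemma exp_scaleR_of_nat:
  fixes A :: "'a::{real_normed_algebra_1,banach}"
  shows "exp (real n *\<^sub>R A) = exp A ^ n"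
proof (induction n)
  case (Suc n)
  have "exp (real (Suc n) *\<^sub>R A) = exp (A + real n *\<^sub>R A)" by (simp add: algebra_simps)
  also have "\<dots> = exp A * exp (real n *\<^sub>R A)" by (rule exp_add_commuting) simp
  finally show ?case by (simp add: Suc)
qed simp

text \<open>The curves \<open>exp (t X) exp (t Y)\<close> and \<open>exp (t (X + Y))\<close> agree to first order at \<open>0\<close>, hence differ by
  \<open>o(1/n)\<close> at \<open>t = 1/n\<close>; taking \<open>n\<close>-th powers multiplies the error by \<open>n\<close> and a bounded factor.\<close>
lemma trotter:
  fixes X Y :: "'a::{real_normed_algebra_1,banach}"
  shows "(\<lambda>n. (exp (X /\<^sub>R real n) * exp (Y /\<^sub>R real n)) ^ n) \<longlonglongrightarrow> exp (X + Y)"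
proof -
  define h where "h t = exp (t *\<^sub>R X) * exp (t *\<^sub>R Y) - exp (t *\<^sub>R (X + Y))" for t
  have "(h has_vector_derivative
      (exp (0 *\<^sub>R X) * (Y * exp (0 *\<^sub>R Y)) + X * exp (0 *\<^sub>R X) * exp (0 *\<^sub>R Y)) - (X + Y) * exp (0 *\<^sub>R (X + Y))) (at 0)"
    unfolding h_def
    by (intro has_vector_derivative_diff has_vector_derivative_mult exp_scaleR_has_vector_derivative_left)
  then have "(h has_vector_derivative 0) (at 0)" by (simp add: algebra_simps)
  then have lim: "((\<lambda>t. h t /\<^sub>R t) \<longlongrightarrow> 0) (at 0)"
    using has_vector_derivative_at_0_quotient[of h 0] by (simp add: h_def)
  have inv: "filterlim (\<lambda>n. inverse (real n)) (at 0) sequentially"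
    unfolding filterlim_at
    by (auto intro: tendsto_inverse_0_at_top filterlim_real_sequentially eventually_sequentiallyI[of 1])
  have "(\<lambda>n. h (inverse (real n)) /\<^sub>R inverse (real n)) \<longlonglongrightarrow> 0"
    by (rule filterlim_compose[OF lim inv])
  then have main: "(\<lambda>n. exp (norm X + norm Y) * norm (h (inverse (real n)) /\<^sub>R inverse (real n))) \<longlonglongrightarrow> exp (norm X + norm Y) * 0"
    by (intro tendsto_intros tendsto_norm_zero)
  have bound: "norm ((exp (X /\<^sub>R real n) * exp (Y /\<^sub>R real n)) ^ n - exp (X + Y))
      \<le> exp (norm X + norm Y) * norm (h (inverse (real n)) /\<^sub>R inverse (real n))" if "n \<ge> 1" for n
  proof -
    define K where "K = exp ((norm X + norm Y) / n)"
    have b: "exp ((X + Y) /\<^sub>R real n) ^ n = exp (X + Y)"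
      using exp_scaleR_of_nat[of n "(X + Y) /\<^sub>R real n"] that by simp
    have "norm (exp (X /\<^sub>R real n) * exp (Y /\<^sub>R real n)) \<le> exp (norm (X /\<^sub>R real n)) * exp (norm (Y /\<^sub>R real n))"
      by (intro order_trans[OF norm_mult_ineq] mult_mono norm_exp) auto
    also have "\<dots> = K"
      by (simp add: K_def exp_add[symmetric] divide_inverse algebra_simps)
    finally have 1: "norm (exp (X /\<^sub>R real n) * exp (Y /\<^sub>R real n)) \<le> K" .
    have "norm (exp ((X + Y) /\<^sub>R real n)) \<le> exp (norm ((X + Y) /\<^sub>R real n))" by (rule norm_exp)
    also have "\<dots> \<le> K"
      using norm_triangle_ineq[of X Y] by (simp add: K_def divide_inverse mult.commute mult_left_mono)
    finally have 2: "norm (exp ((X + Y) /\<^sub>R real n)) \<le> K" .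
    have "K ^ (n - 1) \<le> K ^ n"
      by (intro power_increasing) (auto simp: K_def)
    also have "K ^ n = exp (norm X + norm Y)"
      using that by (simp add: K_def exp_of_nat_mult[symmetric])
    finally have K: "K ^ (n - 1) \<le> exp (norm X + norm Y)" .
    have "norm ((exp (X /\<^sub>R real n) * exp (Y /\<^sub>R real n)) ^ n - exp (X + Y))
      \<le> real n * K ^ (n - 1) * norm (h (inverse (real n)))"
      using norm_power_diff_le[OF 1 2, of n] b by (simp add: h_def)
    also have "\<dots> \<le> real n * exp (norm X + norm Y) * norm (h (inverse (real n)))"
      by (intro mult_right_mono mult_left_mono K) auto
    finally show ?thesis by (simp add: mult_ac)
  qed
  from bound have "\<forall>\<^sub>F n in sequentially. norm ((exp (X /\<^sub>R real n) * exp (Y /\<^sub>R real n)) ^ n - exp (X + Y))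
      \<le> exp (norm X + norm Y) * norm (h (inverse (real n)) /\<^sub>R inverse (real n))"
    by (rule eventually_sequentiallyI)
  then have "(\<lambda>n. (exp (X /\<^sub>R real n) * exp (Y /\<^sub>R real n)) ^ n - exp (X + Y)) \<longlonglongrightarrow> 0"
    by (rule Lim_null_comparison) (use main in simp)
  then show ?thesis by (rule LIM_zero_cancel)
qed

lemma exp_conjugate:
  fixes g h x :: "'a::{real_normed_algebra_1,banach}"
  assumes "h * g = 1" "g * h = 1"
  shows "exp (g * x * h) = g * exp x * h"
proof -
  have p: "(g * x * h) ^ n = g * x ^ n * h" for n
  proof (induction n)
    case (Suc n)
    have "(g * x * h) ^ Suc n = (g * x * h) * (g * x ^ n * h)" by (simp only: Suc power_Suc)
    also have "\<dots> = g * x * (h * g) * x ^ n * h" by (simp only: mult.assoc)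
    finally show ?case using assms by (simp add: mult.assoc)
  qed (use assms in simp)
  have "(\<lambda>n. x ^ n /\<^sub>R fact n) sums exp x"
    unfolding exp_def by (rule summable_sums[OF summable_exp_generic])
  then have "(\<lambda>n. g * (x ^ n /\<^sub>R fact n) * h) sums (g * exp x * h)"
    by (intro bounded_linear.sums[OF bounded_linear_mult_left] bounded_linear.sums[OF bounded_linear_mult_right])
  then have 1: "(\<lambda>n. (g * x * h) ^ n /\<^sub>R fact n) sums (g * exp x * h)" by (simp add: p)
  have "(\<lambda>n. (g * x * h) ^ n /\<^sub>R fact n) sums exp (g * x * h)"
    unfolding exp_def by (rule summable_sums[OF summable_exp_generic])
  then show ?thesis using 1 by (rule sums_unique2)
qed

section \<open>The cross product and Clifford multiplication on \<open>\<real>\<^sup>7\<close>\<close>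
lemma exhaust_7: "(x::7) = 1 \<or> x = 2 \<or> x = 3 \<or> x = 4 \<or> x = 5 \<or> x = 6 \<or> x = 7"
proof (induct x)
  case (of_int z)
  then have "z = 0 \<or> z = 1 \<or> z = 2 \<or> z = 3 \<or> z = 4 \<or> z = 5 \<or> z = 6" by simp arith
  then show ?case by auto
qed

lemma UNIV_7: "UNIV = {1,2,3,4,5,6,7::7}"
  using exhaust_7 by auto

lemma sum_7: "sum f (UNIV::7 set) = f 1 + f 2 + f 3 + f 4 + f 5 + f 6 + f 7"
  unfolding UNIV_7 by (simp add: ac_simps)

lemma UNIV_option: "(UNIV::'a option set) = insert None (range Some)"
  by (auto simp: UNIV_option_conv)

lemma sum_option: "sum f (UNIV::'a::finite option set) = f None + (\<Sum>a\<in>UNIV. f (Some a))"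
  unfolding UNIV_option by (subst sum.insert) (auto simp: sum.reindex)

definition cross :: "real^7 \<Rightarrow> real^7 \<Rightarrow> real^7" where
  "cross u v = (\<chi> k. phi0 u v (axis k 1))"

lemma phi0_coords: "phi0 u v w = 
 u$1*(v$2*w$3-v$3*w$2) - u$2*(v$1*w$3-v$3*w$1) + u$3*(v$1*w$2-v$2*w$1) + 
 u$1*(v$4*w$5-v$5*w$4) - u$4*(v$1*w$5-v$5*w$1) + u$5*(v$1*w$4-v$4*w$1) + 
 u$1*(v$6*w$7-v$7*w$6) - u$6*(v$1*w$7-v$7*w$1) + u$7*(v$1*w$6-v$6*w$1) + 
 u$2*(v$4*w$6-v$6*w$4) - u$4*(v$2*w$6-v$6*w$2) + u$6*(v$2*w$4-v$4*w$2) -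
 (u$2*(v$5*w$7-v$7*w$5) - u$5*(v$2*w$7-v$7*w$2) + u$7*(v$2*w$5-v$5*w$2)) -
 (u$3*(v$4*w$7-v$7*w$4) - u$4*(v$3*w$7-v$7*w$3) + u$7*(v$3*w$4-v$4*w$3)) -
 (u$3*(v$5*w$6-v$6*w$5) - u$5*(v$3*w$6-v$6*w$3) + u$6*(v$3*w$5-v$5*w$3))"
  unfolding phi0_def coord_form3_def by simp

lemma inner_7: "(u::real^7) \<bullet> v = u$1 * v$1 + u$2 * v$2 + u$3 * v$3 + u$4 * v$4 + u$5 * v$5 + u$6 * v$6 + u$7 * v$7"
  by (simp add: inner_vec_def sum_7)

lemma all_7: "(\<forall>x::7. P x) \<longleftrightarrow> P 1 \<and> P 2 \<and> P 3 \<and> P 4 \<and> P 5 \<and> P 6 \<and> P 7"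
  by (metis exhaust_7)

lemma gam_simps:
  "gam u $ None $ None = 0" "gam u $ None $ Some b = u $ b" "gam u $ Some a $ None = - u $ a"
  "gam u $ Some a $ Some b = - phi0 u (axis b 1) (axis a 1)"
  by (simp_all add: gam_def)

lemma phi0_axis_axis:
  "phi0 u (axis 1 1) (axis 1 1) = 0"
  "phi0 u (axis 1 1) (axis 2 1) = u $ 3"
  "phi0 u (axis 1 1) (axis 3 1) = - u $ 2"
  "phi0 u (axis 1 1) (axis 4 1) = u $ 5"
  "phi0 u (axis 1 1) (axis 5 1) = - u $ 4"
  "phi0 u (axis 1 1) (axis 6 1) = u $ 7"
  "phi0 u (axis 1 1) (axis 7 1) = - u $ 6"
  "phi0 u (axis 2 1) (axis 1 1) = - u $ 3"
  "phi0 u (axis 2 1) (axis 2 1) = 0"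
  "phi0 u (axis 2 1) (axis 3 1) = u $ 1"
  "phi0 u (axis 2 1) (axis 4 1) = u $ 6"
  "phi0 u (axis 2 1) (axis 5 1) = - u $ 7"
  "phi0 u (axis 2 1) (axis 6 1) = - u $ 4"
  "phi0 u (axis 2 1) (axis 7 1) = u $ 5"
  "phi0 u (axis 3 1) (axis 1 1) = u $ 2"
  "phi0 u (axis 3 1) (axis 2 1) = - u $ 1"
  "phi0 u (axis 3 1) (axis 3 1) = 0"
  "phi0 u (axis 3 1) (axis 4 1) = - u $ 7"
  "phi0 u (axis 3 1) (axis 5 1) = - u $ 6"
  "phi0 u (axis 3 1) (axis 6 1) = u $ 5"
  "phi0 u (axis 3 1) (axis 7 1) = u $ 4"
  "phi0 u (axis 4 1) (axis 1 1) = - u $ 5"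
  "phi0 u (axis 4 1) (axis 2 1) = - u $ 6"
  "phi0 u (axis 4 1) (axis 3 1) = u $ 7"
  "phi0 u (axis 4 1) (axis 4 1) = 0"
  "phi0 u (axis 4 1) (axis 5 1) = u $ 1"
  "phi0 u (axis 4 1) (axis 6 1) = u $ 2"
  "phi0 u (axis 4 1) (axis 7 1) = - u $ 3"
  "phi0 u (axis 5 1) (axis 1 1) = u $ 4"
  "phi0 u (axis 5 1) (axis 2 1) = u $ 7"
  "phi0 u (axis 5 1) (axis 3 1) = u $ 6"
  "phi0 u (axis 5 1) (axis 4 1) = - u $ 1"
  "phi0 u (axis 5 1) (axis 5 1) = 0"
  "phi0 u (axis 5 1) (axis 6 1) = - u $ 3"
  "phi0 u (axis 5 1) (axis 7 1) = - u $ 2"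
  "phi0 u (axis 6 1) (axis 1 1) = - u $ 7"
  "phi0 u (axis 6 1) (axis 2 1) = u $ 4"
  "phi0 u (axis 6 1) (axis 3 1) = - u $ 5"
  "phi0 u (axis 6 1) (axis 4 1) = - u $ 2"
  "phi0 u (axis 6 1) (axis 5 1) = u $ 3"
  "phi0 u (axis 6 1) (axis 6 1) = 0"
  "phi0 u (axis 6 1) (axis 7 1) = u $ 1"
  "phi0 u (axis 7 1) (axis 1 1) = u $ 6"
  "phi0 u (axis 7 1) (axis 2 1) = - u $ 5"
  "phi0 u (axis 7 1) (axis 3 1) = - u $ 4"
  "phi0 u (axis 7 1) (axis 4 1) = u $ 3"
  "phi0 u (axis 7 1) (axis 5 1) = u $ 2"
  "phi0 u (axis 7 1) (axis 6 1) = - u $ 1"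
  "phi0 u (axis 7 1) (axis 7 1) = 0"
  by (simp_all add: phi0_coords axis_def)

lemma cross_coords:
  "cross u v $ 1 = (u $ 2 * v $ 3 - u $ 3 * v $ 2) + (u $ 4 * v $ 5 - u $ 5 * v $ 4) + (u $ 6 * v $ 7 - u $ 7 * v $ 6)"
  "cross u v $ 2 = (u $ 3 * v $ 1 - u $ 1 * v $ 3) + (u $ 4 * v $ 6 - u $ 6 * v $ 4) + (u $ 7 * v $ 5 - u $ 5 * v $ 7)"
  "cross u v $ 3 = (u $ 1 * v $ 2 - u $ 2 * v $ 1) + (u $ 7 * v $ 4 - u $ 4 * v $ 7) + (u $ 6 * v $ 5 - u $ 5 * v $ 6)"
  "cross u v $ 4 = (u $ 5 * v $ 1 - u $ 1 * v $ 5) + (u $ 6 * v $ 2 - u $ 2 * v $ 6) + (u $ 3 * v $ 7 - u $ 7 * v $ 3)"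
  "cross u v $ 5 = (u $ 1 * v $ 4 - u $ 4 * v $ 1) + (u $ 2 * v $ 7 - u $ 7 * v $ 2) + (u $ 3 * v $ 6 - u $ 6 * v $ 3)"
  "cross u v $ 6 = (u $ 7 * v $ 1 - u $ 1 * v $ 7) + (u $ 2 * v $ 4 - u $ 4 * v $ 2) + (u $ 5 * v $ 3 - u $ 3 * v $ 5)"
  "cross u v $ 7 = (u $ 1 * v $ 6 - u $ 6 * v $ 1) + (u $ 5 * v $ 2 - u $ 2 * v $ 5) + (u $ 4 * v $ 3 - u $ 3 * v $ 4)"
  by (simp_all add: cross_def phi0_coords axis_def algebra_simps)

text \<open>The heart of \<open>cliff_mult\<close>, checked coefficient by coefficient for each of the 49 pairs of
  coordinate directions.\<close>
lemma gam_product_Some_Some: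
  "(\<Sum>c\<in>UNIV. phi0 u (axis c 1) (axis a 1) * phi0 v (axis b 1) (axis c 1)) - u $ a * v $ b =
     - (u \<bullet> v) * (if a = b then 1 else 0) - phi0 (cross u v) (axis b 1) (axis a 1)
     - 2 * (u $ a * v $ b - v $ a * u $ b)"
  using exhaust_7[of a] exhaust_7[of b]
  by (elim disjE; hypsubst; simp only: sum_7 phi0_axis_axis cross_coords inner_7; simp add: algebra_simps)

type_synonym spinmat = "(real, ix) sqmat"

definition cliff :: "real^7 \<Rightarrow> spinmat" where "cliff u = of_mat (gam u)"

text \<open>The projection of the spin space onto the line of the spinor fixed by \<open>G\<^sub>2\<close>. An equation
  \<open>X * vac = Y * vac\<close> says that \<open>X\<close> and \<open>Y\<close> agree on this spinor.\<close>
definition vac :: spinmat where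
  "vac = of_mat (\<chi> s t. if s = None \<and> t = None then 1 else 0)"

abbreviation e7 :: "7 \<Rightarrow> real^7" where "e7 i \<equiv> axis i 1"
abbreviation gm :: "7 \<Rightarrow> spinmat" where "gm i \<equiv> cliff (axis i 1)"
definition eps :: "7 \<Rightarrow> 7 \<Rightarrow> 7 \<Rightarrow> real" where "eps i j k = phi0 (axis i 1) (axis j 1) (axis k 1)"

lemma matrix_ix_eqI:
  assumes "A $ None $ None = B $ None $ None" "\<And>b. A $ None $ Some b = B $ None $ Some b"
    "\<And>a. A $ Some a $ None = B $ Some a $ None" "\<And>a b. A $ Some a $ Some b = B $ Some a $ Some b"
  shows "A = (B::'a^ix^ix)"
  unfolding vec_eq_iff by (metis assms not_Some_eq)

lemma sum_delta_mult:
  fixes f :: "'a::finite \<Rightarrow> 'b::semiring_1"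
  shows "(\<Sum>i\<in>UNIV. (if i = a then 1 else 0) * f i) = f a" "(\<Sum>i\<in>UNIV. (if a = i then 1 else 0) * f i) = f a"
    "(\<Sum>i\<in>UNIV. f i * (if i = a then 1 else 0)) = f a" "(\<Sum>i\<in>UNIV. f i * (if a = i then 1 else 0)) = f a"
  by (simp_all add: if_distrib[of "\<lambda>x. x * _"] if_distrib[of "\<lambda>x. _ * x"] cong: if_cong)

lemma vac_entries:
  "to_mat vac $ None $ None = 1" "to_mat vac $ Some a $ t = 0" "to_mat vac $ s $ Some b = 0"
  by (simp_all add: vac_def)

lemma to_mat_cliff: "to_mat (cliff u) = gam u" by (simp add: cliff_def)

lemma times_entries: "to_mat (A * B) $ s $ t = (\<Sum>k\<in>UNIV. to_mat A $ s $ k * to_mat B $ k $ t)"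
  by (simp add: times_sqmat.rep_eq matrix_matrix_mult_def)

lemma entries:
  "to_mat (A + B) $ s $ t = to_mat A $ s $ t + to_mat B $ s $ t"
  "to_mat (A - B) $ s $ t = to_mat A $ s $ t - to_mat B $ s $ t"
  "to_mat (- A) $ s $ t = - to_mat A $ s $ t"
  "to_mat (r *\<^sub>R A) $ s $ t = r *\<^sub>R (to_mat A $ s $ t)"
  "to_mat 1 $ s $ t = (if s = t then 1 else 0)"
  "to_mat 0 $ s $ t = 0"
  by (simp_all add: plus_sqmat.rep_eq minus_sqmat.rep_eq uminus_sqmat.rep_eq one_sqmat.rep_eq zero_sqmat.rep_eq scaleR_sqmat.rep_eq mat_def)

lemma to_mat_sum: "to_mat (sum f A) = (\<Sum>x\<in>A. to_mat (f x))"
  by (induction A rule: infinite_finite_induct) (simp_all add: plus_sqmat.rep_eq zero_sqmat.rep_eq)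

lemma entries_sum: "to_mat (sum f A) $ s $ t = (\<Sum>x\<in>A. to_mat (f x) $ s $ t)"
  by (simp add: to_mat_sum)

lemma vac_mult_entries:
  "to_mat (A * vac) $ s $ t = (if t = None then to_mat A $ s $ None else 0)"
  "to_mat (vac * A) $ s $ t = (if s = None then to_mat A $ None $ t else 0)"
  by (cases t; simp add: times_entries sum_option vac_entries) (cases s; simp add: times_entries sum_option vac_entries)

lemma vac_mid_entries: "to_mat (A * vac * B) $ s $ t = to_mat A $ s $ None * to_mat B $ None $ t"
  by (simp add: mult.assoc times_entries[of A] sum_option vac_mult_entries)

lemma cross_nth: "cross u v $ k = phi0 u v (axis k 1)" by (simp add: cross_def)

lemma phi0_swap: "phi0 v u w = - phi0 u v w" "phi0 u w v = - phi0 u v w" "phi0 w v u = - phi0 u v w"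
  unfolding phi0_coords by (simp_all add: algebra_simps)

lemma phi0_cyc: "phi0 v w u = phi0 u v w" 
  unfolding phi0_coords by (simp add: algebra_simps)

lemma phi0_expand2: "phi0 u v w = (\<Sum>c\<in>UNIV. phi0 u (axis c 1) w * v $ c)"
  unfolding phi0_coords sum_7 by (simp add: axis_def algebra_simps)

lemma phi0_expand3: "phi0 u v w = (\<Sum>c\<in>UNIV. phi0 u v (axis c 1) * w $ c)"
  unfolding phi0_coords sum_7 by (simp add: axis_def algebra_simps)

text \<open>Multiplication of octonions in disguise. The antisymmetric part of the product, a bivector, is
  expressed through the cross product, which is a single vector, and terms of rank at most two
  built from the projection \<open>vac\<close>. Exchanging \<open>u\<close> and \<open>v\<close> and adding gives the Clifford
  relation, and multiplying by \<open>vac\<close> gives the action on the distinguished spinor.\<close>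
lemma cliff_mult:
  "cliff u * cliff v = - (u \<bullet> v) *\<^sub>R 1 + cliff (cross u v)
     - 2 *\<^sub>R (cliff (cross u v) * vac + vac * cliff (cross u v))
     + 2 *\<^sub>R (cliff u * vac * cliff v - cliff v * vac * cliff u)"
  unfolding sqmat_eq_iff
proof (rule matrix_ix_eqI)
  show "to_mat (cliff u * cliff v) $ Some a $ Some b = to_mat (- (u \<bullet> v) *\<^sub>R 1 + cliff (cross u v)
     - 2 *\<^sub>R (cliff (cross u v) * vac + vac * cliff (cross u v))
     + 2 *\<^sub>R (cliff u * vac * cliff v - cliff v * vac * cliff u)) $ Some a $ Some b" for a b
    using gam_product_Some_Some[of u a v b]
    by (simp only: entries vac_mid_entries vac_mult_entries) (simp add: times_entries sum_option to_mat_cliff gam_simps)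
next
  fix a
  have 1: "(\<Sum>b\<in>UNIV. phi0 u (axis b 1) (axis a 1) * v $ b) = phi0 u v (axis a 1)" by (rule phi0_expand2[symmetric])
  show "to_mat (cliff u * cliff v) $ Some a $ None = to_mat (- (u \<bullet> v) *\<^sub>R 1 + cliff (cross u v)
     - 2 *\<^sub>R (cliff (cross u v) * vac + vac * cliff (cross u v))
     + 2 *\<^sub>R (cliff u * vac * cliff v - cliff v * vac * cliff u)) $ Some a $ None"
    by (simp only: entries vac_mid_entries vac_mult_entries) (simp add: times_entries sum_option to_mat_cliff gam_simps cross_nth 1)
next
  fix b
  have 1: "(\<Sum>a\<in>UNIV. u $ a * phi0 v (axis b 1) (axis a 1)) = phi0 u v (axis b 1)"
    using phi0_expand3[of v "axis b 1" u] phi0_cyc[of v "axis b 1" u] by (simp add: mult.commute)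
  show "to_mat (cliff u * cliff v) $ None $ Some b = to_mat (- (u \<bullet> v) *\<^sub>R 1 + cliff (cross u v)
     - 2 *\<^sub>R (cliff (cross u v) * vac + vac * cliff (cross u v))
     + 2 *\<^sub>R (cliff u * vac * cliff v - cliff v * vac * cliff u)) $ None $ Some b"
    by (simp only: entries vac_mid_entries vac_mult_entries) (simp add: times_entries sum_option to_mat_cliff gam_simps cross_nth 1 sum_negf)
next
  show "to_mat (cliff u * cliff v) $ None $ None = to_mat (- (u \<bullet> v) *\<^sub>R 1 + cliff (cross u v)
     - 2 *\<^sub>R (cliff (cross u v) * vac + vac * cliff (cross u v))
     + 2 *\<^sub>R (cliff u * vac * cliff v - cliff v * vac * cliff u)) $ None $ None"
    by (simp only: entries vac_mid_entries vac_mult_entries) (simp add: times_entries sum_option to_mat_cliff gam_simps inner_vec_def sum_negf)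
qed

lemma linear_gam: "linear gam"
proof (rule linearI)
  show "gam (u + v) = gam u + gam v" for u v
    by (rule matrix_ix_eqI) (simp_all add: gam_simps, simp add: phi0_coords algebra_simps)
  show "gam (r *\<^sub>R u) = r *\<^sub>R gam u" for r u
    by (rule matrix_ix_eqI) (simp_all add: gam_simps, simp add: phi0_coords algebra_simps)
qed

lemma linear_cliff: "linear cliff"
  unfolding cliff_def using linear_compose[OF linear_gam bounded_linear.linear[OF bounded_linear_of_mat]]
  by (simp add: o_def)

lemmas cliff_simps = linear_add[OF linear_cliff] linear_diff[OF linear_cliff] linear_neg[OF linear_cliff]
  linear_0[OF linear_cliff] linear_scale[OF linear_cliff]

lemma cliff_expand: "cliff u = (\<Sum>i\<in>UNIV. u $ i *\<^sub>R gm i)"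
proof -
  have "u = (\<Sum>i\<in>UNIV. u $ i *\<^sub>R axis i 1)"
    by (simp add: vec_eq_iff axis_def if_distrib[of "\<lambda>x. _ * x"] cong: if_cong)
  then have "cliff u = cliff (\<Sum>i\<in>UNIV. u $ i *\<^sub>R axis i 1)" by simp
  then show ?thesis by (simp add: linear_sum[OF linear_cliff] cliff_simps)
qed

lemma cross_swap: "cross v u = - cross u v"
  by (simp add: vec_eq_iff cross_nth phi0_swap(1)[of v u])

lemma cliff_anticomm: "cliff u * cliff v + cliff v * cliff u = - (2 * (u \<bullet> v)) *\<^sub>R 1"
  unfolding cliff_mult[of u v] cliff_mult[of v u] cross_swap[of v u] cliff_simps
  by (simp add: algebra_simps inner_commute flip: scaleR_left_distrib)

lemma cliff_square: "cliff u * cliff u = - (u \<bullet> u) *\<^sub>R 1"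
proof -
  have "2 *\<^sub>R (cliff u * cliff u) = 2 *\<^sub>R (- (u \<bullet> u) *\<^sub>R 1)"
    using cliff_anticomm[of u u] by (simp add: scaleR_2)
  then show ?thesis by (metis scaleR_cancel_left zero_neq_numeral)
qed

lemma e7_inner: "e7 i \<bullet> e7 j = (if i = j then 1 else 0)"
  by (simp add: inner_axis_axis)

lemma gm_anticomm: "gm i * gm j + gm j * gm i = - (if i = j then 2 else 0) *\<^sub>R 1"
  by (simp add: cliff_anticomm e7_inner)

lemma gm_square: "gm i * gm i = - 1" by (simp add: cliff_square e7_inner)

lemma vac_vac: "vac * vac = vac"
  unfolding sqmat_eq_iff by (rule matrix_ix_eqI) (simp_all add: vac_mult_entries vac_entries)

lemma vac_cliff_vac: "vac * cliff u * vac = 0"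
  unfolding sqmat_eq_iff by (rule matrix_ix_eqI) (simp_all add: vac_mult_entries entries to_mat_cliff gam_simps)

text \<open>The elements of \<open>m\<close> as matrices. Up to the factor \<open>- 1/6\<close> this is the anticommutator of \<open>u\<close> and
  the Clifford action of \<open>\<phi>\<close> (lemma \<open>phimat_anticomm\<close>), a multiple of the bivector obtained by
  inserting \<open>u\<close> into \<open>\<phi>\<close>. The factor \<open>1/3\<close> and the sign make \<open>msp u\<close> send the distinguished spinor \<open>(1, 0)\<close> to
  \<open>(0, u)\<close>.\<close>
definition msp :: "real^7 \<Rightarrow> spinmat" where
  "msp u = (1/3) *\<^sub>R (cliff u - 4 *\<^sub>R (cliff u * vac + vac * cliff u))"

text \<open>The Clifford action of \<open>\<phi>\<close>, see \<open>sum_eps_cubic\<close>.\<close>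
definition phimat :: spinmat where "phimat = 8 *\<^sub>R vac - 1"

lemma linear_msp: "linear msp"
  by (rule linearI) (simp_all add: msp_def cliff_simps algebra_simps)

lemmas msp_simps = linear_add[OF linear_msp] linear_diff[OF linear_msp] linear_neg[OF linear_msp]
  linear_0[OF linear_msp] linear_scale[OF linear_msp]

lemma msp_vac: "msp u * vac = - (cliff u * vac)"
proof -
  have "msp u * vac = (1/3) *\<^sub>R (cliff u * vac - 4 *\<^sub>R (cliff u * (vac * vac) + vac * cliff u * vac))"
    by (simp add: msp_def algebra_simps)
  also have "\<dots> = (1/3) *\<^sub>R (- 3 *\<^sub>R (cliff u * vac))" unfolding vac_vac vac_cliff_vac by (simp add: algebra_simps flip: scaleR_left_diff_distrib)
  finally show ?thesis by simp
qed

lemma phimat_anticomm: "cliff u * phimat + phimat * cliff u = - 6 *\<^sub>R msp u"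
  by (simp add: phimat_def msp_def algebra_simps scaleR_2)

lemma sum_gm_vac_gm: "(\<Sum>i\<in>UNIV. gm i * vac * gm i) = vac - 1"
  unfolding sqmat_eq_iff
  by (rule matrix_ix_eqI)
    (simp_all add: entries_sum entries vac_mid_entries vac_entries to_mat_cliff gam_simps axis_def sum_delta_mult sum_negf)

lemma eps_eps: "(\<Sum>i\<in>UNIV. \<Sum>j\<in>UNIV. eps i j k * eps i j l) = (if k = l then 6 else 0)"
proof -
  have *: "eps i j k = phi0 (e7 k) (e7 i) (e7 j)" for i j k unfolding eps_def by (metis phi0_cyc)
  have "\<forall>k l. (\<Sum>i\<in>UNIV. \<Sum>j\<in>UNIV. eps i j k * eps i j l) = (if k = l then 6 else 0)"
    unfolding * sum_7 phi0_axis_axis all_7 by (simp add: axis_def)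
  then show ?thesis by blast
qed

text \<open>Both sides are the matrix of \<open>\<phi>\<^sub>0\<close> with the vector \<open>e\<^sub>k\<close> inserted.\<close>
lemma sum_eps_gm_vac_gm:
  "(\<Sum>i\<in>UNIV. \<Sum>j\<in>UNIV. eps i j k *\<^sub>R (gm i * vac * gm j)) = - (gm k - gm k * vac - vac * gm k)"
  unfolding sqmat_eq_iff
proof (rule matrix_ix_eqI)
  fix a b
  have 1: "phi0 (e7 a) (e7 b) (e7 k) = - phi0 (e7 k) (e7 b) (e7 a)" by (rule phi0_swap)
  have 2: "(\<Sum>i\<in>UNIV. \<Sum>j\<in>UNIV. eps i j k * (e7 i $ a * e7 j $ b)) = eps a b k"
    by (simp add: axis_def sum_delta_mult mult.assoc[symmetric])
  show "to_mat (\<Sum>i\<in>UNIV. \<Sum>j\<in>UNIV. eps i j k *\<^sub>R (gm i * vac * gm j)) $ Some a $ Some b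
    = to_mat (- (gm k - gm k * vac - vac * gm k)) $ Some a $ Some b"
    using 2 by (simp add: entries_sum entries vac_mid_entries vac_mult_entries to_mat_cliff gam_simps sum_negf eps_def 1)
qed (simp_all add: entries_sum entries vac_mid_entries vac_mult_entries to_mat_cliff gam_simps)

lemma sqmat_eqI: "(\<And>s t. to_mat A $ s $ t = to_mat B $ s $ t) \<Longrightarrow> A = B"
  by (simp add: sqmat_eq_iff vec_eq_iff)

lemma scaleR_numeral_cancel: "numeral n *\<^sub>R (a::'a::real_vector) = numeral n *\<^sub>R b \<Longrightarrow> a = b"
  by simp

lemmas expand_mult = distrib_left distrib_right left_diff_distrib right_diff_distrib
  mult_scaleR_left mult_scaleR_right minus_mult_left[symmetric] minus_mult_right[symmetric] mult.assoc mult_1_left mult_1_right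

lemma eps_zero: "eps i i k = 0"
  using phi0_swap(1)[of "e7 i" "e7 i"] by (simp add: eps_def)

lemma eps_swap: "eps j i k = - eps i j k" "eps i k j = - eps i j k"
  by (simp_all add: eps_def phi0_swap(1)[of "e7 j" "e7 i"] phi0_swap(2)[of "e7 i" "e7 k"])

lemma cross_basis: "cross (e7 i) (e7 j) = (\<Sum>k\<in>UNIV. eps i j k *\<^sub>R e7 k)"
  by (simp add: vec_eq_iff cross_nth eps_def axis_def sum_delta_mult)

lemma sum_eps_cross: "(\<Sum>i\<in>UNIV. \<Sum>j\<in>UNIV. eps i j k *\<^sub>R cross (e7 i) (e7 j)) = 6 *\<^sub>R e7 k"
  by (simp add: vec_eq_iff cross_nth flip: eps_def)
    (simp add: eps_eps axis_def)

lemma cliff_mult_vac: "cliff u * cliff v * vac = - (u \<bullet> v) *\<^sub>R vac - cliff (cross u v) * vac"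
proof -
  have "cliff u * cliff v * vac = - (u \<bullet> v) *\<^sub>R vac + cliff (cross u v) * vac
     - 2 *\<^sub>R (cliff (cross u v) * (vac * vac) + vac * cliff (cross u v) * vac)
     + 2 *\<^sub>R (cliff u * (vac * cliff v * vac) - cliff v * (vac * cliff u * vac))"
    unfolding cliff_mult[of u v] by (rule sqmat_eqI, simp only: expand_mult entries, (simp add: algebra_simps)?)
  then show ?thesis by (simp add: vac_vac vac_cliff_vac scaleR_2)
qed

lemma vac_cliff_mult: "vac * (cliff u * cliff v) = - (u \<bullet> v) *\<^sub>R vac - vac * cliff (cross u v)"
proof -
  have "vac * (cliff u * cliff v) = - (u \<bullet> v) *\<^sub>R vac + vac * cliff (cross u v)
     - 2 *\<^sub>R ((vac * cliff (cross u v) * vac) + vac * vac * cliff (cross u v))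
     + 2 *\<^sub>R ((vac * cliff u * vac) * cliff v - (vac * cliff v * vac) * cliff u)"
    unfolding cliff_mult[of u v] by (rule sqmat_eqI, simp only: expand_mult entries, (simp add: algebra_simps)?)
  then show ?thesis by (simp add: vac_vac vac_cliff_vac scaleR_2)
qed

text \<open>Inserting \<open>cliff_mult\<close>, only its part antisymmetric in \<open>i\<close>, \<open>j\<close> survives; the contraction
  \<open>eps_eps\<close> turns its cross products into \<open>6 e\<^sub>k\<close>, and \<open>sum_eps_gm_vac_gm\<close> evaluates the rest.\<close>
lemma sum_eps_gm_gm: "(\<Sum>i\<in>UNIV. \<Sum>j\<in>UNIV. eps i j k *\<^sub>R (gm i * gm j)) = 6 *\<^sub>R msp (e7 k)"
proof -
  define L where "L u = cliff u - 2 *\<^sub>R (cliff u * vac + vac * cliff u)" for u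
  have lin: "linear L" by (rule linearI) (simp_all add: L_def cliff_simps algebra_simps)
  define S where "S = (\<Sum>i\<in>UNIV. \<Sum>j\<in>UNIV. eps i j k *\<^sub>R (gm i * vac * gm j))"
  have S': "(\<Sum>i\<in>UNIV. \<Sum>j\<in>UNIV. eps i j k *\<^sub>R (gm j * vac * gm i)) = - S"
  proof -
    have "(\<Sum>i\<in>UNIV. \<Sum>j\<in>UNIV. eps i j k *\<^sub>R (gm j * vac * gm i)) = (\<Sum>i\<in>UNIV. \<Sum>j\<in>UNIV. eps j i k *\<^sub>R (gm i * vac * gm j))"
      by (rule sum.swap)
    also have "\<dots> = (\<Sum>i\<in>UNIV. \<Sum>j\<in>UNIV. - (eps i j k *\<^sub>R (gm i * vac * gm j)))"
      by (intro sum.cong refl) (subst eps_swap(1), simp)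
    finally show ?thesis by (simp add: sum_negf S_def)
  qed
  have t: "eps i j k *\<^sub>R (gm i * gm j) = L (eps i j k *\<^sub>R cross (e7 i) (e7 j))
     + (2 *\<^sub>R (eps i j k *\<^sub>R (gm i * vac * gm j)) - 2 *\<^sub>R (eps i j k *\<^sub>R (gm j * vac * gm i)))" for i j
  proof (cases "i = j")
    case True then show ?thesis by (simp add: eps_zero linear_0[OF lin])
  next
    case False
    then show ?thesis
      unfolding linear_scale[OF lin] cliff_mult[of "e7 i" "e7 j"]
      by (simp add: e7_inner L_def algebra_simps)
  qed
  have "(\<Sum>i\<in>UNIV. \<Sum>j\<in>UNIV. eps i j k *\<^sub>R (gm i * gm j)) = L (6 *\<^sub>R e7 k) + (2 *\<^sub>R S - 2 *\<^sub>R (- S))"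
    unfolding t S'[symmetric]
    unfolding S_def sum_eps_cross[of k, symmetric] linear_sum[OF lin] scaleR_sum_right sum.distrib sum_subtractf ..
  also have "\<dots> = 6 *\<^sub>R L (e7 k) + 4 *\<^sub>R S" by (simp add: linear_scale[OF lin] flip: scaleR_left_distrib)
  also have "\<dots> = 6 *\<^sub>R msp (e7 k)"
    unfolding S_def sum_eps_gm_vac_gm L_def msp_def
    by (rule sqmat_eqI, simp only: expand_mult entries, (simp add: algebra_simps)?)
  finally show ?thesis .
qed

lemma sum_gm_gm: "(\<Sum>i\<in>UNIV. gm i * gm i) = - 7 *\<^sub>R 1"
  by (simp add: gm_square scaleR_conv_of_real)

text \<open>In particular \<open>\<phi>\<close> acts by \<open>7\<close> on the distinguished spinor and by \<open>- 1\<close> on its complement. This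
  also recovers the projection \<open>vac\<close> from the Clifford vectors, which is how commutants are
  computed below.\<close>
lemma sum_eps_cubic:
  "(\<Sum>i\<in>UNIV. \<Sum>j\<in>UNIV. \<Sum>k\<in>UNIV. eps i j k *\<^sub>R (gm i * gm j * gm k)) = 6 *\<^sub>R phimat"
proof -
  have "(\<Sum>i\<in>UNIV. \<Sum>j\<in>UNIV. \<Sum>k\<in>UNIV. eps i j k *\<^sub>R (gm i * gm j * gm k))
     = (\<Sum>k\<in>UNIV. \<Sum>i\<in>UNIV. \<Sum>j\<in>UNIV. eps i j k *\<^sub>R (gm i * gm j * gm k))"
    by (rule trans[OF sum.cong[OF refl sum.swap] sum.swap])
  also have "\<dots> = (\<Sum>k\<in>UNIV. 6 *\<^sub>R msp (e7 k) * gm k)"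
    unfolding sum_eps_gm_gm[symmetric] sum_distrib_right by simp
  also have "\<dots> = 2 *\<^sub>R ((\<Sum>k\<in>UNIV. gm k * gm k) - 4 *\<^sub>R (\<Sum>k\<in>UNIV. gm k * vac * gm k) - 4 *\<^sub>R (vac * (\<Sum>k\<in>UNIV. gm k * gm k)))"
    unfolding msp_def scaleR_sum_right sum_distrib_left sum_subtractf[symmetric]
    by (intro sum.cong refl) (rule sqmat_eqI, simp only: expand_mult entries, (simp add: algebra_simps)?)
  also have "\<dots> = 6 *\<^sub>R phimat"
    unfolding sum_gm_gm sum_gm_vac_gm phimat_def 
    by (rule sqmat_eqI, simp only: expand_mult entries, (simp add: algebra_simps)?)
  finally show ?thesis .
qed

lemma msp_mult: "9 *\<^sub>R (msp u * msp v) = cliff u * cliff v - 4 *\<^sub>R (cliff u * cliff v * vac)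
   - 4 *\<^sub>R (vac * (cliff u * cliff v)) + 8 *\<^sub>R (cliff u * vac * cliff v) - (16 * (u \<bullet> v)) *\<^sub>R vac"
proof -
  have "9 *\<^sub>R (msp u * msp v) = (cliff u - 4 *\<^sub>R (cliff u * vac + vac * cliff u)) * (cliff v - 4 *\<^sub>R (cliff v * vac + vac * cliff v))"
    by (simp add: msp_def)
  also have "\<dots> = cliff u * cliff v - 4 *\<^sub>R (cliff u * cliff v * vac) - 4 *\<^sub>R (cliff u * vac * cliff v)
    - 4 *\<^sub>R (cliff u * vac * cliff v) - 4 *\<^sub>R (vac * (cliff u * cliff v))
    + 16 *\<^sub>R (cliff u * (vac * cliff v * vac)) + 16 *\<^sub>R (cliff u * (vac * vac) * cliff v)
    + 16 *\<^sub>R (vac * (cliff u * cliff v) * vac) + 16 *\<^sub>R ((vac * cliff u * vac) * cliff v)"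
    by (rule sqmat_eqI, simp only: expand_mult entries, (simp add: algebra_simps)?)
  also have "vac * (cliff u * cliff v) * vac = - (u \<bullet> v) *\<^sub>R vac"
    unfolding vac_cliff_mult left_diff_distrib vac_cliff_vac by (simp add: vac_vac)
  finally show ?thesis
    unfolding vac_vac vac_cliff_vac mult_zero_left mult_zero_right scaleR_zero_right
    by (rule trans) (rule sqmat_eqI, simp only: expand_mult entries, (simp add: algebra_simps)?)
qed

text \<open>The bracket of two elements of \<open>m\<close>. The first summand is an element of \<open>spin(7)\<close> with
  \<open>m\<close>-component \<open>2/3 msp (cross u v)\<close>, so that the \<open>m\<close>-component of the bracket is
  \<open>- 2/3 msp (cross u v)\<close>; this is the normalisation of \<open>\<phi>\<close>.\<close>
lemma msp_commutator:
  "msp u * msp v - msp v * msp u = (2/3) *\<^sub>R (cliff u * cliff v + (u \<bullet> v) *\<^sub>R 1) - (4/3) *\<^sub>R msp (cross u v)"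
proof -
  have d: "cliff u * vac * cliff v - cliff v * vac * cliff u = (1/2) *\<^sub>R (cliff u * cliff v + (u \<bullet> v) *\<^sub>R 1 - cliff (cross u v)
     + 2 *\<^sub>R (cliff (cross u v) * vac + vac * cliff (cross u v)))"
    unfolding cliff_mult[of u v] by (rule sqmat_eqI, simp only: expand_mult entries, (simp add: algebra_simps)?)
  have c: "cliff v * cliff u = - (2 * (u \<bullet> v)) *\<^sub>R 1 - cliff u * cliff v"
    using cliff_anticomm[of u v] by (simp add: algebra_simps)
  define x y where "x = cliff (cross u v)" and "y = cliff u * cliff v"
  have "9 *\<^sub>R (msp u * msp v - msp v * msp u) = 2 *\<^sub>R (y + (u \<bullet> v) *\<^sub>R 1) + 8 *\<^sub>R (x * vac + vac * x)
     + 8 *\<^sub>R (cliff u * vac * cliff v - cliff v * vac * cliff u)"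
    unfolding scaleR_right_diff_distrib msp_mult cliff_mult_vac vac_cliff_mult
    unfolding cross_swap[of v u] c cliff_simps inner_commute[of v u] x_def[symmetric] y_def[symmetric]
    by (rule sqmat_eqI, simp only: mult_minus_left mult_minus_right entries, simp)
  also have "\<dots> = 9 *\<^sub>R ((2/3) *\<^sub>R (cliff u * cliff v + (u \<bullet> v) *\<^sub>R 1) - (4/3) *\<^sub>R msp (cross u v))"
    unfolding d msp_def x_def[symmetric] y_def[symmetric]
    by (rule sqmat_eqI, simp only: entries, simp add: field_simps)
  finally show ?thesis by (rule scaleR_numeral_cancel)
qed

lemma sum_msp_msp: "(\<Sum>k\<in>UNIV. msp (e7 k) * msp (e7 k)) = - (5/3) *\<^sub>R 1 - (16/3) *\<^sub>R vac"
proof -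
  have "(\<Sum>k\<in>UNIV. 9 *\<^sub>R (msp (e7 k) * msp (e7 k))) = (\<Sum>k\<in>UNIV. - 1 *\<^sub>R 1 - 8 *\<^sub>R vac + 8 *\<^sub>R (gm k * vac * gm k))"
    by (intro sum.cong refl, simp only: msp_mult gm_square e7_inner)
     (rule sqmat_eqI, simp only: expand_mult entries, (simp add: algebra_simps)?)
  also have "\<dots> = - 7 *\<^sub>R 1 - 56 *\<^sub>R vac + 8 *\<^sub>R (vac - 1)"
    unfolding sum.distrib sum_subtractf scaleR_sum_right[symmetric] sum_gm_vac_gm by (simp add: scaleR_conv_of_real)
  also have "\<dots> = 9 *\<^sub>R (- (5/3) *\<^sub>R 1 - (16/3) *\<^sub>R vac)"
    by (rule sqmat_eqI, simp only: expand_mult entries, (simp add: algebra_simps)?)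
  finally have "9 *\<^sub>R (\<Sum>k\<in>UNIV. msp (e7 k) * msp (e7 k)) = 9 *\<^sub>R (- (5/3) *\<^sub>R 1 - (16/3) *\<^sub>R vac)"
    by (simp only: scaleR_sum_right)
  then show ?thesis by (rule scaleR_numeral_cancel)
qed

section \<open>The Lie algebra \<open>spin(7)\<close> inside the Clifford algebra\<close>
definition tp :: "spinmat \<Rightarrow> spinmat" where "tp X = of_mat (transpose (to_mat X))"
definition tr :: "spinmat \<Rightarrow> real" where "tr X = trace (to_mat X)"

lemma tp_entries: "to_mat (tp X) $ s $ t = to_mat X $ t $ s"
  by (simp add: tp_def transpose_def)

lemma tp_mult: "tp (A * B) = tp B * tp A"
  by (simp add: sqmat_eq_iff tp_def times_sqmat.rep_eq matrix_transpose_mul)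

lemma linear_tp: "linear tp"
  by (rule linearI; rule sqmat_eqI; simp add: tp_entries entries)

lemma linear_tr: "linear tr"
  by (rule linearI) (simp_all add: tr_def trace_def entries sum.distrib sum_distrib_left)

lemmas tp_simps = linear_add[OF linear_tp] linear_diff[OF linear_tp] linear_neg[OF linear_tp]
  linear_0[OF linear_tp] linear_scale[OF linear_tp]
lemmas tr_simps = linear_add[OF linear_tr] linear_diff[OF linear_tr] linear_neg[OF linear_tr]
  linear_0[OF linear_tr] linear_scale[OF linear_tr, simplified]

lemma tp_one: "tp 1 = 1" by (rule sqmat_eqI) (auto simp: tp_entries entries)
lemma tp_vac: "tp vac = vac" by (rule sqmat_eqI) (auto simp: tp_entries vac_def)
lemma tp_tp: "tp (tp X) = X" by (rule sqmat_eqI) (simp add: tp_entries)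

lemma tp_cliff: "tp (cliff u) = - cliff u"
  unfolding sqmat_eq_iff
proof (rule matrix_ix_eqI)
  show "to_mat (tp (cliff u)) $ Some a $ Some b = to_mat (- cliff u) $ Some a $ Some b" for a b
    using phi0_swap(2)[of u "e7 a" "e7 b"] by (simp add: tp_entries entries to_mat_cliff gam_simps)
qed (simp_all add: tp_entries entries to_mat_cliff gam_simps)

lemma tr_mult_commute: "tr (A * B) = tr (B * A)"
  unfolding tr_def times_sqmat.rep_eq by (rule trace_mul_sym)

lemma tr_one: "tr 1 = 8"
  by (simp add: tr_def trace_def entries)

lemma tr_tp: "tr (tp X) = tr X"
  by (simp add: tr_def trace_def tp_entries)

lemma tr_square_zero_imp:
  assumes "tp X = - X" "tr (X * X) = 0"
  shows "X = 0"
proof -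
  have "(\<Sum>s\<in>UNIV. \<Sum>t\<in>UNIV. (to_mat X $ s $ t)\<^sup>2) = tr (X * tp X)"
    by (simp add: tr_def trace_def times_entries tp_entries power2_eq_square)
  also have "\<dots> = 0" using assms by (simp add: tr_simps)
  finally have "\<forall>s. (\<Sum>t\<in>UNIV. (to_mat X $ s $ t)\<^sup>2) = 0"
    by (subst (asm) sum_nonneg_eq_0_iff) (auto intro: sum_nonneg)
  then have "to_mat X $ s $ t = 0" for s t
    by (subst (asm) sum_nonneg_eq_0_iff) auto
  then show ?thesis by (intro sqmat_eqI) (simp add: entries)
qed

lemma tr_cliff_cliff: "tr (cliff u * cliff v) = - 8 * (u \<bullet> v)"
proof -
  have "2 * tr (cliff u * cliff v) = tr (cliff u * cliff v + cliff v * cliff u)"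
    by (simp add: tr_simps tr_mult_commute[of "cliff v"])
  also have "\<dots> = - 16 * (u \<bullet> v)" by (simp add: cliff_anticomm tr_simps tr_one)
  finally show ?thesis by simp
qed

definition brk :: "'a::ring \<Rightarrow> 'a \<Rightarrow> 'a" where "brk X Y = X * Y - Y * X"

text \<open>The Lie algebra of the group of orthogonal matrices that normalise the Clifford vectors.\<close>
definition spinalg :: "spinmat set" where
  "spinalg = {X. tp X = - X \<and> (\<forall>u. \<exists>w. brk X (cliff u) = cliff w)}"

lemma subspace_spinalg: "subspace spinalg"
  unfolding subspace_def
proof (intro conjI ballI allI)
  show "0 \<in> spinalg" by (auto simp: spinalg_def tp_simps brk_def intro!: exI[of _ 0] simp: cliff_simps)
next
  fix X Y assume "X \<in> spinalg" "Y \<in> spinalg"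
  moreover have "brk (X + Y) Z = brk X Z + brk Y Z" for Z by (simp add: brk_def algebra_simps)
  ultimately show "X + Y \<in> spinalg" by (auto simp: spinalg_def tp_simps) (metis cliff_simps(1))
next
  fix c X assume "X \<in> spinalg"
  moreover have "brk (c *\<^sub>R X) Z = c *\<^sub>R brk X Z" for Z by (simp add: brk_def algebra_simps)
  ultimately show "c *\<^sub>R X \<in> spinalg" by (auto simp: spinalg_def tp_simps) (metis cliff_simps(5))
qed

lemma spinalg_tr_zero: "X \<in> spinalg \<Longrightarrow> tr X = 0"
  using tr_tp[of X] by (simp add: spinalg_def tr_simps)

text \<open>The matrix of the rotation of \<open>\<real>\<^sup>7\<close> generated by an element of \<open>spin(7)\<close>, see \<open>brk_gm\<close>; the trace
  form extracts it.\<close>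
definition rot :: "spinmat \<Rightarrow> 7 \<Rightarrow> 7 \<Rightarrow> real" where "rot X a b = tr (X * gm a * gm b) / 4"

lemma rot_swap: "X \<in> spinalg \<Longrightarrow> rot X b a = - rot X a b"
proof -
  assume X: "X \<in> spinalg"
  have "rot X b a + rot X a b = tr (X * (gm a * gm b + gm b * gm a)) / 4"
    by (simp add: rot_def tr_simps algebra_simps)
  also have "\<dots> = 0" unfolding gm_anticomm by (simp add: tr_simps spinalg_tr_zero[OF X])
  finally show ?thesis by simp
qed

definition adv :: "spinmat \<Rightarrow> real^7 \<Rightarrow> real^7" where
  "adv X u = (\<chi> a. \<Sum>b\<in>UNIV. rot X a b * u $ b)"

lemma brk_gm: 
  assumes X: "X \<in> spinalg" shows "brk X (gm b) = (\<Sum>a\<in>UNIV. rot X a b *\<^sub>R gm a)"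
proof -
  obtain w where w: "brk X (gm b) = cliff w" using X unfolding spinalg_def by blast
  have "w $ a = rot X a b" for a
  proof -
    have "- 8 * w $ a = tr (gm a * cliff w)" by (simp add: tr_cliff_cliff inner_axis')
    also have "\<dots> = tr (gm a * X * gm b) - tr (gm a * gm b * X)" by (simp add: w[symmetric] brk_def tr_simps algebra_simps)
    also have "tr (gm a * X * gm b) = tr (X * gm b * gm a)"
      using tr_mult_commute[of "gm a" "X * gm b"] by (simp add: mult.assoc)
    also have "tr (gm a * gm b * X) = tr (X * gm a * gm b)"
      using tr_mult_commute[of "gm a * gm b" X] by (simp add: mult.assoc)
    finally show ?thesis using rot_swap[OF X, of a b] by (simp add: rot_def)
  qed
  then show ?thesis by (simp add: w cliff_expand[of w])
qed

lemma linear_brk: "linear (brk X)" for X :: spinmat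
  by (rule linearI) (simp_all add: brk_def algebra_simps)

lemma linear_brk_left: "linear (\<lambda>X. brk X Y)" for Y :: spinmat
  by (rule linearI) (simp_all add: brk_def algebra_simps)

lemma brk_cliff:
  assumes X: "X \<in> spinalg" shows "brk X (cliff u) = cliff (adv X u)"
proof -
  have "brk X (cliff u) = (\<Sum>b\<in>UNIV. u $ b *\<^sub>R (\<Sum>a\<in>UNIV. rot X a b *\<^sub>R gm a))"
    by (simp add: cliff_expand[of u] linear_sum[OF linear_brk] linear_scale[OF linear_brk] brk_gm[OF X])
  also have "\<dots> = (\<Sum>a\<in>UNIV. (\<Sum>b\<in>UNIV. rot X a b * u $ b) *\<^sub>R gm a)"
    by (simp add: scaleR_sum_right scaleR_sum_left mult.commute) (rule sum.swap)
  also have "\<dots> = cliff (adv X u)" by (subst cliff_expand) (simp add: adv_def)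
  finally show ?thesis .
qed

text \<open>Commuting with the Clifford vectors, \<open>B\<close> commutes with \<open>phimat\<close>, hence with \<open>vac\<close>, and acts on the
  distinguished spinor by a scalar. The Clifford vectors move this spinor everywhere, as
  \<open>sum_gm_vac_gm\<close> shows.\<close>
lemma gm_commutant:
  assumes "\<And>i. B * gm i = gm i * B"
  shows "\<exists>b. B = b *\<^sub>R 1"
proof -
  have "B * (gm i * gm j * gm k) = (gm i * gm j * gm k) * B" for i j k
  proof -
    have "B * (gm i * gm j * gm k) = (B * gm i) * gm j * gm k" by (simp only: mult.assoc)
    also have "\<dots> = gm i * (B * gm j) * gm k" by (simp only: assms mult.assoc)
    also have "\<dots> = gm i * gm j * (B * gm k)" by (simp only: assms mult.assoc)
    finally show ?thesis by (simp only: assms mult.assoc)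
  qed
  then have "B * (\<Sum>i\<in>UNIV. \<Sum>j\<in>UNIV. \<Sum>k\<in>UNIV. eps i j k *\<^sub>R (gm i * gm j * gm k))
     = (\<Sum>i\<in>UNIV. \<Sum>j\<in>UNIV. \<Sum>k\<in>UNIV. eps i j k *\<^sub>R (gm i * gm j * gm k)) * B"
    by (simp add: sum_distrib_left sum_distrib_right)
  then have "B * phimat = phimat * B"
    unfolding sum_eps_cubic by (simp)
  then have "8 *\<^sub>R (B * vac) = 8 *\<^sub>R (vac * B)" by (simp add: phimat_def algebra_simps)
  then have c: "B * vac = vac * B" by (rule scaleR_numeral_cancel)
  define b where "b = to_mat B $ None $ None"
  have "B * vac = B * (vac * vac)" by (simp only: vac_vac)
  also have "\<dots> = vac * B * vac" by (simp only: c mult.assoc[symmetric])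
  finally have "B * vac = vac * B * vac" .
  moreover have "vac * B * vac = b *\<^sub>R vac"
    unfolding sqmat_eq_iff by (rule matrix_ix_eqI) (simp_all add: vac_mult_entries entries vac_entries b_def)
  ultimately have Bv: "B * vac = b *\<^sub>R vac" by simp
  have "B = B * vac - B * (\<Sum>i\<in>UNIV. gm i * vac * gm i)"
    unfolding sum_gm_vac_gm by (simp add: algebra_simps)
  also have "B * (\<Sum>i\<in>UNIV. gm i * vac * gm i) = (\<Sum>i\<in>UNIV. gm i * (B * vac) * gm i)"
    unfolding sum_distrib_left
  proof (intro sum.cong refl)
    fix i
    have "B * (gm i * vac * gm i) = (B * gm i) * vac * gm i" by (simp only: mult.assoc)
    then show "B * (gm i * vac * gm i) = gm i * (B * vac) * gm i" by (simp only: assms mult.assoc)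
  qed
  also have "\<dots> = b *\<^sub>R (\<Sum>i\<in>UNIV. gm i * vac * gm i)" by (simp add: Bv scaleR_sum_right)
  finally have "B = b *\<^sub>R 1" unfolding Bv sum_gm_vac_gm by (simp add: algebra_simps)
  then show ?thesis by blast
qed

text \<open>As \<open>phimat\<close> is of odd degree, \<open>B\<close> anticommutes with it; but no two eigenvalues \<open>7\<close>, \<open>- 1\<close> of
  \<open>phimat\<close> add up to zero.\<close>
lemma gm_anticommutant:
  assumes "\<And>i. B * gm i = - (gm i * B)"
  shows "B = 0"
proof -
  have "B * (gm i * gm j * gm k) = - ((gm i * gm j * gm k) * B)" for i j k
  proof -
    have "B * (gm i * gm j * gm k) = (B * gm i) * gm j * gm k" by (simp add: mult.assoc)
    also have "\<dots> = - (gm i * (B * gm j) * gm k)" by (simp add: assms mult.assoc)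
    also have "\<dots> = gm i * gm j * (B * gm k)" by (simp add: assms mult.assoc)
    finally show ?thesis by (simp add: assms mult.assoc)
  qed
  then have "B * (\<Sum>i\<in>UNIV. \<Sum>j\<in>UNIV. \<Sum>k\<in>UNIV. eps i j k *\<^sub>R (gm i * gm j * gm k))
     = - ((\<Sum>i\<in>UNIV. \<Sum>j\<in>UNIV. \<Sum>k\<in>UNIV. eps i j k *\<^sub>R (gm i * gm j * gm k)) * B)"
    by (simp add: sum_distrib_left sum_distrib_right sum_negf)
  then have "6 *\<^sub>R (B * phimat) = 6 *\<^sub>R (- (phimat * B))"
    unfolding sum_eps_cubic by simp
  then have "B * phimat = - (phimat * B)" by (rule scaleR_numeral_cancel)
  then have *: "2 *\<^sub>R B = 8 *\<^sub>R (B * vac + vac * B)"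
    by (simp add: phimat_def algebra_simps scaleR_2)
  define C where "C = vac * B * vac"
  have 1: "2 *\<^sub>R (vac * B) = 8 *\<^sub>R (C + vac * B)"
    using arg_cong[OF *, of "\<lambda>X. vac * X"] by (simp add: distrib_left mult.assoc[symmetric] vac_vac C_def)
  have 2: "2 *\<^sub>R (B * vac) = 8 *\<^sub>R (B * vac + C)"
    using arg_cong[OF *, of "\<lambda>X. X * vac"] by (simp add: distrib_right mult.assoc vac_vac C_def)
  have "2 *\<^sub>R C = 8 *\<^sub>R (C + C)"
    using arg_cong[OF 1, of "\<lambda>X. X * vac"] by (simp add: distrib_right mult.assoc vac_vac C_def)
  then have C: "C = 0" by (simp flip: scaleR_2)
  have "vac * B = 0" "B * vac = 0" using 1 2 unfolding C by simp_all
  then show ?thesis using * by simp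
qed

text \<open>The bivector \<open>e\<^sub>i \<and> e\<^sub>j\<close>, which is twice the generator of the rotations in the plane of
  \<open>e\<^sub>i\<close>, \<open>e\<^sub>j\<close>. The second summand makes it vanish for \<open>i = j\<close>, so that sums may run over all pairs.\<close>
definition Eg :: "7 \<Rightarrow> 7 \<Rightarrow> spinmat" where
  "Eg i j = gm i * gm j + (if i = j then 1 else 0)"

lemma brk_gmgm: "brk (gm a * gm b) (gm c) = (if a = c then 2 else 0) *\<^sub>R gm b - (if b = c then 2 else 0) *\<^sub>R gm a"
proof -
  have "brk (gm a * gm b) (gm c) = gm a * (gm b * gm c + gm c * gm b) - (gm a * gm c + gm c * gm a) * gm b"
    by (simp add: brk_def algebra_simps)
  also have "\<dots> = gm a * (- (if b = c then 2 else 0) *\<^sub>R 1) - (- (if a = c then 2 else 0) *\<^sub>R 1) * gm b"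
    by (simp only: gm_anticomm)
  finally show ?thesis by simp
qed

lemma Eg_spinalg: "Eg i j \<in> spinalg"
proof (cases "i = j")
  case True
  then have "Eg i j = 0" by (simp add: Eg_def gm_square)
  then show ?thesis using subspace_0[OF subspace_spinalg] by simp
next
  case False
  have "gm j * gm i = - (gm i * gm j)" using gm_anticomm[of i j] False by (simp add: add_eq_0_iff)
  then have "tp (Eg i j) = - Eg i j" using False by (simp add: Eg_def tp_mult tp_cliff)
  moreover have "\<exists>w. brk (Eg i j) (cliff u) = cliff w" for u
  proof -
    have "brk (Eg i j) (cliff u) = (\<Sum>c\<in>UNIV. u $ c *\<^sub>R brk (gm i * gm j) (gm c))"
      using False by (simp add: Eg_def cliff_expand[of u] linear_sum[OF linear_brk] linear_scale[OF linear_brk])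
    also have "\<dots> = cliff (\<Sum>c\<in>UNIV. u $ c *\<^sub>R ((if i = c then 2 else 0) *\<^sub>R e7 j - (if j = c then 2 else 0) *\<^sub>R e7 i))"
      by (simp add: brk_gmgm linear_sum[OF linear_cliff] cliff_simps)
    finally show ?thesis by blast
  qed
  ultimately show ?thesis by (simp add: spinalg_def)
qed

text \<open>Both sides generate the same rotation, so their difference commutes with all Clifford vectors
  and is a scalar; being skew-symmetric, it is zero.\<close>
lemma spinalg_expand:
  assumes X: "X \<in> spinalg"
  shows "X = - (1/4) *\<^sub>R (\<Sum>a\<in>UNIV. \<Sum>b\<in>UNIV. rot X a b *\<^sub>R Eg a b)"
proof -
  define Y where "Y = - (1/4) *\<^sub>R (\<Sum>a\<in>UNIV. \<Sum>b\<in>UNIV. rot X a b *\<^sub>R Eg a b)"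
  have Y: "Y \<in> spinalg" unfolding Y_def
    by (intro subspace_scale subspace_sum subspace_spinalg Eg_spinalg)
  have bE: "brk (Eg a b) (gm c) = (if a = c then 2 else 0) *\<^sub>R gm b - (if b = c then 2 else 0) *\<^sub>R gm a" for a b c
    unfolding brk_gmgm[symmetric] by (simp add: Eg_def brk_def algebra_simps)
  have "brk Y (gm c) = brk X (gm c)" for c
  proof -
    have "brk Y (gm c) = - (1/4) *\<^sub>R (\<Sum>a\<in>UNIV. \<Sum>b\<in>UNIV. rot X a b *\<^sub>R brk (Eg a b) (gm c))"
      unfolding Y_def by (simp only: linear_sum[OF linear_brk_left] linear_scale[OF linear_brk_left])
    also have "(\<Sum>a\<in>UNIV. \<Sum>b\<in>UNIV. rot X a b *\<^sub>R brk (Eg a b) (gm c))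
      = (\<Sum>a\<in>UNIV. \<Sum>b\<in>UNIV. rot X a b *\<^sub>R (if a = c then 2 else 0) *\<^sub>R gm b) - (\<Sum>a\<in>UNIV. \<Sum>b\<in>UNIV. rot X a b *\<^sub>R (if b = c then 2 else 0) *\<^sub>R gm a)"
      by (simp add: bE scaleR_right_diff_distrib sum_subtractf)
    also have "(\<Sum>a\<in>UNIV. \<Sum>b\<in>UNIV. rot X a b *\<^sub>R (if a = c then 2 else 0) *\<^sub>R gm b) = (\<Sum>b\<in>UNIV. \<Sum>a\<in>UNIV. (if a = c then (rot X a b * 2) *\<^sub>R gm b else 0))"
      by (subst sum.swap) (intro sum.cong refl, simp)
    also have "\<dots> = (\<Sum>b\<in>UNIV. (rot X c b * 2) *\<^sub>R gm b)" by simp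
    also have "\<dots> = - (2 *\<^sub>R (\<Sum>b\<in>UNIV. rot X b c *\<^sub>R gm b))"
      by (simp add: rot_swap[OF X, of _ c] scaleR_sum_right sum_negf mult.commute)
    also have "(\<Sum>a\<in>UNIV. \<Sum>b\<in>UNIV. rot X a b *\<^sub>R (if b = c then 2 else 0) *\<^sub>R gm a) = (\<Sum>a\<in>UNIV. \<Sum>b\<in>UNIV. (if b = c then (rot X a b * 2) *\<^sub>R gm a else 0))"
      by (intro sum.cong refl) simp
    also have "\<dots> = 2 *\<^sub>R (\<Sum>b\<in>UNIV. rot X b c *\<^sub>R gm b)" by (simp add: scaleR_sum_right mult.commute)
    finally show ?thesis by (simp add: brk_gm[OF X] flip: scaleR_minus_left scaleR_left_diff_distrib)
  qed
  then have "(Y - X) * gm c = gm c * (Y - X)" for c by (simp add: brk_def algebra_simps)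
  then obtain b where b: "Y - X = b *\<^sub>R 1" using gm_commutant by blast
  have "tp (Y - X) = - (Y - X)" using X Y by (simp add: spinalg_def tp_simps)
  then have "b *\<^sub>R (1::spinmat) = - (b *\<^sub>R 1)" by (simp add: b tp_simps tp_one)
  from arg_cong[OF this, of "\<lambda>M. to_mat M $ None $ None"] have "b = 0" by (simp add: entries)
  then show ?thesis using b by (simp add: Y_def)
qed

section \<open>The subalgebra \<open>g\<^sub>2\<close> and the Casimir tensors\<close>
lemma sum_const_7: "(\<Sum>i\<in>(UNIV::7 set). X) = 7 *\<^sub>R (X::'a::real_vector)"
  by (simp only: sum_constant_scaleR) simp

lemma gm_swap: "i \<noteq> j \<Longrightarrow> gm j * gm i = - (gm i * gm j)"
  by (rule minus_unique[symmetric]) (simp add: gm_anticomm)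

lemma gm_swap_delta: "gm j * gm i = - (gm i * gm j) - (if i = j then 2 else 0) *\<^sub>R 1"
  by (cases "i = j") (simp_all add: gm_swap[of i j] gm_square scaleR_2)

lemma msp_spinalg: "msp u \<in> spinalg"
proof -
  have "6 *\<^sub>R msp (e7 k) = (\<Sum>i\<in>UNIV. \<Sum>j\<in>UNIV. eps i j k *\<^sub>R Eg i j)" for k
    unfolding sum_eps_gm_gm[symmetric] by (intro sum.cong refl) (simp add: Eg_def eps_zero)
  moreover have "(\<Sum>i\<in>UNIV. \<Sum>j\<in>UNIV. eps i j k *\<^sub>R Eg i j) \<in> spinalg" for k
    by (intro subspace_sum subspace_scale subspace_spinalg Eg_spinalg)
  ultimately have 1: "(1/6) *\<^sub>R (6 *\<^sub>R msp (e7 k)) \<in> spinalg" for k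
    by (metis subspace_scale subspace_spinalg)
  have "msp u = msp (\<Sum>i\<in>UNIV. u $ i *\<^sub>R axis i 1)"
    by (rule arg_cong[of _ _ msp]) (simp add: vec_eq_iff axis_def sum_delta_mult)
  also have "\<dots> = (\<Sum>i\<in>UNIV. u $ i *\<^sub>R msp (e7 i))"
    by (simp add: linear_sum[OF linear_msp] msp_simps)
  finally show ?thesis using 1 by (simp add: subspace_sum subspace_scale subspace_spinalg)
qed

text \<open>Moving the second \<open>gm i\<close> past \<open>X\<close> produces \<open>- 7 X\<close> and a sum that \<open>spinalg_expand\<close> recognises as
  \<open>4 X\<close>.\<close>
lemma sum_gm_X_gm:
  assumes X: "X \<in> spinalg"
  shows "(\<Sum>i\<in>UNIV. gm i * X * gm i) = - 3 *\<^sub>R X"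
proof -
  have "gm i * X * gm i = gm i * gm i * X + (\<Sum>a\<in>UNIV. rot X a i *\<^sub>R (gm i * gm a))" for i
  proof -
    have "gm i * X * gm i = gm i * gm i * X + gm i * brk X (gm i)" by (simp add: brk_def algebra_simps)
    also have "gm i * brk X (gm i) = (\<Sum>a\<in>UNIV. rot X a i *\<^sub>R (gm i * gm a))"
      by (simp add: brk_gm[OF X] sum_distrib_left)
    finally show ?thesis .
  qed
  then have "(\<Sum>i\<in>UNIV. gm i * X * gm i) = (\<Sum>i\<in>UNIV. (\<Sum>a\<in>UNIV. rot X a i *\<^sub>R (gm i * gm a)) - X)"
    by (simp add: gm_square)
  also have "\<dots> = - 7 *\<^sub>R X + (\<Sum>i\<in>UNIV. \<Sum>a\<in>UNIV. rot X a i *\<^sub>R (gm i * gm a))"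
    by (simp only: sum_subtractf sum_const_7) simp
  also have "(\<Sum>i\<in>UNIV. \<Sum>a\<in>UNIV. rot X a i *\<^sub>R (gm i * gm a)) = (\<Sum>i\<in>UNIV. \<Sum>a\<in>UNIV. - (rot X i a *\<^sub>R Eg i a))"
  proof (intro sum.cong refl)
    fix i a
    show "rot X a i *\<^sub>R (gm i * gm a) = - (rot X i a *\<^sub>R Eg i a)"
      using rot_swap[OF X, of a i] by (cases "i = a") (auto simp: Eg_def)
  qed
  also have "\<dots> = 4 *\<^sub>R X"
    by (subst (2) spinalg_expand[OF X]) (simp add: sum_negf)
  finally show ?thesis by (simp flip: scaleR_left_diff_distrib)
qed

lemma brk_Eg: "brk (Eg i j) X = brk (gm i * gm j) X"
  by (simp add: Eg_def brk_def algebra_simps)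

text \<open>The Casimir operator of the adjoint representation of \<open>spin(7)\<close>. Written out in Clifford
  products it reduces to two applications of \<open>sum_gm_X_gm\<close>.\<close>
lemma sum_brk_Eg_brk_Eg:
  assumes X: "X \<in> spinalg"
  shows "(\<Sum>i\<in>UNIV. \<Sum>j\<in>UNIV. brk (Eg i j) (brk (Eg i j) X)) = - 80 *\<^sub>R X"
proof -
  have sw: "gm j * gm i = - (gm i * gm j) - (if i = j then 2 else 0) *\<^sub>R 1" for i j
    by (rule gm_swap_delta)
  have sq: "gm i * gm j * (gm i * gm j) = (if i = j then 2 else 0) *\<^sub>R 1 - 1" for i j
  proof -
    have "gm i * gm j * (gm i * gm j) = gm i * (gm j * gm i) * gm j" by (simp only: mult.assoc)
    also have "\<dots> = - (gm i * gm i) * (gm j * gm j) - (if i = j then 2 else 0) *\<^sub>R (gm i * gm j)"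
      unfolding sw[of j i] by (simp add: algebra_simps)
    finally show ?thesis by (simp add: gm_square)
  qed
  have "brk (Eg i j) (brk (Eg i j) X) = ((if i = j then 4 else 0) - 2) *\<^sub>R X
      + 2 *\<^sub>R (gm i * (gm j * X * gm j) * gm i) + (if i = j then 4 else 0) *\<^sub>R (gm i * gm j * X)" for i j
  proof -
    have "brk (Eg i j) (brk (Eg i j) X) = (gm i * gm j * (gm i * gm j)) * X + X * (gm i * gm j * (gm i * gm j))
       - 2 *\<^sub>R (gm i * gm j * X * (gm i * gm j))"
      unfolding brk_Eg unfolding brk_def by (simp add: algebra_simps scaleR_2)
    also have "gm i * gm j * X * (gm i * gm j) = - (gm i * (gm j * X * gm j) * gm i) - (if i = j then 2 else 0) *\<^sub>R (gm i * gm j * X)"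
      using arg_cong[OF sw[of i j], of "\<lambda>M. gm i * gm j * X * M"] by (cases "i = j") (simp_all add: algebra_simps)
    finally show ?thesis unfolding sq
      by (rule trans) (rule sqmat_eqI, simp only: expand_mult entries, simp add: algebra_simps)
  qed
  then have "(\<Sum>i\<in>UNIV. \<Sum>j\<in>UNIV. brk (Eg i j) (brk (Eg i j) X))
     = (\<Sum>i\<in>(UNIV::7 set). \<Sum>j\<in>(UNIV::7 set). ((if i = j then 4 else 0) - 2) *\<^sub>R X)
      + 2 *\<^sub>R (\<Sum>i\<in>UNIV. gm i * (\<Sum>j\<in>UNIV. gm j * X * gm j) * gm i)
      + (\<Sum>i\<in>UNIV. \<Sum>j\<in>UNIV. (if i = j then 4 else 0) *\<^sub>R (gm i * gm j * X))"
    by (simp add: sum.distrib scaleR_sum_right sum_distrib_left sum_distrib_right)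
  also have "(\<Sum>i\<in>(UNIV::7 set). \<Sum>j\<in>(UNIV::7 set). ((if i = j then 4 else 0) - 2) *\<^sub>R X) = - 70 *\<^sub>R X"
    by (simp add: scaleR_left_diff_distrib sum_subtractf if_distrib[of "\<lambda>x. x *\<^sub>R _"] cong: if_cong)
      (simp flip: scaleR_left_diff_distrib)
  also have "(\<Sum>i\<in>UNIV. gm i * (\<Sum>j\<in>UNIV. gm j * X * gm j) * gm i) = 9 *\<^sub>R X"
    unfolding sum_gm_X_gm[OF X] using sum_gm_X_gm[OF X] by (simp add: sum_negf flip: scaleR_sum_right)
  also have "(\<Sum>i\<in>UNIV. \<Sum>j\<in>UNIV. (if i = j then 4 else 0) *\<^sub>R (gm i * gm j * X)) = - 28 *\<^sub>R X"
    by (simp add: if_distrib[of "\<lambda>x. x *\<^sub>R _"] gm_square cong: if_cong)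
  finally show ?thesis by (rule trans) (rule sqmat_eqI, simp add: entries)
qed

text \<open>The \<open>g\<^sub>2\<close>-component of the bracket of \<open>e\<^sub>i\<close> and \<open>e\<^sub>j\<close> in \<open>m\<close>, and at the same time, up to a factor,
  of the bivector \<open>e\<^sub>i \<and> e\<^sub>j\<close>. These 49 elements replace an orthonormal basis of \<open>g\<^sub>2\<close>: three eighths
  of the sum of the \<open>Gg i j \<otimes> Gg i j\<close> is the Casimir tensor of \<open>g\<^sub>2\<close>.\<close>
definition Gg :: "7 \<Rightarrow> 7 \<Rightarrow> spinmat" where
  "Gg i j = (2/3) *\<^sub>R (Eg i j - msp (cross (e7 i) (e7 j)))"

definition g2alg :: "spinmat set" where "g2alg = {X \<in> spinalg. X * vac = 0}"

lemma subspace_g2alg: "subspace g2alg"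
  using subspace_spinalg unfolding subspace_def g2alg_def by (auto simp: distrib_right)

lemma g2alg_vac: "X \<in> g2alg \<Longrightarrow> X * vac = 0" "X \<in> g2alg \<Longrightarrow> vac * X = 0"
proof -
  assume X: "X \<in> g2alg"
  then show 1: "X * vac = 0" by (simp add: g2alg_def)
  have "tp (X * vac) = - (vac * X)" using X by (simp only: tp_mult tp_vac) (simp add: g2alg_def spinalg_def)
  then show "vac * X = 0" using 1 by (simp add: tp_simps)
qed

lemma Eg_decomp: "Eg i j = (3/2) *\<^sub>R Gg i j + msp (cross (e7 i) (e7 j))"
  by (simp add: Gg_def)

lemma Eg_vac: "Eg i j * vac = - (cliff (cross (e7 i) (e7 j)) * vac)"
  by (simp add: Eg_def distrib_right cliff_mult_vac e7_inner)

lemma Gg_g2alg: "Gg i j \<in> g2alg"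
proof -
  have "Gg i j \<in> spinalg" unfolding Gg_def
    by (intro subspace_scale subspace_diff subspace_spinalg Eg_spinalg msp_spinalg)
  then show ?thesis by (simp add: g2alg_def Gg_def left_diff_distrib Eg_vac msp_vac)
qed

text \<open>An element of \<open>g\<^sub>2\<close> annihilates the distinguished spinor, so it commutes with \<open>vac\<close> and acts on
  \<open>msp u\<close> through \<open>u\<close>.\<close>
lemma brk_msp_g2:
  assumes X: "X \<in> g2alg" shows "brk X (msp u) = msp (adv X u)"
proof -
  have c: "brk X (cliff u) = cliff (adv X u)" using X by (simp add: brk_cliff g2alg_def)
  have v: "X * vac = 0" "vac * X = 0" using g2alg_vac[OF X] by auto
  have "brk X (cliff u * vac) = brk X (cliff u) * vac" using v by (simp add: brk_def algebra_simps)
  moreover have "brk X (vac * cliff u) = vac * brk X (cliff u)" using v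
    by (simp add: brk_def algebra_simps) (simp add: v flip: mult.assoc)
  ultimately show ?thesis
    by (simp add: msp_def linear_add[OF linear_brk] linear_diff[OF linear_brk] linear_scale[OF linear_brk] c)
qed

lemma Eg_swap: "Eg j i = - Eg i j"
  by (cases "i = j") (auto simp: Eg_def gm_square gm_swap[of i j])

lemma sum_eps_Gg: "(\<Sum>i\<in>UNIV. \<Sum>j\<in>UNIV. eps i j k *\<^sub>R Gg i j) = 0"
proof -
  have 1: "(\<Sum>i\<in>UNIV. \<Sum>j\<in>UNIV. eps i j k *\<^sub>R Eg i j) = 6 *\<^sub>R msp (e7 k)"
    unfolding sum_eps_gm_gm[symmetric] by (intro sum.cong refl) (simp add: Eg_def eps_zero)
  have 2: "(\<Sum>i\<in>UNIV. \<Sum>j\<in>UNIV. eps i j k *\<^sub>R msp (cross (e7 i) (e7 j))) = 6 *\<^sub>R msp (e7 k)"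
    using arg_cong[OF sum_eps_cross[of k], of msp] by (simp add: linear_sum[OF linear_msp] msp_simps)
  have "(\<Sum>i\<in>UNIV. \<Sum>j\<in>UNIV. eps i j k *\<^sub>R Gg i j) = (2/3) *\<^sub>R ((\<Sum>i\<in>UNIV. \<Sum>j\<in>UNIV. eps i j k *\<^sub>R Eg i j)
     - (\<Sum>i\<in>UNIV. \<Sum>j\<in>UNIV. eps i j k *\<^sub>R msp (cross (e7 i) (e7 j))))"
    unfolding sum_subtractf[symmetric] scaleR_sum_right Gg_def
    by (intro sum.cong refl) (simp add: scaleR_right_diff_distrib mult.commute)
  then show ?thesis by (simp add: 1 2)
qed

text \<open>Expanding the cross product in coordinates moves its coefficients to the other argument.\<close>
lemma bilinear_eps_sum:
  assumes "bilinear (B :: spinmat \<Rightarrow> spinmat \<Rightarrow> 'v::real_vector)"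
  shows "(\<Sum>i\<in>UNIV. \<Sum>j\<in>UNIV. B (msp (cross (e7 i) (e7 j))) (Y i j)) = (\<Sum>k\<in>UNIV. B (msp (e7 k)) (\<Sum>i\<in>UNIV. \<Sum>j\<in>UNIV. eps i j k *\<^sub>R Y i j))"
    "(\<Sum>i\<in>UNIV. \<Sum>j\<in>UNIV. B (Y i j) (msp (cross (e7 i) (e7 j)))) = (\<Sum>k\<in>UNIV. B (\<Sum>i\<in>UNIV. \<Sum>j\<in>UNIV. eps i j k *\<^sub>R Y i j) (msp (e7 k)))"
proof -
  have l: "linear (B x)" "linear (\<lambda>x. B x y)" for x y using assms by (auto simp: bilinear_def)
  have m: "msp (cross (e7 i) (e7 j)) = (\<Sum>k\<in>UNIV. eps i j k *\<^sub>R msp (e7 k))" for i j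
    by (simp add: cross_basis linear_sum[OF linear_msp] msp_simps)
  have r: "(\<Sum>i\<in>UNIV. \<Sum>j\<in>UNIV. \<Sum>k\<in>UNIV. f i j k) = (\<Sum>k\<in>UNIV. \<Sum>i\<in>UNIV. \<Sum>j\<in>UNIV. f i j k)" for f :: "7 \<Rightarrow> 7 \<Rightarrow> 7 \<Rightarrow> 'v"
    by (rule trans[OF sum.cong[OF refl sum.swap] sum.swap])
  show "(\<Sum>i\<in>UNIV. \<Sum>j\<in>UNIV. B (msp (cross (e7 i) (e7 j))) (Y i j)) = (\<Sum>k\<in>UNIV. B (msp (e7 k)) (\<Sum>i\<in>UNIV. \<Sum>j\<in>UNIV. eps i j k *\<^sub>R Y i j))"
    by (simp only: m linear_sum[OF l(1)] linear_sum[OF l(2)] linear_scale[OF l(1)] linear_scale[OF l(2)]) (rule r)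
  show "(\<Sum>i\<in>UNIV. \<Sum>j\<in>UNIV. B (Y i j) (msp (cross (e7 i) (e7 j)))) = (\<Sum>k\<in>UNIV. B (\<Sum>i\<in>UNIV. \<Sum>j\<in>UNIV. eps i j k *\<^sub>R Y i j) (msp (e7 k)))"
    by (simp only: m linear_sum[OF l(1)] linear_sum[OF l(2)] linear_scale[OF l(1)] linear_scale[OF l(2)]) (rule r)
qed

text \<open>The Casimir tensor of \<open>spin(7)\<close> is the sum of that of \<open>g\<^sub>2\<close> and that of \<open>m\<close>: the mixed terms
  vanish by \<open>sum_eps_Gg\<close>. Formulating it for an arbitrary bilinear map serves the spin
  representation, the adjoint representation and an arbitrary representation alike.\<close>
lemma casimir_split:
  assumes B: "bilinear (B :: spinmat \<Rightarrow> spinmat \<Rightarrow> 'v::real_vector)"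
  shows "(\<Sum>i\<in>UNIV. \<Sum>j\<in>UNIV. B (Eg i j) (Eg i j))
    = (9/4) *\<^sub>R (\<Sum>i\<in>UNIV. \<Sum>j\<in>UNIV. B (Gg i j) (Gg i j)) + 6 *\<^sub>R (\<Sum>k\<in>UNIV. B (msp (e7 k)) (msp (e7 k)))"
proof -
  have l: "linear (B x)" "linear (\<lambda>x. B x y)" for x y using B by (auto simp: bilinear_def)
  have mm: "(\<Sum>i\<in>UNIV. \<Sum>j\<in>UNIV. eps i j k *\<^sub>R msp (cross (e7 i) (e7 j))) = 6 *\<^sub>R msp (e7 k)" for k
    using arg_cong[OF sum_eps_cross[of k], of msp] by (simp add: linear_sum[OF linear_msp] msp_simps)
  have "(\<Sum>i\<in>UNIV. \<Sum>j\<in>UNIV. B (Eg i j) (Eg i j))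
    = (9/4) *\<^sub>R (\<Sum>i\<in>UNIV. \<Sum>j\<in>UNIV. B (Gg i j) (Gg i j))
    + (3/2) *\<^sub>R (\<Sum>i\<in>UNIV. \<Sum>j\<in>UNIV. B (Gg i j) (msp (cross (e7 i) (e7 j))))
    + (3/2) *\<^sub>R (\<Sum>i\<in>UNIV. \<Sum>j\<in>UNIV. B (msp (cross (e7 i) (e7 j))) (Gg i j))
    + (\<Sum>i\<in>UNIV. \<Sum>j\<in>UNIV. B (msp (cross (e7 i) (e7 j))) (msp (cross (e7 i) (e7 j))))"
    unfolding Eg_decomp scaleR_sum_right sum.distrib[symmetric]
    by (simp add: linear_add[OF l(1)] linear_add[OF l(2)] linear_scale[OF l(1)] linear_scale[OF l(2)] scaleR_right_distrib add_ac)
  then show ?thesis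
    by (simp add: bilinear_eps_sum[OF B] sum_eps_Gg mm linear_0[OF l(1)] linear_0[OF l(2)] linear_scale[OF l(1)] scaleR_sum_right)
qed

text \<open>The part of \<open>D\<^sup>2\<close> that involves the \<open>g\<^sub>2\<close>-component of the bracket of \<open>m\<close>: the bivector of \<open>e\<^sub>j\<close>, \<open>e\<^sub>i\<close>
  acting on spinors is paired with \<open>g\<^sub>2\<close>, so only its \<open>g\<^sub>2\<close>-component contributes.\<close>
lemma clifford_bivector_casimir:
  assumes B: "bilinear (B :: spinmat \<Rightarrow> spinmat \<Rightarrow> 'v::real_vector)"
  shows "(\<Sum>i\<in>UNIV. \<Sum>j\<in>UNIV. B (gm j * gm i) (Gg i j)) = - (3/2) *\<^sub>R (\<Sum>i\<in>UNIV. \<Sum>j\<in>UNIV. B (Gg i j) (Gg i j))"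
proof -
  have l: "linear (B x)" "linear (\<lambda>x. B x y)" for x y using B by (auto simp: bilinear_def)
  have G0: "Gg i i = 0" for i
  proof -
    have "cross (e7 i) (e7 i) = 0" by (simp add: cross_basis eps_zero)
    then show ?thesis by (simp add: Gg_def Eg_def gm_square msp_simps)
  qed
  have "B (gm j * gm i) (Gg i j) = - ((3/2) *\<^sub>R B (Gg i j) (Gg i j) + B (msp (cross (e7 i) (e7 j))) (Gg i j))" for i j
  proof (cases "i = j")
    case True then show ?thesis by (simp add: G0 linear_0[OF l(1)])
  next
    case False
    then have "gm j * gm i = - Eg i j" using Eg_swap[of j i] by (simp add: Eg_def)
    then have "gm j * gm i = - ((3/2) *\<^sub>R Gg i j + msp (cross (e7 i) (e7 j)))" by (simp only: Eg_decomp)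
    then show ?thesis by (simp only: linear_neg[OF l(2)] linear_add[OF l(2)] linear_scale[OF l(2)])
  qed
  then show ?thesis
    by (simp add: sum_negf sum_subtractf sum.distrib bilinear_eps_sum[OF B] sum_eps_Gg linear_0[OF l(1)] scaleR_sum_right)
qed

lemma bilinear_times: "bilinear ((*) :: spinmat \<Rightarrow> spinmat \<Rightarrow> spinmat)"
  unfolding bilinear_def by (auto intro!: linearI simp: algebra_simps)

lemma sum_Gg_square: "(\<Sum>i\<in>UNIV. \<Sum>j\<in>UNIV. Gg i j * Gg i j) = (128/9) *\<^sub>R (vac - 1)"
proof -
  have "Eg i j * Eg i j = (if i = j then 1 else 0) *\<^sub>R 1 - 1" for i j
  proof (cases "i = j")
    case True then show ?thesis by (simp add: Eg_def gm_square)
  next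
    case False
    have "gm i * gm j * (gm i * gm j) = gm i * (gm j * gm i) * gm j" by (simp only: mult.assoc)
    also have "gm j * gm i = - (gm i * gm j)" using False by (rule gm_swap)
    also have "gm i * - (gm i * gm j) * gm j = - (gm i * gm i) * (gm j * gm j)" by (simp add: mult.assoc)
    finally show ?thesis using False by (simp add: Eg_def gm_square)
  qed
  then have "(\<Sum>i\<in>UNIV. \<Sum>j\<in>UNIV. Eg i j * Eg i j) = - 42 *\<^sub>R 1"
    by (simp add: sum_subtractf if_distrib[of "\<lambda>x. x *\<^sub>R _"] cong: if_cong) (simp add: scaleR_conv_of_real)
  with casimir_split[OF bilinear_times] have
    "(9/4) *\<^sub>R (\<Sum>i\<in>UNIV. \<Sum>j\<in>UNIV. Gg i j * Gg i j) = - 42 *\<^sub>R 1 - 6 *\<^sub>R (- (5/3) *\<^sub>R 1 - (16/3) *\<^sub>R vac)"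
    unfolding sum_msp_msp by (simp add: algebra_simps)
  then have "(4/9) *\<^sub>R ((9/4) *\<^sub>R (\<Sum>i\<in>UNIV. \<Sum>j\<in>UNIV. Gg i j * Gg i j)) = (4/9) *\<^sub>R (- 42 *\<^sub>R 1 - 6 *\<^sub>R (- (5/3) *\<^sub>R 1 - (16/3) *\<^sub>R vac))"
    by simp
  then show ?thesis by simp (rule sqmat_eqI, simp only: entries, simp add: field_simps)
qed

section \<open>Spin(7) as the normaliser of the Clifford vectors\<close>
definition spingrp :: "spinmat set" where "spingrp = {A. to_mat A \<in> Spin7}"

definition normaliser :: "spinmat set" where
  "normaliser = {A. tp A * A = 1 \<and> A * tp A = 1 \<and> (\<forall>v. \<exists>w. A * cliff v * tp A = cliff w)}"

lemma one_spingrp: "1 \<in> spingrp"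
  by (simp add: spingrp_def one_sqmat.rep_eq Spin7.one)

lemma pair_spingrp: "norm u = 1 \<Longrightarrow> norm w = 1 \<Longrightarrow> A \<in> spingrp \<Longrightarrow> cliff u * cliff w * A \<in> spingrp"
  by (simp add: spingrp_def times_sqmat.rep_eq to_mat_cliff Spin7.pair)

lemma spingrp_induct [consumes 1, case_names one pair]:
  assumes "A \<in> spingrp" "P 1"
    "\<And>u w A. norm u = 1 \<Longrightarrow> norm w = 1 \<Longrightarrow> A \<in> spingrp \<Longrightarrow> P A \<Longrightarrow> P (cliff u * cliff w * A)"
  shows "P A"
proof -
  have "M \<in> Spin7 \<Longrightarrow> P (of_mat M)" for M
  proof (induction rule: Spin7.induct)
    case one
    then show ?case using assms(2) by (simp add: one_sqmat_def)
  next
    case (pair u w A)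
    have "of_mat (gam u ** gam w ** A) = cliff u * cliff w * of_mat A"
      by (simp add: sqmat_eq_iff times_sqmat.rep_eq to_mat_cliff)
    then show ?case using assms(3)[of u w "of_mat A"] pair by (simp add: spingrp_def)
  qed
  then show ?thesis using assms(1) by (metis spingrp_def mem_Collect_eq to_mat_inverse)
qed

lemma unit_cliff_square: "norm u = 1 \<Longrightarrow> cliff u * cliff u = - 1"
  by (simp add: cliff_square norm_eq_1)

lemma cliff_reflect: "norm u = 1 \<Longrightarrow> cliff u * cliff v * cliff u = cliff (v - (2 * (u \<bullet> v)) *\<^sub>R u)"
proof -
  assume u: "norm u = 1"
  have "cliff u * cliff v * cliff u = (cliff u * cliff v + cliff v * cliff u) * cliff u - cliff v * (cliff u * cliff u)"
    by (simp add: algebra_simps)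
  then show ?thesis unfolding unit_cliff_square[OF u] cliff_anticomm cliff_simps by simp
qed

lemma cliff_normaliser: "norm u = 1 \<Longrightarrow> cliff u \<in> normaliser"
  unfolding normaliser_def
proof (intro CollectI conjI allI)
  assume u: "norm u = 1"
  show "tp (cliff u) * cliff u = 1" "cliff u * tp (cliff u) = 1"
    by (simp_all add: tp_cliff unit_cliff_square[OF u])
  fix v
  have "cliff u * cliff v * tp (cliff u) = cliff (- (v - (2 * (u \<bullet> v)) *\<^sub>R u))"
    unfolding linear_neg[OF linear_cliff] cliff_reflect[OF u, symmetric] tp_cliff by simp
  then show "\<exists>w. cliff u * cliff v * tp (cliff u) = cliff w" by blast
qed

lemma normaliser_mult: 
  assumes "A \<in> normaliser" "B \<in> normaliser" shows "A * B \<in> normaliser"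
  unfolding normaliser_def
proof (intro CollectI conjI allI)
  have A: "tp A * A = 1" "A * tp A = 1" and B: "tp B * B = 1" "B * tp B = 1"
    using assms by (auto simp: normaliser_def)
  have "tp (A * B) * (A * B) = tp B * (tp A * A) * B" by (simp only: tp_mult mult.assoc)
  then show "tp (A * B) * (A * B) = 1" by (simp add: A B)
  have "(A * B) * tp (A * B) = A * (B * tp B) * tp A" by (simp only: tp_mult mult.assoc)
  then show "(A * B) * tp (A * B) = 1" by (simp add: A B)
  fix v
  obtain w where w: "B * cliff v * tp B = cliff w" using assms by (auto simp: normaliser_def)
  obtain x where x: "A * cliff w * tp A = cliff x" using assms by (auto simp: normaliser_def)
  have "A * B * cliff v * tp (A * B) = A * (B * cliff v * tp B) * tp A" by (simp only: tp_mult mult.assoc)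
  then show "\<exists>w. A * B * cliff v * tp (A * B) = cliff w" using w x by auto
qed

lemma spingrp_normaliser: "A \<in> spingrp \<Longrightarrow> A \<in> normaliser"
proof (induction rule: spingrp_induct)
  case one
  show ?case by (auto simp: normaliser_def tp_one)
next
  case (pair u w A)
  then show ?case by (intro normaliser_mult cliff_normaliser)
qed

lemma spingrp_mult: "A \<in> spingrp \<Longrightarrow> B \<in> spingrp \<Longrightarrow> A * B \<in> spingrp"
  by (induction rule: spingrp_induct) (simp_all add: pair_spingrp mult.assoc, metis pair_spingrp mult.assoc)

lemma spingrp_tp: "A \<in> spingrp \<Longrightarrow> tp A \<in> spingrp"
proof (induction rule: spingrp_induct)
  case one
  show ?case by (simp add: tp_one one_spingrp)
next
  case (pair u w A)
  have "cliff w * cliff u * 1 \<in> spingrp" using pair by (intro pair_spingrp one_spingrp)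
  then have "tp A * (cliff w * cliff u) \<in> spingrp" using pair by (simp add: spingrp_mult)
  then show ?case by (simp add: tp_mult tp_cliff mult.assoc)
qed

lemma spingrp_inverse: "A \<in> spingrp \<Longrightarrow> tp A * A = 1" "A \<in> spingrp \<Longrightarrow> A * tp A = 1"
  using spingrp_normaliser by (auto simp: normaliser_def)

lemma minus_spingrp: "A \<in> spingrp \<Longrightarrow> - A \<in> spingrp"
proof -
  assume A: "A \<in> spingrp"
  have u: "norm (axis 1 1 :: real^7) = 1" by simp
  show ?thesis using pair_spingrp[OF u u A] by (simp add: unit_cliff_square[OF u])
qed

text \<open>The products of an odd number of unit Clifford vectors.\<close>
definition oddpin :: "spinmat set" where
  "oddpin = {cliff u * C | u C. norm u = 1 \<and> C \<in> spingrp}"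

lemma oddpin_normaliser: "B \<in> oddpin \<Longrightarrow> B \<in> normaliser"
  unfolding oddpin_def using normaliser_mult[OF cliff_normaliser spingrp_normaliser] by blast

text \<open>The argument of Cartan and Dieudonne, one basis vector at a time: if \<open>B A\<close> turns \<open>e\<^sub>k\<close> into a unit
  vector \<open>w\<close> different from \<open>s e\<^sub>k\<close>, then the reflection in the hyperplane orthogonal to \<open>w - s e\<^sub>k\<close>
  sends \<open>w\<close> to \<open>s e\<^sub>k\<close> and fixes the vectors treated before. Conjugation with a Clifford vector is
  the negative of a reflection, whence the sign \<open>s\<close>, which records the parity.\<close>
lemma reflections_straighten_frame:
  assumes A: "A \<in> normaliser" and J: "finite J"
  shows "\<exists>B s. (s = 1 \<and> B \<in> spingrp \<or> s = - 1 \<and> B \<in> oddpin) \<and> (\<forall>j\<in>J. B * A * gm j = s *\<^sub>R (gm j * (B * A)))"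
  using J
proof (induction J rule: finite_induct)
  case empty
  show ?case by (rule exI[of _ 1], rule exI[of _ 1]) (simp add: one_spingrp)
next
  case (insert k J)
  then obtain B s where s: "s = 1 \<and> B \<in> spingrp \<or> s = - 1 \<and> B \<in> oddpin"
    and J: "\<And>j. j \<in> J \<Longrightarrow> B * A * gm j = s *\<^sub>R (gm j * (B * A))" by blast
  have ss: "s * s = (1::real)" using s by auto
  have "B \<in> normaliser"
    using s oddpin_normaliser spingrp_normaliser by blast
  then have N: "B * A \<in> normaliser" using A by (rule normaliser_mult)
  define M where "M = B * A"
  have M: "tp M * M = 1" "M * tp M = 1" using N by (auto simp: M_def normaliser_def)
  obtain w where w: "M * gm k * tp M = cliff w" using N by (auto simp: M_def normaliser_def)
  have Mk: "M * gm k = cliff w * M" using arg_cong[OF w, of "\<lambda>X. X * M"] M by (simp add: mult.assoc)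
  have "cliff w * cliff w = M * gm k * (tp M * M) * gm k * tp M" by (simp only: w[symmetric] mult.assoc)
  also have "\<dots> = M * (gm k * gm k) * tp M" by (simp add: M mult.assoc)
  finally have "cliff w * cliff w = - 1" by (simp add: gm_square M)
  from arg_cong[OF this, of tr] have nw: "w \<bullet> w = 1" by (simp add: cliff_square tr_simps tr_one)
  show ?case
  proof (cases "w = s *\<^sub>R e7 k")
    case True
    then have "M * gm k = s *\<^sub>R (gm k * M)" using Mk by (simp add: cliff_simps)
    then show ?thesis using s J unfolding M_def by blast
  next
    case False
    \<comment> \<open>Normalised, \<open>w - s e\<^sub>k\<close> is the vector in whose orthogonal hyperplane to reflect.\<close>
    define c where "c = 1 / norm (w - s *\<^sub>R e7 k)"
    define x where "x = c *\<^sub>R (w - s *\<^sub>R e7 k)"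
    have x: "norm x = 1" using False by (simp add: x_def c_def)
    have J': "cliff x * M * gm j = (- s) *\<^sub>R (gm j * (cliff x * M))" if j: "j \<in> J" for j
    proof -
      have jk: "j \<noteq> k" using j insert by auto
      have "gm j * cliff w + cliff w * gm j = 0"
      proof -
        have Mj: "M * gm j = s *\<^sub>R (gm j * M)" using J[OF j] by (simp add: M_def)
        have "s *\<^sub>R (gm j * cliff w * M) = s *\<^sub>R (gm j * M * gm k)" using Mk by (simp add: mult.assoc)
        also have "\<dots> = M * (gm j * gm k)" using Mj by (simp add: mult.assoc[symmetric])
        finally have 1: "s *\<^sub>R (gm j * cliff w * M) = M * (gm j * gm k)" .
        have "s *\<^sub>R (cliff w * gm j * M) = cliff w * (M * gm j)" using Mj by (simp add: mult.assoc)
        also have "\<dots> = M * (gm k * gm j)" using Mk by (simp add: mult.assoc[symmetric])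
        finally have 2: "s *\<^sub>R (cliff w * gm j * M) = M * (gm k * gm j)" .
        have "s *\<^sub>R ((gm j * cliff w + cliff w * gm j) * M) = M * (gm j * gm k + gm k * gm j)"
          using 1 2 by (simp add: distrib_left distrib_right scaleR_right_distrib)
        also have "\<dots> = 0" using jk by (simp add: gm_anticomm)
        finally have "(gm j * cliff w + cliff w * gm j) * M = 0" using s by auto
        then have "(gm j * cliff w + cliff w * gm j) * (M * tp M) = 0" by (simp only: mult.assoc[symmetric]) simp
        then show ?thesis by (simp add: M)
      qed
      moreover have "gm j * gm k + gm k * gm j = 0" using jk by (simp add: gm_anticomm)
      ultimately have "gm j * cliff x + cliff x * gm j = 0"
      proof -
        have "gm j * cliff x + cliff x * gm j = c *\<^sub>R ((gm j * cliff w + cliff w * gm j) - s *\<^sub>R (gm j * gm k + gm k * gm j))"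
          by (simp add: x_def cliff_simps algebra_simps)
        then show ?thesis using \<open>gm j * cliff w + cliff w * gm j = 0\<close> \<open>gm j * gm k + gm k * gm j = 0\<close> by simp
      qed
      then have a: "cliff x * gm j = - (gm j * cliff x)" by (simp add: add_eq_0_iff)
      have "cliff x * M * gm j = cliff x * (s *\<^sub>R (gm j * M))" using J[OF j] by (simp add: M_def mult.assoc)
      also have "\<dots> = s *\<^sub>R (cliff x * gm j * M)" by (simp add: mult.assoc)
      finally show ?thesis by (simp add: a mult.assoc)
    qed
    have k': "cliff x * M * gm k = (- s) *\<^sub>R (gm k * (cliff x * M))"
    proof -
      have "cliff w * cliff w = - 1" using nw by (simp add: cliff_square)
      then have "cliff x * cliff w = (- s) *\<^sub>R (gm k * cliff x)"
        using gm_square[of k] ss by (simp add: x_def cliff_simps algebra_simps)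
      moreover have "cliff x * M * gm k = cliff x * cliff w * M" using Mk by (simp add: mult.assoc)
      ultimately show ?thesis by (simp add: mult.assoc)
    qed
    have "- s = 1 \<and> cliff x * B \<in> spingrp \<or> - s = - 1 \<and> cliff x * B \<in> oddpin"
      using s
    proof
      assume "s = 1 \<and> B \<in> spingrp"
      then show ?thesis using x by (auto simp: oddpin_def)
    next
      assume "s = - 1 \<and> B \<in> oddpin"
      then show ?thesis using x by (auto simp: oddpin_def mult.assoc[symmetric] intro!: pair_spingrp)
    qed
    moreover have "\<forall>j\<in>insert k J. cliff x * B * A * gm j = (- s) *\<^sub>R (gm j * (cliff x * B * A))"
      using J' k' by (auto simp: M_def mult.assoc)
    ultimately show ?thesis by blast
  qed
qed

text \<open>When all basis vectors are straightened, the remaining matrix is a scalar in the even case, and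
  this scalar is \<open>1\<close> or \<open>- 1\<close> by orthogonality; the odd case is excluded by \<open>gm_anticommutant\<close>.\<close>
lemma normaliser_spingrp: "A \<in> normaliser \<Longrightarrow> A \<in> spingrp"
proof -
  assume A: "A \<in> normaliser"
  obtain B s where s: "s = 1 \<and> B \<in> spingrp \<or> s = - 1 \<and> B \<in> oddpin"
    and c: "\<And>j. B * A * gm j = s *\<^sub>R (gm j * (B * A))"
    using reflections_straighten_frame[OF A, of UNIV] by auto
  have "B \<in> normaliser"
    using s oddpin_normaliser spingrp_normaliser by blast
  then have N: "tp (B * A) * (B * A) = 1" using normaliser_mult[OF _ A] by (auto simp: normaliser_def)
  from s show ?thesis
  proof
    assume "s = - 1 \<and> B \<in> oddpin"
    then have "B * A = 0" using c by (intro gm_anticommutant) simp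
    with N show ?thesis by simp
  next
    assume s1: "s = 1 \<and> B \<in> spingrp"
    then obtain b where b: "B * A = b *\<^sub>R 1" using gm_commutant[of "B * A"] c by auto
    with N have "(b * b) *\<^sub>R (1::spinmat) = 1" by (simp add: tp_simps tp_one)
    from arg_cong[OF this, of "\<lambda>M. to_mat M $ None $ None"] have "b * b = 1" by (simp add: entries)
    then have b1: "b = 1 \<or> b = - 1" by (simp add: square_eq_1_iff)
    have "A = tp B * (B * A)" using s1 by (simp add: spingrp_inverse mult.assoc[symmetric])
    then have "A = b *\<^sub>R tp B" by (simp add: b)
    then show ?thesis using b1 s1 spingrp_tp minus_spingrp by auto
  qed
qed

lemma bounded_linear_sqmat:
  fixes f :: "('a::{real_normed_field,euclidean_space},'n::finite) sqmat \<Rightarrow> 'b::real_normed_vector"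
  assumes "linear f" shows "bounded_linear f"
proof -
  have "linear (f \<circ> of_mat)"
    by (rule linear_compose[OF bounded_linear.linear[OF bounded_linear_of_mat] assms])
  then have "bounded_linear (f \<circ> of_mat)" by (simp add: linear_conv_bounded_linear)
  from bounded_linear_compose[OF this bounded_linear_to_mat] show ?thesis by (simp add: o_def)
qed

lemma tp_exp: "tp (exp X) = exp (tp X)"
proof -
  have p: "tp (X ^ n) = tp X ^ n" for n
    by (induction n) (simp_all add: tp_one tp_mult power_commutes)
  have "(\<lambda>n. X ^ n /\<^sub>R fact n) sums exp X"
    unfolding exp_def by (rule summable_sums[OF summable_exp_generic])
  then have "(\<lambda>n. tp (X ^ n /\<^sub>R fact n)) sums tp (exp X)"
    by (rule bounded_linear.sums[OF bounded_linear_sqmat[OF linear_tp]])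
  then have 1: "(\<lambda>n. tp X ^ n /\<^sub>R fact n) sums tp (exp X)" by (simp add: tp_simps p)
  have "(\<lambda>n. tp X ^ n /\<^sub>R fact n) sums exp (tp X)"
    unfolding exp_def by (rule summable_sums[OF summable_exp_generic])
  with 1 show ?thesis by (rule sums_unique2)
qed

text \<open>Conjugation with \<open>exp (t X)\<close> acts on Clifford vectors through the flow of the rotation generated
  by \<open>X\<close>, since both sides solve the same linear differential equation.\<close>
lemma exp_normalises_cliff:
  assumes X: "X \<in> spinalg"
  shows "\<exists>w. exp (t *\<^sub>R X) * cliff v * exp (- (t *\<^sub>R X)) = cliff w"
proof -
  \<comment> \<open>The generator of the rotation, so that the flow on \<open>\<real>\<^sup>7\<close> is \<open>exp (t W)\<close>.\<close>
  define W :: "(real,7) sqmat" where "W = of_mat (\<chi> a b. rot X a b)"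
  have W: "adv X u = to_mat W *v u" for u by (simp add: W_def adv_def matrix_vector_mult_def)
  define L where "L M = cliff (to_mat M *v v)" for M :: "(real,7) sqmat"
  have "linear L" unfolding L_def
    by (rule linearI) (simp_all add: plus_sqmat.rep_eq scaleR_sqmat.rep_eq matrix_vector_mult_add_rdistrib cliff_simps scaleR_matrix_vector_assoc[symmetric])
  then have bl: "bounded_linear L" by (rule bounded_linear_sqmat)
  have LW: "L (W * M) = brk X (L M)" for M
    by (simp add: L_def brk_cliff[OF X] W times_sqmat.rep_eq matrix_vector_mul_assoc)
  \<comment> \<open>The candidate for the conjugate, conjugated back; it turns out to be constant.\<close>
  define m where "m t = exp (- (t *\<^sub>R X)) * (L (exp (t *\<^sub>R W)) * exp (t *\<^sub>R X))" for t
  have "m t = m 0"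
  proof (rule has_vector_derivative_zero_constant_real)
    fix t
    have k: "((\<lambda>t. L (exp (t *\<^sub>R W))) has_vector_derivative L (W * exp (t *\<^sub>R W))) (at t)"
      by (rule bounded_linear.has_vector_derivative[OF bl exp_scaleR_has_vector_derivative_left])
    have "exp (- (t *\<^sub>R X)) * X = X * exp (- (t *\<^sub>R X))"
      using exp_times_scaleR_commute[of "- t" X] by simp
    then have c': "exp (- (t *\<^sub>R X)) * (X * Z) = X * (exp (- (t *\<^sub>R X)) * Z)" for Z
      by (simp only: mult.assoc[symmetric])
    show "(m has_vector_derivative 0) (at t)"
      unfolding m_def
      by (rule has_vector_derivative_eq_rhs[OF has_vector_derivative_mult[OF exp_neg_has_vector_derivative
            has_vector_derivative_mult[OF k exp_scaleR_has_vector_derivative_left]]])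
        (simp add: LW brk_def algebra_simps c')
  qed
  also have "m 0 = cliff v" by (simp add: m_def L_def one_sqmat.rep_eq)
  finally have "exp (t *\<^sub>R X) * m t * exp (- (t *\<^sub>R X)) = exp (t *\<^sub>R X) * cliff v * exp (- (t *\<^sub>R X))" by simp
  moreover have "exp (t *\<^sub>R X) * m t * exp (- (t *\<^sub>R X)) = (exp (t *\<^sub>R X) * exp (- (t *\<^sub>R X))) * L (exp (t *\<^sub>R W)) * (exp (t *\<^sub>R X) * exp (- (t *\<^sub>R X)))"
    by (simp only: m_def mult.assoc)
  ultimately have "exp (t *\<^sub>R X) * cliff v * exp (- (t *\<^sub>R X)) = L (exp (t *\<^sub>R W))"
    by (simp add: exp_scaleR_minus_right)
  then show ?thesis unfolding L_def by blast
qed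

lemma spinalg_exp: 
  assumes X: "X \<in> spinalg" shows "exp (t *\<^sub>R X) \<in> spingrp"
proof (rule normaliser_spingrp)
  have t: "tp (exp (t *\<^sub>R X)) = exp (- (t *\<^sub>R X))" using X by (simp add: tp_exp tp_simps spinalg_def)
  show "exp (t *\<^sub>R X) \<in> normaliser"
    using exp_normalises_cliff[OF X, of t] by (simp add: normaliser_def t exp_scaleR_minus_right exp_minus_inverse_left)
qed

text \<open>Differentiate at \<open>t = 0\<close> the conditions that define the normaliser. The linear projection \<open>Q\<close> onto
  the Clifford vectors shows that the derivative of a curve of Clifford vectors is one.\<close>
lemma exp_spinalg:
  assumes "\<And>t. exp (t *\<^sub>R X) \<in> spingrp" shows "X \<in> spinalg"
proof -
  define f where "f t = exp (t *\<^sub>R X)" for t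
  have fd: "(f has_vector_derivative X) (at 0)"
    unfolding f_def using exp_scaleR_has_vector_derivative_left[of X 0] by simp
  have f0: "f 0 = 1" by (simp add: f_def)
  have td: "((\<lambda>t. tp (f t)) has_vector_derivative tp X) (at 0)"
    by (rule bounded_linear.has_vector_derivative[OF bounded_linear_sqmat[OF linear_tp] fd])
  have N: "f t \<in> normaliser" for t using assms spingrp_normaliser by (simp add: f_def)
  have "((\<lambda>t. tp (f t) * f t) has_vector_derivative tp (f 0) * X + tp X * f 0) (at 0)"
    by (rule has_vector_derivative_mult[OF td fd])
  moreover have "(\<lambda>t. tp (f t) * f t) = (\<lambda>t. 1)" using N by (auto simp: normaliser_def)
  ultimately have "((\<lambda>t. 1) has_vector_derivative tp (f 0) * X + tp X * f 0) (at (0::real))" by simp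
  then have "tp (f 0) * X + tp X * f 0 = 0"
    by (rule vector_derivative_unique_at) (rule has_vector_derivative_const)
  then have sk: "tp X = - X" by (simp add: f0 tp_one add_eq_0_iff)
  have "\<exists>w. brk X (cliff v) = cliff w" for v
  proof -
    \<comment> \<open>The factor \<open>- 1/8\<close> inverts the trace form on Clifford vectors, \<open>tr_cliff_cliff\<close>.\<close>
    define Q where "Q M = cliff (\<chi> i. - (1/8) * tr (gm i * M))" for M
    have "linear Q" unfolding Q_def
    proof (rule linearI)
      fix M M' and r :: real
      have "(\<chi> i. - (1/8) * tr (gm i * (M + M'))) = (\<chi> i. - (1/8) * tr (gm i * M)) + (\<chi> i. - (1/8) * tr (gm i * M'))"
        by (simp add: vec_eq_iff distrib_left tr_simps)
      then show "cliff (\<chi> i. - (1/8) * tr (gm i * (M + M'))) = cliff (\<chi> i. - (1/8) * tr (gm i * M)) + cliff (\<chi> i. - (1/8) * tr (gm i * M'))"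
        by (simp add: cliff_simps)
      have "(\<chi> i. - (1/8) * tr (gm i * (r *\<^sub>R M))) = r *\<^sub>R (\<chi> i. - (1/8) * tr (gm i * M))"
        by (simp add: vec_eq_iff tr_simps)
      then show "cliff (\<chi> i. - (1/8) * tr (gm i * (r *\<^sub>R M))) = r *\<^sub>R cliff (\<chi> i. - (1/8) * tr (gm i * M))"
        by (simp add: cliff_simps)
    qed
    then have Qb: "bounded_linear Q" by (rule bounded_linear_sqmat)
    have Qc: "Q (cliff w) = cliff w" for w
      by (simp add: Q_def tr_cliff_cliff inner_axis' )
    define h where "h t = f t * (cliff v * tp (f t))" for t
    have hd: "(h has_vector_derivative f 0 * (cliff v * tp X) + X * (cliff v * tp (f 0))) (at 0)"
      unfolding h_def
      by (intro has_vector_derivative_mult[OF fd] bounded_linear.has_vector_derivative[OF bounded_linear_mult_right] td)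
    have e: "f 0 * (cliff v * tp X) + X * (cliff v * tp (f 0)) = brk X (cliff v)"
      by (simp add: f0 tp_one sk brk_def)
    have h: "(h has_vector_derivative brk X (cliff v)) (at 0)" using hd by (simp only: e)
    then have "((\<lambda>t. Q (h t)) has_vector_derivative Q (brk X (cliff v))) (at 0)"
      by (rule bounded_linear.has_vector_derivative[OF Qb])
    moreover have "Q (h t) = h t" for t
    proof -
      obtain w where "f t * cliff v * tp (f t) = cliff w" using N[of t] by (auto simp: normaliser_def)
      then show ?thesis using Qc by (simp add: h_def mult.assoc)
    qed
    ultimately have "(h has_vector_derivative Q (brk X (cliff v))) (at 0)" by simp
    with h have "brk X (cliff v) = Q (brk X (cliff v))" by (rule vector_derivative_unique_at)
    then show ?thesis unfolding Q_def by blast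
  qed
  with sk show ?thesis by (simp add: spinalg_def)
qed

lemma spin7_eq: "X \<in> spin7 \<longleftrightarrow> of_mat X \<in> spinalg"
proof -
  have "X \<in> spin7 \<longleftrightarrow> (\<forall>t. exp (t *\<^sub>R of_mat X) \<in> spingrp)"
    by (simp add: spin7_def lie_algebra_def mat_exp_eq spingrp_def bounded_linear.linear[OF bounded_linear_of_mat, THEN linear_scale])
  then show ?thesis using spinalg_exp exp_spinalg by blast
qed

lemma fixes_vac_iff: "M *v axis None 1 = axis None 1 \<longleftrightarrow> of_mat M * vac = vac"
proof -
  have "M *v axis None 1 = axis None 1 \<longleftrightarrow> (\<forall>s. M $ s $ None = (if s = None then 1 else 0))"
    by (simp add: vec_eq_iff matrix_vector_mult_def axis_def if_distrib[of "\<lambda>x. _ * x"] cong: if_cong)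
  also have "\<dots> \<longleftrightarrow> of_mat M * vac = vac"
  proof -
    have v: "to_mat vac $ s $ t = (if s = None \<and> t = None then 1 else 0)" for s t by (simp add: vac_def)
    show ?thesis unfolding sqmat_eq_iff vec_eq_iff by (auto simp: vac_mult_entries v)
  qed
  finally show ?thesis .
qed

lemma G2_eq: "M \<in> G2 \<longleftrightarrow> of_mat M \<in> spingrp \<and> of_mat M * vac = vac"
  by (simp add: G2_def fixes_vac_iff spingrp_def)

lemma g2alg_exp: "X \<in> g2alg \<Longrightarrow> exp (t *\<^sub>R X) * vac = vac"
proof -
  assume X: "X \<in> g2alg"
  have "exp (t *\<^sub>R X) * vac = exp (0 *\<^sub>R X) * vac"
  proof (rule has_vector_derivative_zero_constant_real)
    fix t
    have "((\<lambda>t. exp (t *\<^sub>R X) * vac) has_vector_derivative (exp (t *\<^sub>R X) * X) * vac) (at t)"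
      by (rule bounded_linear.has_vector_derivative[OF bounded_linear_mult_left exp_scaleR_has_vector_derivative_right])
    then show "((\<lambda>t. exp (t *\<^sub>R X) * vac) has_vector_derivative 0) (at t)"
      by (simp add: mult.assoc g2alg_vac[OF X])
  qed
  then show ?thesis by simp
qed

lemma g2_eq: "X \<in> g2 \<longleftrightarrow> of_mat X \<in> g2alg"
proof -
  have "X \<in> g2 \<longleftrightarrow> (\<forall>t. exp (t *\<^sub>R of_mat X) \<in> spingrp \<and> exp (t *\<^sub>R of_mat X) * vac = vac)"
    by (simp add: g2_def lie_algebra_def mat_exp_eq G2_eq bounded_linear.linear[OF bounded_linear_of_mat, THEN linear_scale])
  also have "\<dots> \<longleftrightarrow> of_mat X \<in> spinalg \<and> (\<forall>t. exp (t *\<^sub>R of_mat X) * vac = vac)"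
    using spinalg_exp exp_spinalg by blast
  also have "\<dots> \<longleftrightarrow> of_mat X \<in> g2alg"
  proof
    assume a: "of_mat X \<in> spinalg \<and> (\<forall>t. exp (t *\<^sub>R of_mat X) * vac = vac)"
    have "((\<lambda>t. exp (t *\<^sub>R of_mat X) * vac) has_vector_derivative (of_mat X * exp (0 *\<^sub>R of_mat X)) * vac) (at 0)"
      by (rule bounded_linear.has_vector_derivative[OF bounded_linear_mult_left exp_scaleR_has_vector_derivative_left])
    then have "((\<lambda>t. vac) has_vector_derivative of_mat X * vac) (at (0::real))" using a by simp
    then have "of_mat X * vac = 0" by (rule vector_derivative_unique_at) (rule has_vector_derivative_const)
    then show "of_mat X \<in> g2alg" using a by (simp add: g2alg_def)
  qed (use g2alg_exp in \<open>auto simp: g2alg_def\<close>)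
  finally show ?thesis .
qed

section \<open>The Killing form and the complement of \<open>g\<^sub>2\<close>\<close>

text \<open>The trace may be computed with any family \<open>L\<close> that spans \<open>S\<close>, linearly dependent or not, together
  with functionals \<open>c\<close> that expand the elements of \<open>S\<close> in it.\<close>
lemma trace_on_frame:
  fixes S :: "'v::real_vector set" and L :: "'i \<Rightarrow> 'v" and c :: "'i \<Rightarrow> 'v \<Rightarrow> real"
  assumes P: "finite P" and L: "\<And>p. p \<in> P \<Longrightarrow> L p \<in> S" and S: "subspace S"
    and c: "\<And>p. p \<in> P \<Longrightarrow> linear (c p)"
    and ex: "\<And>X. X \<in> S \<Longrightarrow> X = (\<Sum>p\<in>P. c p X *\<^sub>R L p)"
    and T: "linear T" and TS: "\<And>X. X \<in> S \<Longrightarrow> T X \<in> S"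
  shows "trace_on S T = (\<Sum>p\<in>P. c p (T (L p)))"
proof -
  define B where "B = (SOME B. independent B \<and> span B = S)"
  obtain B0 where B0: "B0 \<subseteq> S" "independent B0" "S \<subseteq> span B0"
    using maximal_independent_subset[of S] by blast
  have "span B0 = S" using B0 S by (metis span_subspace)
  then have "\<exists>B. independent B \<and> span B = S" using B0 by blast
  then have B: "independent B" "span B = S" unfolding B_def by (rule someI2_ex, blast)+
  have "S \<subseteq> span (L ` P)"
  proof
    fix X assume "X \<in> S"
    then have "X = (\<Sum>p\<in>P. c p X *\<^sub>R L p)" by (rule ex)
    then show "X \<in> span (L ` P)" by (metis (no_types, lifting) imageI span_base span_scale span_sum)
  qed
  moreover have "B \<subseteq> S" using B span_superset by blast
  ultimately have finB: "finite B"
    using independent_span_bound[of "L ` P" B] B P by (meson finite_imageI order_trans)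
  have rep: "representation B (\<Sum>p\<in>P. a p *\<^sub>R Y p) b = (\<Sum>p\<in>P. a p * representation B (Y p) b)"
    if "\<And>p. p \<in> P \<Longrightarrow> Y p \<in> S" for a Y b
  proof -
    have "representation B (\<Sum>p\<in>P. a p *\<^sub>R Y p) = (\<lambda>b. \<Sum>p\<in>P. representation B (a p *\<^sub>R Y p) b)"
      using that B by (intro representation_sum) (auto intro: span_scale)
    also have "\<dots> = (\<lambda>b. \<Sum>p\<in>P. a p * representation B (Y p) b)"
      using that B by (intro ext sum.cong refl) (simp add: representation_scale)
    finally show ?thesis by simp
  qed
  have "trace_on S T = (\<Sum>b\<in>B. representation B (T b) b)"
    unfolding trace_on_def B_def Let_def ..
  also have "\<dots> = (\<Sum>b\<in>B. \<Sum>p\<in>P. c p b * representation B (T (L p)) b)"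
  proof (intro sum.cong refl)
    fix b assume "b \<in> B"
    then have "b \<in> S" using \<open>B \<subseteq> S\<close> by blast
    then have "T b = (\<Sum>p\<in>P. c p b *\<^sub>R T (L p))"
      using arg_cong[OF ex[OF \<open>b \<in> S\<close>], of T] by (simp only: linear_sum[OF T] linear_scale[OF T])
    then show "representation B (T b) b = (\<Sum>p\<in>P. c p b * representation B (T (L p)) b)"
      using rep[of "\<lambda>p. T (L p)"] TS L by simp
  qed
  also have "\<dots> = (\<Sum>p\<in>P. \<Sum>b\<in>B. c p b * representation B (T (L p)) b)" by (rule sum.swap)
  also have "\<dots> = (\<Sum>p\<in>P. c p (T (L p)))"
  proof (intro sum.cong refl)
    fix p assume p: "p \<in> P"
    have "T (L p) = (\<Sum>b\<in>B. representation B (T (L p)) b *\<^sub>R b)"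
      using sum_representation_eq[OF B(1) _ finB order_refl, of "T (L p)"] B TS L p by auto
    then have "c p (T (L p)) = c p (\<Sum>b\<in>B. representation B (T (L p)) b *\<^sub>R b)" by simp
    then show "(\<Sum>b\<in>B. c p b * representation B (T (L p)) b) = c p (T (L p))"
      by (simp add: linear_sum[OF c[OF p]] linear_scale[OF c[OF p]] mult.commute)
  qed
  finally show ?thesis .
qed

lemma to_mat_brk: "to_mat (brk X Y) = bracket (to_mat X) (to_mat Y)"
  by (simp add: brk_def bracket_def minus_sqmat.rep_eq times_sqmat.rep_eq)

lemma of_mat_bracket: "of_mat (bracket X Y) = brk (of_mat X) (of_mat Y)"
  by (simp add: sqmat_eq_iff to_mat_brk)

lemma brk_spinalg: "X \<in> spinalg \<Longrightarrow> Y \<in> spinalg \<Longrightarrow> brk X Y \<in> spinalg"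
proof -
  assume X: "X \<in> spinalg" and Y: "Y \<in> spinalg"
  have "tp (brk X Y) = - brk X Y" using X Y by (simp add: brk_def tp_simps tp_mult spinalg_def)
  moreover have "\<exists>w. brk (brk X Y) (cliff u) = cliff w" for u
  proof -
    have "brk (brk X Y) (cliff u) = brk X (brk Y (cliff u)) - brk Y (brk X (cliff u))"
      by (simp add: brk_def algebra_simps)
    also have "\<dots> = cliff (adv X (adv Y u) - adv Y (adv X u))"
      by (simp add: brk_cliff X Y cliff_simps)
    finally show ?thesis by blast
  qed
  ultimately show ?thesis by (simp add: spinalg_def)
qed

lemma subspace_spin7: "subspace spin7"
  using subspace_spinalg unfolding subspace_def
  by (auto simp: spin7_eq linear_0[OF bounded_linear.linear[OF bounded_linear_of_mat]]
    linear_add[OF bounded_linear.linear[OF bounded_linear_of_mat]] linear_scale[OF bounded_linear.linear[OF bounded_linear_of_mat]])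

lemma tr_brk_brk: "tr (brk A B * C) = - tr (B * brk A C)"
  using tr_mult_commute[of "B * C" A] by (simp add: brk_def tr_simps algebra_simps)

text \<open>By invariance of the trace form the two outer brackets can be moved to the frame elements, where
  they form the Casimir operator of the adjoint representation.\<close>
lemma killing_eq:
  assumes X: "X \<in> spin7" and Y: "Y \<in> spin7"
  shows "killing spin7 X Y = 5 * tr (of_mat X * of_mat Y)"
proof -
  define x y where "x = of_mat X" and "y = of_mat Y"
  have x: "x \<in> spinalg" and y: "y \<in> spinalg" using X Y by (simp_all add: x_def y_def spin7_eq)
  have lin_of: "linear (of_mat :: ix rmat \<Rightarrow> spinmat)" by (rule bounded_linear.linear[OF bounded_linear_of_mat])
  have lin_to: "linear (to_mat :: spinmat \<Rightarrow> ix rmat)" by (rule bounded_linear.linear[OF bounded_linear_to_mat])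
  \<comment> \<open>The coefficients in \<open>spinalg_expand\<close>.\<close>
  define c where "c p Z = - (1/16) * tr (of_mat Z * gm (fst p) * gm (snd p))" for p :: "7 \<times> 7" and Z
  have "killing spin7 X Y = (\<Sum>p\<in>UNIV. c p (bracket X (bracket Y (to_mat (Eg (fst p) (snd p))))))"
    unfolding killing_def
  proof (rule trace_on_frame)
    show "linear (c p)" for p unfolding c_def
      by (rule linearI) (simp_all add: linear_add[OF lin_of] linear_scale[OF lin_of] distrib_right tr_simps algebra_simps)
    show "to_mat (Eg (fst p) (snd p)) \<in> spin7" for p by (simp add: spin7_eq Eg_spinalg)
    show "linear (\<lambda>Z. bracket X (bracket Y Z))"
    proof -
      have "(\<lambda>Z. bracket X (bracket Y Z)) = (to_mat \<circ> (brk x \<circ> (brk y \<circ> of_mat)))"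
        by (simp add: fun_eq_iff to_mat_brk x_def y_def)
      then show ?thesis by (simp only: linear_compose lin_of lin_to linear_brk)
    qed
    show "bracket X (bracket Y Z) \<in> spin7" if "Z \<in> spin7" for Z
      using that X Y by (simp add: spin7_eq of_mat_bracket brk_spinalg)
    show "Z = (\<Sum>p\<in>UNIV. c p Z *\<^sub>R to_mat (Eg (fst p) (snd p)))" if "Z \<in> spin7" for Z
    proof -
      define z where "z = of_mat Z"
      have "z \<in> spinalg" using that by (simp add: z_def spin7_eq)
      then have "to_mat z = to_mat (- (1/4) *\<^sub>R (\<Sum>a\<in>UNIV. \<Sum>b\<in>UNIV. rot z a b *\<^sub>R Eg a b))"
        using spinalg_expand by simp
      then show ?thesis
        by (simp add: linear_scale[OF lin_to] linear_sum[OF lin_to] linear_neg[OF lin_to] z_def rot_def c_def scaleR_sum_right sum_negf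
            sum.cartesian_product split_beta)
    qed
  qed (simp_all add: subspace_spin7)
  also have "\<dots> = (\<Sum>a\<in>UNIV. \<Sum>b\<in>UNIV. - (1/16) * tr (brk x (brk y (Eg a b)) * Eg a b))"
  proof -
    have *: "tr (Z * gm a * gm b) = tr (Z * Eg a b)" if "Z \<in> spinalg" for Z a b
      using spinalg_tr_zero[OF that] by (simp add: Eg_def distrib_left tr_simps mult.assoc)
    show ?thesis
      by (simp add: c_def of_mat_bracket x_def[symmetric] y_def[symmetric] * brk_spinalg x y Eg_spinalg sum.cartesian_product split_beta)
  qed
  also have "\<dots> = (\<Sum>a\<in>UNIV. \<Sum>b\<in>UNIV. - (1/16) * tr (brk (Eg a b) (brk (Eg a b) x) * y))"
  proof (intro sum.cong refl)
    fix a b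
    have "tr (brk x (brk y (Eg a b)) * Eg a b) = - tr (brk y (Eg a b) * brk x (Eg a b))" by (rule tr_brk_brk)
    also have "\<dots> = tr (brk (Eg a b) y * brk x (Eg a b))" by (simp add: brk_def tr_simps algebra_simps)
    also have "\<dots> = - tr (y * brk (Eg a b) (brk x (Eg a b)))" by (rule tr_brk_brk)
    also have "\<dots> = tr (y * brk (Eg a b) (brk (Eg a b) x))" by (simp add: brk_def tr_simps algebra_simps)
    finally show "- (1/16) * tr (brk x (brk y (Eg a b)) * Eg a b) = - (1/16) * tr (brk (Eg a b) (brk (Eg a b) x) * y)"
      by (simp add: tr_mult_commute[of y])
  qed
  also have "\<dots> = - (1/16) * tr ((\<Sum>a\<in>UNIV. \<Sum>b\<in>UNIV. brk (Eg a b) (brk (Eg a b) x)) * y)"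
    by (simp add: sum_distrib_right linear_sum[OF linear_tr] sum_distrib_left sum_negf)
  also have "\<dots> = 5 * tr (x * y)" unfolding sum_brk_Eg_brk_Eg[OF x] by (simp add: tr_simps)
  finally show ?thesis by (simp add: x_def y_def)
qed

lemma ip_eq: "X \<in> spin7 \<Longrightarrow> Y \<in> spin7 \<Longrightarrow> ip X Y = - (3/8) * tr (of_mat X * of_mat Y)"
  by (simp add: ip_def killing_eq)

text \<open>The operator \<open>X \<mapsto> \<Sum>\<^sub>i gm i * X * gm i\<close> is symmetric for the trace form and has the eigenvalue \<open>- 3\<close>
  on \<open>spin(7)\<close> but \<open>5\<close> on the Clifford vectors.\<close>
lemma tr_cliff_spinalg: "X \<in> spinalg \<Longrightarrow> tr (X * cliff u) = 0"
proof -
  assume X: "X \<in> spinalg"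
  have r: "gm i * cliff u * gm i = cliff (u - (2 * (e7 i \<bullet> u)) *\<^sub>R e7 i)" for i
    by (rule cliff_reflect) simp
  have "(\<Sum>i\<in>UNIV. gm i * cliff u * gm i) = cliff (\<Sum>i\<in>UNIV. u - (2 * (e7 i \<bullet> u)) *\<^sub>R e7 i)"
    by (simp only: r linear_sum[OF linear_cliff])
  also have "(\<Sum>i\<in>UNIV. u - (2 * (e7 i \<bullet> u)) *\<^sub>R e7 i) = 5 *\<^sub>R u"
    unfolding inner_axis' by (simp add: vec_eq_iff sum_subtractf axis_def sum_delta_mult mult.assoc flip: sum_distrib_left)
  finally have 5: "(\<Sum>i\<in>UNIV. gm i * cliff u * gm i) = 5 *\<^sub>R cliff u" by (simp add: cliff_simps)
  have "- 3 * tr (X * cliff u) = tr ((\<Sum>i\<in>UNIV. gm i * X * gm i) * cliff u)"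
    by (simp add: sum_gm_X_gm[OF X] tr_simps)
  also have "\<dots> = (\<Sum>i\<in>UNIV. tr (gm i * (X * gm i * cliff u)))" by (simp add: sum_distrib_right linear_sum[OF linear_tr] mult.assoc)
  also have "\<dots> = (\<Sum>i\<in>UNIV. tr (X * (gm i * cliff u * gm i)))"
    by (subst tr_mult_commute) (simp add: mult.assoc)
  also have "\<dots> = tr (X * (5 *\<^sub>R cliff u))" by (simp only: 5[symmetric] sum_distrib_left linear_sum[OF linear_tr])
  finally show ?thesis by (simp add: tr_simps)
qed

lemma tr_g2_msp: "X \<in> g2alg \<Longrightarrow> tr (msp u * X) = 0"
proof -
  assume X: "X \<in> g2alg"
  have 1: "tr (cliff u * X) = 0" using tr_cliff_spinalg[of X u] X tr_mult_commute by (simp add: g2alg_def)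
  have "tr (vac * cliff u * X) = tr (cliff u * X * vac)" using tr_mult_commute[of vac "cliff u * X"] by (simp add: mult.assoc)
  then have 2: "tr (vac * cliff u * X) = 0" using g2alg_vac[OF X] by (simp add: mult.assoc tr_simps)
  show ?thesis
    using 1 2 g2alg_vac[OF X] by (simp add: msp_def algebra_simps tr_simps)
qed

lemma tr_msp_msp: "tr (msp u * msp v) = - (8/3) * (u \<bullet> v)"
proof -
  have v: "tr vac = 1" by (simp add: tr_def trace_def sum_option vac_entries)
  have z1: "tr (vac * cliff w) = 0" for w
  proof -
    have "tr (vac * cliff w) = tr (vac * (vac * cliff w))" by (simp only: mult.assoc[symmetric] vac_vac)
    also have "\<dots> = tr (vac * cliff w * vac)" by (rule tr_mult_commute)
    finally show ?thesis by (simp add: vac_cliff_vac tr_simps)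
  qed
  then have "tr (cliff w * vac) = 0" for w by (subst tr_mult_commute)
  note z = z1 this
  have m: "tr (cliff u * vac * cliff v) = - (u \<bullet> v)"
  proof -
    have "tr (cliff u * vac * cliff v) = tr (cliff v * (cliff u * vac))" by (rule tr_mult_commute)
    also have "\<dots> = tr (cliff v * cliff u * vac)" by (simp only: mult.assoc)
    finally show ?thesis unfolding cliff_mult_vac by (simp add: tr_simps v z inner_commute)
  qed
  have "9 * tr (msp u * msp v) = tr (9 *\<^sub>R (msp u * msp v))" by (simp add: tr_simps)
  also have "\<dots> = - 24 * (u \<bullet> v)"
    unfolding msp_mult cliff_mult_vac vac_cliff_mult by (simp add: tr_simps tr_cliff_cliff v z m)
  finally show ?thesis by simp
qed

definition iso :: "real^7 \<Rightarrow> ix rmat" where "iso u = to_mat (msp u)"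

lemma spinalg_decomp:
  assumes X: "X \<in> spinalg"
  obtains u where "X - msp u \<in> g2alg"
proof -
  define u where "u = (\<chi> a. to_mat X $ Some a $ None)"
  have "to_mat X $ None $ None = - to_mat X $ None $ None"
  proof -
    have "tp X = - X" using X by (simp add: spinalg_def)
    from arg_cong[OF this, of "\<lambda>M. to_mat M $ None $ None"] show ?thesis by (simp add: tp_entries entries)
  qed
  then have 0: "to_mat X $ None $ None = 0" by simp
  have "X * vac = - (cliff u * vac)"
    unfolding sqmat_eq_iff by (rule matrix_ix_eqI) (simp_all add: vac_mult_entries entries to_mat_cliff gam_simps 0 u_def)
  then have "X - msp u \<in> g2alg"
    unfolding g2alg_def using X msp_spinalg subspace_spinalg
    by (auto simp: left_diff_distrib msp_vac intro: subspace_diff)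
  then show thesis by (rule that)
qed

text \<open>Every element of \<open>spin(7)\<close> differs from some \<open>msp u\<close> by an element of \<open>g\<^sub>2\<close>, namely the one for
  which both have the same value on the distinguished spinor. If the element is in \<open>m\<close>, this
  difference is orthogonal to itself.\<close>
lemma m7_eq: "m7 = range iso"
proof (intro set_eqI iffI)
  fix X assume "X \<in> m7"
  then have X: "X \<in> spin7" "\<And>Y. Y \<in> g2 \<Longrightarrow> killing spin7 X Y = 0" by (auto simp: m7_def)
  have g2s: "Y \<in> g2 \<Longrightarrow> Y \<in> spin7" for Y by (simp add: g2_eq spin7_eq g2alg_def)
  obtain u where u: "of_mat X - msp u \<in> g2alg" using spinalg_decomp X(1) by (auto simp: spin7_eq)
  define Y where "Y = of_mat X - msp u"
  have Y: "to_mat Y \<in> g2" using u by (simp add: g2_eq Y_def)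
  have "tr (of_mat X * Y) = 0" using X(2)[OF Y] killing_eq[OF X(1) g2s[OF Y]] by simp
  moreover have "tr (msp u * Y) = 0" using u by (simp add: Y_def tr_g2_msp)
  moreover have "Y * Y = of_mat X * Y - msp u * Y"
    unfolding left_diff_distrib[symmetric] by (simp only: Y_def)
  ultimately have "tr (Y * Y) = 0" by (simp only: tr_simps)
  moreover have "tp Y = - Y" using u by (simp add: Y_def g2alg_def spinalg_def)
  ultimately have "Y = 0" by (intro tr_square_zero_imp)
  then have "of_mat X = msp u" by (simp add: Y_def)
  then have "X = iso u" by (metis iso_def of_mat_to_mat)
  then show "X \<in> range iso" by blast
next
  fix X assume "X \<in> range iso"
  then obtain u where u: "X = iso u" by blast
  then have X: "X \<in> spin7" by (simp add: iso_def spin7_eq msp_spinalg)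
  have "killing spin7 X Y = 0" if "Y \<in> g2" for Y
  proof -
    have "Y \<in> spin7" "of_mat Y \<in> g2alg" using that by (simp_all add: g2_eq spin7_eq g2alg_def)
    then show ?thesis using killing_eq[OF X] by (simp add: u iso_def tr_g2_msp)
  qed
  with X show "X \<in> m7" by (simp add: m7_def)
qed

lemma iso_spin7: "iso u \<in> spin7" by (simp add: iso_def spin7_eq msp_spinalg)

lemma ip_iso: "ip (iso u) (iso v) = u \<bullet> v"
  by (simp add: ip_eq iso_spin7) (simp add: iso_def tr_msp_msp)

lemma msp_g2_zero: "msp u \<in> g2alg \<Longrightarrow> u = 0"
proof -
  assume "msp u \<in> g2alg"
  then have "tr (msp u * msp u) = 0" by (rule tr_g2_msp)
  then show ?thesis by (simp add: tr_msp_msp)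
qed

lemma proj_m_eq:
  assumes "of_mat X - msp u \<in> g2alg" shows "proj_m X = iso u"
  unfolding proj_m_def
proof (rule the_equality)
  show "iso u \<in> m7 \<and> X - iso u \<in> g2"
    using assms by (simp add: m7_eq g2_eq iso_def linear_diff[OF bounded_linear.linear[OF bounded_linear_of_mat]])
next
  fix Y assume Y: "Y \<in> m7 \<and> X - Y \<in> g2"
  then obtain v where v: "Y = iso v" by (auto simp: m7_eq)
  have "of_mat X - msp v \<in> g2alg"
    using Y v by (simp add: g2_eq iso_def linear_diff[OF bounded_linear.linear[OF bounded_linear_of_mat]])
  then have "(of_mat X - msp v) - (of_mat X - msp u) \<in> g2alg"
    by (rule subspace_diff[OF subspace_g2alg _ assms])
  moreover have "(of_mat X - msp v) - (of_mat X - msp u) = msp (u - v)" by (simp add: msp_simps)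
  ultimately have "msp (u - v) \<in> g2alg" by simp
  then have "u - v = 0" by (rule msp_g2_zero)
  then show "Y = iso u" by (simp add: v)
qed

text \<open>The sign and the scale in the definitions of \<open>phi\<close> and of the inner product are those for which
  \<open>iso\<close> is an isometry that carries \<open>\<phi>\<^sub>0\<close> to \<open>\<phi>\<close>.\<close>
lemma phi_iso: "phi (iso u) (iso v) (iso w) = phi0 u v w"
proof -
  have "brk (msp u) (msp v) * vac = (2/3) *\<^sub>R (cliff u * cliff v * vac + (u \<bullet> v) *\<^sub>R vac) - (4/3) *\<^sub>R (msp (cross u v) * vac)"
    unfolding brk_def msp_commutator by (simp add: algebra_simps)
  also have "\<dots> = (2/3) *\<^sub>R (cliff (cross u v) * vac)"
    unfolding cliff_mult_vac msp_vac by (rule sqmat_eqI, simp only: entries, simp add: field_simps)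
  finally have "(brk (msp u) (msp v) - msp ((-2/3) *\<^sub>R cross u v)) * vac = 0"
    by (simp add: left_diff_distrib distrib_right msp_vac msp_simps)
  moreover have "brk (msp u) (msp v) - msp ((-2/3) *\<^sub>R cross u v) \<in> spinalg"
    by (intro subspace_diff subspace_spinalg brk_spinalg msp_spinalg)
  ultimately have "of_mat (bracket (iso u) (iso v)) - msp ((-2/3) *\<^sub>R cross u v) \<in> g2alg"
    by (simp add: g2alg_def of_mat_bracket iso_def)
  then have "proj_m (bracket (iso u) (iso v)) = iso ((-2/3) *\<^sub>R cross u v)" by (rule proj_m_eq)
  then have "phi (iso u) (iso v) (iso w) = cross u v \<bullet> w" by (simp add: phi_def ip_iso)
  also have "\<dots> = phi0 u v w"
    unfolding inner_vec_def by (simp add: cross_nth phi0_expand3[of u v w])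
  finally show ?thesis .
qed

lemma orthonormal_basis_m_iso:
  assumes "orthonormal_basis_m I"
  obtains U where "\<And>a. I a = iso (U a)" "\<And>a b. U a \<bullet> U b = (if a = b then 1 else 0)"
proof -
  have "I a \<in> m7" for a using assms by (auto simp: orthonormal_basis_m_def intro: span_base)
  then have "\<forall>a. \<exists>u. I a = iso u" by (auto simp: m7_eq)
  then obtain U where U: "\<And>a. I a = iso (U a)" by metis
  have "U a \<bullet> U b = (if a = b then 1 else 0)" for a b
    using assms ip_iso[of "U a" "U b"] by (simp add: orthonormal_basis_m_def U[symmetric])
  with U show thesis by (rule that)
qed

lemma orthonormal_rows_columns:
  fixes U :: "7 \<Rightarrow> real^7"
  assumes "\<And>a b. U a \<bullet> U b = (if a = b then 1 else 0)"
  shows "(\<Sum>a\<in>UNIV. U a $ i * U a $ j) = (if i = j then 1 else 0)"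
proof -
  define M where "M = (\<chi> a i. U a $ i)"
  have "M ** transpose M = mat 1"
    using assms by (simp add: vec_eq_iff M_def matrix_matrix_mult_def transpose_def mat_def inner_vec_def)
  then have "transpose M ** M = mat 1" by (simp add: matrix_left_right_inverse)
  then have "(transpose M ** M) $ i $ j = mat 1 $ i $ j" by simp
  then show ?thesis by (simp add: M_def matrix_matrix_mult_def transpose_def mat_def)
qed

section \<open>The Casimir operator of \<open>g\<^sub>2\<close> on \<open>m\<close> and \<open>g\<^sub>2\<close>\<close>
lemma cliff_vac_inject: "cliff u * vac = cliff v * vac \<Longrightarrow> u = v"
proof -
  assume "cliff u * vac = cliff v * vac"
  then have "to_mat (cliff u * vac) $ Some a $ None = to_mat (cliff v * vac) $ Some a $ None" for a by simp
  then show ?thesis by (simp add: vac_mult_entries to_mat_cliff gam_simps vec_eq_iff)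
qed

text \<open>The representation of \<open>g\<^sub>2\<close> on \<open>\<real>\<^sup>7\<close> is contained in the spin representation, where the Casimir
  operator is known from \<open>sum_Gg_square\<close>.\<close>
lemma sum_Gg_adv: "(\<Sum>i\<in>UNIV. \<Sum>j\<in>UNIV. adv (Gg i j) (adv (Gg i j) w)) = - (128/9) *\<^sub>R w"
proof -
  have g: "cliff (adv X u) * vac = X * cliff u * vac" if X: "X \<in> g2alg" for X u
    using brk_cliff[of X u] X g2alg_vac[OF X] by (simp add: g2alg_def brk_def left_diff_distrib mult.assoc flip: brk_cliff)
  have "cliff (\<Sum>i\<in>UNIV. \<Sum>j\<in>UNIV. adv (Gg i j) (adv (Gg i j) w)) * vac
     = (\<Sum>i\<in>UNIV. \<Sum>j\<in>UNIV. Gg i j * Gg i j) * cliff w * vac"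
    by (simp add: linear_sum[OF linear_cliff] sum_distrib_right g Gg_g2alg) (simp add: mult.assoc g[OF Gg_g2alg, unfolded mult.assoc])
  also have "\<dots> = (128/9) *\<^sub>R (vac * cliff w * vac - cliff w * vac)"
    unfolding sum_Gg_square by (simp add: algebra_simps)
  also have "\<dots> = cliff (- (128/9) *\<^sub>R w) * vac" by (simp add: vac_cliff_vac cliff_simps)
  finally show ?thesis by (rule cliff_vac_inject)
qed

lemma sum_brk_Gg_msp: "(\<Sum>i\<in>UNIV. \<Sum>j\<in>UNIV. brk (Gg i j) (brk (Gg i j) (msp w))) = - (128/9) *\<^sub>R msp w"
proof -
  have "(\<Sum>i\<in>UNIV. \<Sum>j\<in>UNIV. brk (Gg i j) (brk (Gg i j) (msp w))) = msp (\<Sum>i\<in>UNIV. \<Sum>j\<in>UNIV. adv (Gg i j) (adv (Gg i j) w))"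
    by (simp add: brk_msp_g2 Gg_g2alg linear_sum[OF linear_msp])
  then show ?thesis by (simp only: sum_Gg_adv msp_simps)
qed

lemma bilinear_brk_brk: "bilinear (\<lambda>X Y. brk X (brk Y (Z::spinmat)))"
  unfolding bilinear_def
  by (auto intro!: linearI simp: brk_def algebra_simps)

lemma adv_basis: "adv Z (e7 k) = (\<Sum>a\<in>UNIV. rot Z a k *\<^sub>R e7 a)"
  by (simp add: adv_def vec_eq_iff axis_def sum_delta_mult)

lemma brk_antisym: "brk X Y = - brk Y (X::spinmat)" by (simp add: brk_def)

text \<open>\<open>[N\<^sub>k, Z]\<close> is again in \<open>m\<close> for \<open>N\<^sub>k = msp e\<^sub>k\<close>, so that \<open>msp_commutator\<close> applies to the outer bracket.
  The coefficients of \<open>Z\<close> sum up the bivectors to \<open>4 Z\<close>, and the cross products to a vector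
  \<open>t\<close> that vanishes because \<open>Z\<close> annihilates the distinguished spinor.\<close>
lemma sum_brk_msp_g2:
  assumes Z: "Z \<in> g2alg"
  shows "(\<Sum>k\<in>UNIV. brk (msp (e7 k)) (brk (msp (e7 k)) Z)) = - (8/3) *\<^sub>R Z"
proof -
  have Zs: "Z \<in> spinalg" using Z by (simp add: g2alg_def)
  define t where "t = (\<Sum>k\<in>UNIV. \<Sum>a\<in>UNIV. rot Z a k *\<^sub>R cross (e7 k) (e7 a))"
  have E: "(\<Sum>k\<in>UNIV. \<Sum>a\<in>UNIV. rot Z a k *\<^sub>R Eg k a) = 4 *\<^sub>R Z"
  proof -
    have "(\<Sum>k\<in>UNIV. \<Sum>a\<in>UNIV. rot Z a k *\<^sub>R Eg k a) = - (\<Sum>k\<in>UNIV. \<Sum>a\<in>UNIV. rot Z k a *\<^sub>R Eg k a)"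
      unfolding sum_negf[symmetric]
    proof (intro sum.cong refl)
      fix k a show "rot Z a k *\<^sub>R Eg k a = - (rot Z k a *\<^sub>R Eg k a)" using rot_swap[OF Zs, of a k] by simp
    qed
    also have "\<dots> = 4 *\<^sub>R (- (1/4) *\<^sub>R (\<Sum>k\<in>UNIV. \<Sum>a\<in>UNIV. rot Z k a *\<^sub>R Eg k a))" by simp
    also have "\<dots> = 4 *\<^sub>R Z" by (simp only: spinalg_expand[OF Zs, symmetric])
    finally show ?thesis .
  qed
  have "cliff t * vac = - ((\<Sum>k\<in>UNIV. \<Sum>a\<in>UNIV. rot Z a k *\<^sub>R Eg k a) * vac)"
    by (simp add: t_def linear_sum[OF linear_cliff] cliff_simps sum_distrib_right Eg_vac sum_negf)
  also have "\<dots> = cliff 0 * vac" unfolding E using g2alg_vac[OF Z] by (simp add: cliff_simps)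
  finally have t: "t = 0" by (rule cliff_vac_inject)
  have c: "brk (msp (e7 k)) (msp (e7 a)) = (2/3) *\<^sub>R Eg k a - (4/3) *\<^sub>R msp (cross (e7 k) (e7 a))" for k a
    unfolding brk_def msp_commutator by (simp add: Eg_def e7_inner)
  have "brk (msp (e7 k)) (brk (msp (e7 k)) Z) = - (\<Sum>a\<in>UNIV. rot Z a k *\<^sub>R ((2/3) *\<^sub>R Eg k a - (4/3) *\<^sub>R msp (cross (e7 k) (e7 a))))" for k
  proof -
    have "brk (msp (e7 k)) Z = - (\<Sum>a\<in>UNIV. rot Z a k *\<^sub>R msp (e7 a))"
      by (subst brk_antisym) (simp add: brk_msp_g2[OF Z] adv_basis linear_sum[OF linear_msp] msp_simps)
    then show ?thesis
      by (simp add: linear_neg[OF linear_brk] linear_sum[OF linear_brk] linear_scale[OF linear_brk] c)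
  qed
  then have "(\<Sum>k\<in>UNIV. brk (msp (e7 k)) (brk (msp (e7 k)) Z))
     = - ((2/3) *\<^sub>R (\<Sum>k\<in>UNIV. \<Sum>a\<in>UNIV. rot Z a k *\<^sub>R Eg k a) - (4/3) *\<^sub>R msp t)"
    by (simp add: t_def linear_sum[OF linear_msp] msp_simps sum_negf scaleR_sum_right sum_subtractf[symmetric] scaleR_right_diff_distrib mult.commute)
  then show ?thesis by (simp add: E t msp_simps)
qed

text \<open>The difference of the Casimir operators of \<open>spin(7)\<close> and of \<open>m\<close>.\<close>
lemma sum_brk_Gg_g2:
  assumes Z: "Z \<in> g2alg"
  shows "(\<Sum>i\<in>UNIV. \<Sum>j\<in>UNIV. brk (Gg i j) (brk (Gg i j) Z)) = - (256/9) *\<^sub>R Z"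
proof -
  define S where "S = (\<Sum>i\<in>UNIV. \<Sum>j\<in>UNIV. brk (Gg i j) (brk (Gg i j) Z))"
  have "- 80 *\<^sub>R Z = (9/4) *\<^sub>R S + 6 *\<^sub>R (- (8/3) *\<^sub>R Z)"
    unfolding S_def sum_brk_msp_g2[OF Z, symmetric]
    using casimir_split[OF bilinear_brk_brk[of Z]] sum_brk_Eg_brk_Eg[of Z] Z by (simp add: g2alg_def)
  then have e: "to_mat (- 80 *\<^sub>R Z) $ s $ t = to_mat ((9/4) *\<^sub>R S + 6 *\<^sub>R (- (8/3) *\<^sub>R Z)) $ s $ t" for s t by simp
  have "S = - (256/9) *\<^sub>R Z"
  proof (rule sqmat_eqI)
    fix s t show "to_mat S $ s $ t = to_mat (- (256/9) *\<^sub>R Z) $ s $ t"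
      using e[of s t] by (simp add: entries)
  qed
  then show ?thesis by (simp add: S_def)
qed

section \<open>Differentiating a representation of Spin(7)\<close>
locale spin_rep =
  fixes \<rho> :: "ix rmat \<Rightarrow> complex^'n::finite^'n"
  assumes rep: "spin7_rep \<rho>"
begin

definition rho :: "spinmat \<Rightarrow> (complex,'n) sqmat" where "rho A = of_mat (\<rho> (to_mat A))"

definition drho :: "spinmat \<Rightarrow> (complex,'n) sqmat" where "drho X = of_mat (diff_rep \<rho> (to_mat X))"

lemma rho_one: "rho 1 = 1"
  using rep by (simp add: rho_def spin7_rep_def one_sqmat.rep_eq sqmat_eq_iff)

lemma rho_mult: "A \<in> spingrp \<Longrightarrow> B \<in> spingrp \<Longrightarrow> rho (A * B) = rho A * rho B"
  using rep by (simp add: rho_def spin7_rep_def spingrp_def times_sqmat.rep_eq sqmat_eq_iff)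

lemma rho_power: "A \<in> spingrp \<Longrightarrow> A ^ n \<in> spingrp \<and> rho (A ^ n) = rho A ^ n"
  by (induction n) (simp_all add: one_spingrp rho_one spingrp_mult rho_mult)

lemma continuous_on_rho: "continuous_on spingrp rho"
proof -
  have "continuous_on spingrp (\<rho> \<circ> to_mat)"
    by (rule continuous_on_compose)
      (use rep in \<open>auto simp: spin7_rep_def spingrp_def bounded_linear.continuous_on[OF bounded_linear_to_mat]
         intro: continuous_on_subset\<close>)
  then have "continuous_on spingrp (\<lambda>A. of_mat ((\<rho> \<circ> to_mat) A) :: (complex,'n) sqmat)"
    by (rule bounded_linear.continuous_on[OF bounded_linear_of_mat])
  then show ?thesis by (simp add: rho_def[abs_def] o_def)
qed

lemma exp_add_scaleR: "exp ((s + t) *\<^sub>R X) = exp (s *\<^sub>R X) * exp (t *\<^sub>R (X::spinmat))"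
  unfolding scaleR_left_distrib by (rule exp_add_commuting) simp

text \<open>As a continuous one-parameter group is an exponential, the derivative at \<open>0\<close>, which defines \<open>drho X\<close>,
  determines it.\<close>
lemma rho_exp:
  assumes X: "X \<in> spinalg" shows "rho (exp (t *\<^sub>R X)) = exp (t *\<^sub>R drho X)"
proof -
  have "continuous_on UNIV (\<lambda>t. exp (t *\<^sub>R X))"
    by (intro continuous_at_imp_continuous_on ballI has_vector_derivative_continuous)
      (rule exp_scaleR_has_vector_derivative_left)
  then have cont: "continuous_on UNIV (\<lambda>t. rho (exp (t *\<^sub>R X)))"
    by (rule continuous_on_compose2[OF continuous_on_rho]) (auto intro: spinalg_exp[OF X])
  obtain A where A: "\<And>t. rho (exp (t *\<^sub>R X)) = exp (t *\<^sub>R A)"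
    by (rule one_parameter_group_exp[OF cont])
      (simp_all add: rho_one exp_add_scaleR rho_mult spinalg_exp[OF X])
  have "diff_rep \<rho> (to_mat X) = to_mat A"
    unfolding diff_rep_def
  proof (rule vector_derivative_at)
    have "((\<lambda>t. to_mat (exp (t *\<^sub>R A))) has_vector_derivative to_mat (A * exp (0 *\<^sub>R A))) (at 0)"
      by (rule bounded_linear.has_vector_derivative[OF bounded_linear_to_mat exp_scaleR_has_vector_derivative_left])
    moreover have "\<rho> (mat_exp (t *\<^sub>R to_mat X)) = to_mat (exp (t *\<^sub>R A))" for t
      by (simp add: mat_exp_eq A[symmetric] rho_def linear_scale[OF bounded_linear.linear[OF bounded_linear_of_mat]])
    ultimately show "((\<lambda>t. \<rho> (mat_exp (t *\<^sub>R to_mat X))) has_vector_derivative to_mat A) (at 0)" by simp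
  qed
  then show ?thesis by (simp add: drho_def A)
qed

lemma drho_unique: "X \<in> spinalg \<Longrightarrow> (\<And>t. rho (exp (t *\<^sub>R X)) = exp (t *\<^sub>R A)) \<Longrightarrow> drho X = A"
  by (rule exp_scaleR_inject) (simp add: rho_exp[symmetric])

lemma drho_scaleR: "X \<in> spinalg \<Longrightarrow> drho (c *\<^sub>R X) = c *\<^sub>R drho X"
proof -
  assume X: "X \<in> spinalg"
  then have "c *\<^sub>R X \<in> spinalg" by (simp add: subspace_scale subspace_spinalg)
  then show ?thesis by (rule drho_unique) (use rho_exp[OF X] in simp)
qed

text \<open>The Trotter product formula on both sides: \<open>rho\<close> is a continuous homomorphism on the group, so it
  maps the approximations of \<open>exp (t (X + Y))\<close> to those for \<open>drho X\<close> and \<open>drho Y\<close>.\<close>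
lemma drho_add:
  assumes X: "X \<in> spinalg" and Y: "Y \<in> spinalg" shows "drho (X + Y) = drho X + drho Y"
proof (rule drho_unique)
  show XY: "X + Y \<in> spinalg" using X Y by (simp add: subspace_add subspace_spinalg)
  fix t
  define a where "a n = (exp ((t *\<^sub>R X) /\<^sub>R real n) * exp ((t *\<^sub>R Y) /\<^sub>R real n)) ^ n" for n
  have e: "exp ((t *\<^sub>R Z) /\<^sub>R real n) \<in> spingrp" "rho (exp ((t *\<^sub>R Z) /\<^sub>R real n)) = exp ((t *\<^sub>R drho Z) /\<^sub>R real n)"
    if "Z \<in> spinalg" for Z n using spinalg_exp[OF that] rho_exp[OF that] by simp_all
  have lim: "a \<longlonglongrightarrow> exp (t *\<^sub>R X + t *\<^sub>R Y)" unfolding a_def by (rule trotter)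
  have aG: "a n \<in> spingrp" for n unfolding a_def using rho_power e X Y spingrp_mult by simp
  have Ra: "rho (a n) = (exp ((t *\<^sub>R drho X) /\<^sub>R real n) * exp ((t *\<^sub>R drho Y) /\<^sub>R real n)) ^ n" for n
    unfolding a_def using rho_power e X Y spingrp_mult rho_mult by simp
  have "exp (t *\<^sub>R X + t *\<^sub>R Y) \<in> spingrp" using spinalg_exp[OF XY, of t] by (simp add: scaleR_right_distrib)
  then have "(\<lambda>n. rho (a n)) \<longlonglongrightarrow> rho (exp (t *\<^sub>R X + t *\<^sub>R Y))"
    using continuous_on_rho lim aG unfolding continuous_on_sequentially comp_def by blast
  moreover have "(\<lambda>n. rho (a n)) \<longlonglongrightarrow> exp (t *\<^sub>R drho X + t *\<^sub>R drho Y)" unfolding Ra by (rule trotter)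
  ultimately show "rho (exp (t *\<^sub>R (X + Y))) = exp (t *\<^sub>R (drho X + drho Y))"
    using LIMSEQ_unique by (simp add: scaleR_right_distrib)
qed

lemma drho_zero: "drho 0 = 0"
  using drho_scaleR[of 0 0] subspace_0[OF subspace_spinalg] by simp

lemma drho_sum: "(\<And>i. i \<in> I \<Longrightarrow> f i \<in> spinalg) \<Longrightarrow> drho (sum f I) = (\<Sum>i\<in>I. drho (f i))"
  by (induction I rule: infinite_finite_induct) (simp_all add: drho_zero drho_add subspace_sum subspace_spinalg)

text \<open>A linear extension of \<open>drho\<close> from \<open>spin(7)\<close> to all matrices. Being linear on a space of finite
  dimension it is continuous, so that curves in \<open>spin(7)\<close> can be differentiated through it.\<close>
definition drho_ext :: "spinmat \<Rightarrow> (complex,'n) sqmat" where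
  "drho_ext X = - (1/4) *\<^sub>R (\<Sum>a\<in>UNIV. \<Sum>b\<in>UNIV. rot X a b *\<^sub>R drho (Eg a b))"

lemma linear_drho_ext: "linear drho_ext"
  by (rule linearI) (simp_all add: drho_ext_def rot_def distrib_right tr_simps add_divide_distrib scaleR_left_distrib
     sum.distrib scaleR_right_distrib scaleR_sum_right mult_ac)

lemma drho_ext_eq: "X \<in> spinalg \<Longrightarrow> drho_ext X = drho X"
proof -
  assume X: "X \<in> spinalg"
  have s: "rot X a b *\<^sub>R Eg a b \<in> spinalg" for a b by (intro subspace_scale subspace_spinalg Eg_spinalg)
  have "drho X = drho (- (1/4) *\<^sub>R (\<Sum>a\<in>UNIV. \<Sum>b\<in>UNIV. rot X a b *\<^sub>R Eg a b))"
    using spinalg_expand[OF X] by simp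
  also have "\<dots> = drho_ext X" unfolding drho_ext_def
    by (subst drho_scaleR) (simp_all add: drho_sum s subspace_sum subspace_spinalg drho_scaleR Eg_spinalg)
  finally show ?thesis by simp
qed

lemma conj_spinalg:
  assumes g: "g \<in> spingrp" and X: "X \<in> spinalg"
  shows "g * X * tp g \<in> spinalg" "rho g * drho X * rho (tp g) = drho (g * X * tp g)"
proof -
  have gi: "tp g * g = 1" "g * tp g = 1" using spingrp_inverse[OF g] by auto
  have e: "exp (t *\<^sub>R (g * X * tp g)) = g * exp (t *\<^sub>R X) * tp g" for t
    using exp_conjugate[OF gi, of "t *\<^sub>R X"] by simp
  have G: "g * exp (t *\<^sub>R X) \<in> spingrp" for t by (intro spingrp_mult g spinalg_exp[OF X])
  show 1: "g * X * tp g \<in> spinalg"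
    by (rule exp_spinalg) (simp add: e spingrp_mult G spingrp_tp[OF g])
  have Ri: "rho (tp g) * rho g = 1" "rho g * rho (tp g) = 1"
    using gi rho_mult[OF g spingrp_tp[OF g]] rho_mult[OF spingrp_tp[OF g] g] rho_one by auto
  have "rho (exp (t *\<^sub>R (g * X * tp g))) = exp (t *\<^sub>R (rho g * drho X * rho (tp g)))" for t
    using exp_conjugate[OF Ri, of "t *\<^sub>R drho X"]
    by (simp add: e rho_mult G spingrp_tp[OF g] g spinalg_exp[OF X] rho_exp[OF X])
  then show "rho g * drho X * rho (tp g) = drho (g * X * tp g)" using drho_unique[OF 1] by metis
qed

text \<open>The derivative at \<open>s = 0\<close> of the compatibility of \<open>drho\<close> with conjugation by \<open>exp (s Y)\<close>.\<close>
lemma drho_brk: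
  assumes Y: "Y \<in> spinalg" and X: "X \<in> spinalg"
  shows "drho (brk Y X) = brk (drho Y) (drho X)"
proof -
  have der: "((\<lambda>s. exp (s *\<^sub>R A) * (B * exp (- (s *\<^sub>R A)))) has_vector_derivative brk A B) (at 0)"
    for A B :: "'b::{real_normed_algebra_1,banach}"
    by (rule has_vector_derivative_eq_rhs[OF has_vector_derivative_mult[OF exp_scaleR_has_vector_derivative_left
       bounded_linear.has_vector_derivative[OF bounded_linear_mult_right exp_neg_has_vector_derivative]]])
      (simp add: brk_def)
  have t: "tp (exp (s *\<^sub>R Y)) = exp (- (s *\<^sub>R Y))" for s using Y by (simp add: tp_exp tp_simps spinalg_def)
  have nY: "- Y \<in> spinalg" using Y by (simp add: subspace_neg subspace_spinalg)
  have Dn: "drho (- Y) = - drho Y" using drho_scaleR[OF Y, of "-1"] by simp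
  have "((\<lambda>s. drho_ext (exp (s *\<^sub>R Y) * (X * exp (- (s *\<^sub>R Y))))) has_vector_derivative drho_ext (brk Y X)) (at 0)"
    by (rule bounded_linear.has_vector_derivative[OF bounded_linear_sqmat[OF linear_drho_ext] der])
  moreover have "drho_ext (exp (s *\<^sub>R Y) * (X * exp (- (s *\<^sub>R Y)))) = exp (s *\<^sub>R drho Y) * (drho X * exp (- (s *\<^sub>R drho Y)))" for s
  proof -
    have "rho (exp (- (s *\<^sub>R Y))) = exp (- (s *\<^sub>R drho Y))" using rho_exp[OF nY, of s] by (simp add: Dn)
    then show ?thesis
      using conj_spinalg[OF spinalg_exp[OF Y, of s] X] by (simp add: drho_ext_eq t rho_exp[OF Y] mult.assoc)
  qed
  ultimately have "((\<lambda>s. exp (s *\<^sub>R drho Y) * (drho X * exp (- (s *\<^sub>R drho Y)))) has_vector_derivative drho_ext (brk Y X)) (at 0)" by simp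
  then have "drho_ext (brk Y X) = brk (drho Y) (drho X)" using der by (rule vector_derivative_unique_at)
  then show ?thesis by (simp add: drho_ext_eq brk_spinalg X Y)
qed

end

section \<open>Eigenvectors and representations of \<open>sl\<^sub>2\<close>\<close>

text \<open>If \<open>p (T) v = 0\<close> and \<open>z\<close> is a root of \<open>p\<close>, then either \<open>T v = z v\<close>, or the vector \<open>T v - z v\<close> is
  annihilated by a polynomial of smaller degree.\<close>
lemma eigenvector_of_annihilating_poly:
  fixes T :: "complex^'n::finite \<Rightarrow> complex^'n"
  assumes T: "Vector_Spaces.linear (*s) (*s) T" and S: "vec.subspace S" "\<And>v. v \<in> S \<Longrightarrow> T v \<in> S"
  shows "degree p < N \<Longrightarrow> p \<noteq> 0 \<Longrightarrow> v \<in> S \<Longrightarrow> v \<noteq> 0 \<Longrightarrow> (\<Sum>i<N. coeff p i *s (T ^^ i) v) = 0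
    \<Longrightarrow> \<exists>w\<in>S. w \<noteq> 0 \<and> (\<exists>z. T w = z *s w)"
proof (induction N arbitrary: p v)
  case (Suc N)
  interpret T: Vector_Spaces.linear "(*s)" "(*s)" T by (rule T)
  have Tpow: "(T ^^ i) (x - z *s y) = (T ^^ i) x - z *s (T ^^ i) y" for i z x y
    by (induction i) (simp_all add: T.diff T.scale)
  show ?case
  proof (cases "degree p = 0")
    case True
    then obtain c where c: "p = [:c:]" by (metis degree_0_id)
    have "(\<Sum>i<Suc N. coeff p i *s (T ^^ i) v) = c *s v + (\<Sum>i<N. coeff p (Suc i) *s (T ^^ Suc i) v)"
      by (simp only: sum.lessThan_Suc_shift) (simp add: c)
    also have "\<dots> = c *s v" by (simp add: c)
    finally have "c *s v = 0" using Suc.prems by simp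
    then show ?thesis using Suc.prems c by (simp add: vec_eq_iff)
  next
    case False
    then obtain z where "poly p z = 0"
      using fundamental_theorem_of_algebra[of p] constant_degree[of p] by auto
    then obtain q where q: "p = [:- z, 1:] * q" using poly_eq_0_iff_dvd by (metis dvdE)
    have q0: "q \<noteq> 0" using q Suc.prems by auto
    have dq: "degree p = Suc (degree q)" using q q0 by (simp add: degree_mult_eq del: mult_pCons_left)
    have dN: "degree q < N" using dq Suc.prems by simp
    have cq: "coeff p i = (case i of 0 \<Rightarrow> 0 | Suc j \<Rightarrow> coeff q j) - z * coeff q i" for i
      by (simp add: q coeff_pCons split: nat.split)
    define w where "w = T v - z *s v"
    have w: "w \<in> S" unfolding w_def using S Suc.prems by (intro vec.subspace_diff vec.subspace_scale)
    have "(\<Sum>i<N. coeff q i *s (T ^^ i) w) = (\<Sum>i<N. coeff q i *s (T ^^ Suc i) v) - (\<Sum>i<N. (z * coeff q i) *s (T ^^ i) v)"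
      unfolding w_def Tpow by (simp add: funpow_swap1 vec.scale_right_diff_distrib sum_subtractf vec.scale_scale mult.commute)
    also have "(\<Sum>i<N. coeff q i *s (T ^^ Suc i) v) = (\<Sum>i<Suc N. (case i of 0 \<Rightarrow> 0 | Suc j \<Rightarrow> coeff q j) *s (T ^^ i) v)"
      by (simp only: sum.lessThan_Suc_shift) simp
    also have "(\<Sum>i<N. (z * coeff q i) *s (T ^^ i) v) = (\<Sum>i<Suc N. (z * coeff q i) *s (T ^^ i) v)"
      using dN by (simp add: coeff_eq_0)
    also have "(\<Sum>i<Suc N. (case i of 0 \<Rightarrow> 0 | Suc j \<Rightarrow> coeff q j) *s (T ^^ i) v) - (\<Sum>i<Suc N. (z * coeff q i) *s (T ^^ i) v)
       = (\<Sum>i<Suc N. coeff p i *s (T ^^ i) v)"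
      unfolding sum_subtractf[symmetric] cq by (simp only: vec.scale_left_diff_distrib)
    also have "\<dots> = 0" by (rule Suc.prems)
    finally have w0: "(\<Sum>i<N. coeff q i *s (T ^^ i) w) = 0" .
    show ?thesis
    proof (cases "w = 0")
      case True
      then have "T v = z *s v" by (simp add: w_def)
      then show ?thesis using Suc.prems by blast
    next
      case False
      then show ?thesis using Suc.IH[OF dN q0 w _ w0] by blast
    qed
  qed
qed simp

lemma eigenvector_exists:
  fixes T :: "complex^'n::finite \<Rightarrow> complex^'n"
  assumes T: "Vector_Spaces.linear (*s) (*s) T" and S: "vec.subspace S" "\<And>v. v \<in> S \<Longrightarrow> T v \<in> S"
    and v: "v \<in> S" "v \<noteq> 0"
  obtains w z where "w \<in> S" "w \<noteq> 0" "T w = z *s w"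
proof -
  define N where "N = Suc CARD('n)"
  have "\<exists>c. (\<exists>i<N. c i \<noteq> 0) \<and> (\<Sum>i<N. c i *s (T ^^ i) v) = 0"
  proof (cases "inj_on (\<lambda>i. (T ^^ i) v) {..<N}")
    case True
    let ?B = "(\<lambda>i. (T ^^ i) v) ` {..<N}"
    have "card ?B = N" using True by (simp add: card_image)
    then have "vec.dependent ?B"
      using vec.independent_card_le_dim[of ?B UNIV] by (auto simp: N_def vec_dim_card simp del: vec.dim_UNIV)
    then obtain u where u: "\<exists>b\<in>?B. u b \<noteq> 0" "(\<Sum>b\<in>?B. u b *s b) = 0"
      by (auto simp: vec.dependent_finite)
    show ?thesis
    proof (rule exI[of _ "\<lambda>i. u ((T ^^ i) v)"], rule conjI)
      show "\<exists>i<N. u ((T ^^ i) v) \<noteq> 0" using u(1) by auto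
      show "(\<Sum>i<N. u ((T ^^ i) v) *s (T ^^ i) v) = 0"
        using u(2) by (simp add: sum.reindex[OF True] o_def)
    qed
  next
    case False
    then obtain i j where ij: "i < N" "j < N" "i \<noteq> j" "(T ^^ i) v = (T ^^ j) v" by (auto simp: inj_on_def)
    define c :: "nat \<Rightarrow> complex" where "c k = (if k = i then 1 else 0) - (if k = j then 1 else 0)" for k
    have "(\<Sum>k<N. c k *s (T ^^ k) v) = (T ^^ i) v - (T ^^ j) v"
      using ij by (simp add: c_def vec.scale_left_diff_distrib sum_subtractf if_distrib[of "\<lambda>x. x *s _"] cong: if_cong)
    moreover have "c i \<noteq> 0" using ij by (simp add: c_def)
    ultimately show ?thesis using ij by (intro exI[of _ c]) auto
  qed
  then obtain c where c: "\<exists>i<N. c i \<noteq> 0" "(\<Sum>i<N. c i *s (T ^^ i) v) = 0" by blast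
  define p where "p = Poly (map c [0..<N])"
  have cp: "coeff p i = (if i < N then c i else 0)" for i by (simp add: p_def nth_default_def)
  have "p \<noteq> 0" using c(1) cp by (metis coeff_0)
  moreover have "degree p < N" using \<open>p \<noteq> 0\<close> cp by (metis leading_coeff_0_iff)
  moreover have "(\<Sum>i<N. coeff p i *s (T ^^ i) v) = 0" using c(2) by (simp add: cp)
  ultimately show thesis using eigenvector_of_annihilating_poly[OF T S, of p N v] v that by blast
qed

lemma norm_vscale: "norm (c *s (v::complex^'n::finite)) = norm c * norm v"
  by (simp add: norm_vec_def L2_set_def norm_mult power_mult_distrib sum_distrib_left[symmetric] real_sqrt_mult)

text \<open>The vectors \<open>f\<^sup>k v\<close> have the distinct eigenvalues \<open>\<mu> - 2 k\<close> of the bounded operator \<open>h\<close>, so one of them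
  is zero; at the first such \<open>k = n + 1\<close> the formula for \<open>e f\<^sup>n\<^sup>+\<^sup>1 v\<close> forces \<open>\<mu> = n\<close>.\<close>
lemma sl2_highest_weight_nat:
  fixes e f h :: "complex^'n::finite \<Rightarrow> complex^'n"
  assumes e: "Vector_Spaces.linear (*s) (*s) e" and f: "Vector_Spaces.linear (*s) (*s) f"
    and bnd: "\<And>x. norm (h x) \<le> K * norm x"
    and ef: "\<And>x. e (f x) = f (e x) + h x" and hf: "\<And>x. h (f x) = f (h x) - 2 *s f x"
    and v: "v \<noteq> 0" "e v = 0" "h v = \<mu> *s v"
  shows "\<exists>n. \<mu> = of_nat n"
proof -
  interpret e: Vector_Spaces.linear "(*s)" "(*s)" e by (rule e)
  interpret f: Vector_Spaces.linear "(*s)" "(*s)" f by (rule f)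
  define w where "w k = (f ^^ k) v" for k
  have w0: "w 0 = v" and wS: "w (Suc k) = f (w k)" for k by (simp_all add: w_def)
  have hw: "h (w k) = (\<mu> - 2 * of_nat k) *s w k" for k
  proof (induction k)
    case (Suc k)
    have "h (w (Suc k)) = f ((\<mu> - 2 * of_nat k) *s w k) - 2 *s f (w k)" by (simp add: wS hf Suc)
    also have "\<dots> = (\<mu> - 2 * of_nat (Suc k)) *s w (Suc k)"
      by (simp only: f.scale wS) (simp add: vec_eq_iff algebra_simps)
    finally show ?case .
  qed (simp add: w0 v)
  have ew: "e (w (Suc k)) = (of_nat (Suc k) * (\<mu> - of_nat k)) *s w k" for k
  proof (induction k)
    case 0
    show ?case by (simp add: wS w0 ef v f.zero)
  next
    case (Suc k)
    have "e (w (Suc (Suc k))) = f (e (w (Suc k))) + h (w (Suc k))" by (simp add: wS ef)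
    also have "\<dots> = (of_nat (Suc k) * (\<mu> - of_nat k)) *s w (Suc k) + (\<mu> - 2 * of_nat (Suc k)) *s w (Suc k)"
      by (simp only: Suc hw f.scale wS[symmetric])
    also have "\<dots> = (of_nat (Suc (Suc k)) * (\<mu> - of_nat (Suc k))) *s w (Suc k)"
      unfolding vec.scale_left_distrib[symmetric] by (simp add: algebra_simps)
    finally show ?case .
  qed
  have "\<exists>k. w k = 0"
  proof (rule ccontr)
    assume nz: "\<nexists>k. w k = 0"
    have "norm (\<mu> - 2 * of_nat k) \<le> K" for k
    proof -
      have "norm (\<mu> - 2 * of_nat k) * norm (w k) = norm (h (w k))"
        by (simp only: hw norm_vscale)
      also have "\<dots> \<le> K * norm (w k)" by (rule bnd)
      finally show ?thesis using nz by simp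
    qed
    note b = this
    obtain k where k: "real k > norm \<mu> + K" using reals_Archimedean2 by blast
    have "norm (2 * of_nat k :: complex) \<le> norm \<mu> + norm (\<mu> - 2 * of_nat k)"
      using norm_triangle_ineq4[of \<mu> "\<mu> - 2 * of_nat k"] by simp
    then have "2 * real k \<le> norm \<mu> + K" using b[of k] by (simp add: norm_mult)
    then show False using k by simp
  qed
  define k where "k = (LEAST k. w k = 0)"
  have k: "w k = 0" unfolding k_def using \<open>\<exists>k. w k = 0\<close> by (rule LeastI_ex)
  have "k \<noteq> 0" using k w0 v by metis
  then obtain n where n: "k = Suc n" by (metis not0_implies_Suc)
  have wn: "w n \<noteq> 0" using not_less_Least[of n "\<lambda>k. w k = 0"] n k_def by auto
  have "(of_nat (Suc n) * (\<mu> - of_nat n)) *s w n = 0" using ew[of n] k n e.zero by simp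
  then have "of_nat (Suc n) * (\<mu> - of_nat n) = 0" using wn by (simp only: vec.scale_eq_0_iff) simp
  then have "\<mu> = of_nat n" by (simp only: mult_eq_0_iff of_nat_eq_0_iff) simp
  then show ?thesis by blast
qed

section \<open>Highest weights and the Casimir operator\<close>
lemma gm_gm_Eg: "gm a * gm b = Eg a b - (if a = b then 1 else 0)" by (simp add: Eg_def)

lemma brk_Eg_Eg: "brk (Eg a b) (Eg c d) = 2 *\<^sub>R ((if a = c then 1 else 0) *\<^sub>R Eg b d - (if b = c then 1 else 0) *\<^sub>R Eg a d
   + (if a = d then 1 else 0) *\<^sub>R Eg c b - (if b = d then 1 else 0) *\<^sub>R Eg c a)"
proof -
  have "brk (Eg a b) (Eg c d) = brk (gm a * gm b) (gm c) * gm d + gm c * brk (gm a * gm b) (gm d)"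
    unfolding brk_Eg by (simp add: Eg_def brk_def algebra_simps)
  then show ?thesis unfolding brk_gmgm
    by (rule trans) (auto simp: left_diff_distrib right_diff_distrib gm_gm_Eg scaleR_2)
qed

lemma Eg_same: "Eg i i = 0" by (simp add: Eg_def gm_square)

text \<open>The trace of a bilinear form does not depend on the orthonormal basis. This makes the Casimir
  operator invariant under Spin(7), and the Dirac operator independent of the chosen basis of \<open>m\<close>.\<close>
lemma orthonormal_basis_trace:
  fixes \<beta> :: "real^7 \<Rightarrow> real^7 \<Rightarrow> 'v::real_vector" and U :: "7 \<Rightarrow> real^7"
  assumes \<beta>: "bilinear \<beta>" and U: "\<And>a b. U a \<bullet> U b = (if a = b then 1 else 0)"
  shows "(\<Sum>i\<in>UNIV. \<beta> (U i) (U i)) = (\<Sum>i\<in>UNIV. \<beta> (e7 i) (e7 i))"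
proof -
  have l: "linear (\<beta> x)" "linear (\<lambda>x. \<beta> x y)" for x y using \<beta> by (auto simp: bilinear_def)
  have ex: "u = (\<Sum>i\<in>UNIV. u $ i *\<^sub>R e7 i)" for u :: "real^7"
    by (simp add: vec_eq_iff axis_def sum_delta_mult)
  have bex: "\<beta> u v = (\<Sum>a\<in>UNIV. \<Sum>c\<in>UNIV. (u $ a * v $ c) *\<^sub>R \<beta> (e7 a) (e7 c))" for u v
    by (subst ex[of u], subst ex[of v])
      (simp only: linear_sum[OF l(1)] linear_sum[OF l(2)] linear_scale[OF l(1)] linear_scale[OF l(2)] scaleR_sum_right scaleR_scaleR,
       subst sum.swap, simp only: mult.commute)
  have "(\<Sum>i\<in>UNIV. \<beta> (U i) (U i)) = (\<Sum>i\<in>UNIV. \<Sum>a\<in>UNIV. \<Sum>c\<in>UNIV. (U i $ a * U i $ c) *\<^sub>R \<beta> (e7 a) (e7 c))"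
    by (intro sum.cong refl bex)
  also have "\<dots> = (\<Sum>a\<in>UNIV. \<Sum>c\<in>UNIV. \<Sum>i\<in>UNIV. (U i $ a * U i $ c) *\<^sub>R \<beta> (e7 a) (e7 c))"
    by (rule trans[OF sum.swap sum.cong[OF refl sum.swap]])
  also have "\<dots> = (\<Sum>a\<in>UNIV. \<Sum>c\<in>UNIV. (if a = c then 1 else 0) *\<^sub>R \<beta> (e7 a) (e7 c))"
    by (simp only: scaleR_sum_left[symmetric] orthonormal_rows_columns[OF U])
  also have "\<dots> = (\<Sum>a\<in>UNIV. \<beta> (e7 a) (e7 a))"
    by (simp add: if_distrib[of "\<lambda>x. x *\<^sub>R _"] cong: if_cong)
  finally show ?thesis .
qed

lemma Re_Im_mat_mult:
  "Re_mat (A ** B) = Re_mat A ** Re_mat B - Im_mat A ** Im_mat B"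
  "Im_mat (A ** B) = Re_mat A ** Im_mat B + Im_mat A ** Re_mat B"
  by (simp_all add: vec_eq_iff Re_mat_def Im_mat_def matrix_matrix_mult_def sum_subtractf sum.distrib)

lemma Re_Im_mat_simps:
  "Re_mat (A - B) = Re_mat A - Re_mat B" "Im_mat (A - B) = Im_mat A - Im_mat B"
  "Re_mat (mscale (of_real r) A) = r *\<^sub>R Re_mat A" "Im_mat (mscale (of_real r) A) = r *\<^sub>R Im_mat A"
  "Re_mat (complex_mat X + mscale \<i> (complex_mat Y)) = X" "Im_mat (complex_mat X + mscale \<i> (complex_mat Y)) = Y"
  by (simp_all add: vec_eq_iff Re_mat_def Im_mat_def mscale_def complex_mat_def)

context spin_rep
begin

text \<open>The action of \<open>spin(7)\<close> on vectors.\<close>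
definition op :: "spinmat \<Rightarrow> complex^'n \<Rightarrow> complex^'n" where "op X v = to_mat (drho_ext X) *v v"

lemma op_lin: "op (X + Y) v = op X v + op Y v" "op (X - Y) v = op X v - op Y v" "op (r *\<^sub>R X) v = r *\<^sub>R op X v"
  "op (- X) v = - op X v" "op 0 v = 0"
  by (simp_all add: op_def linear_add[OF linear_drho_ext] linear_diff[OF linear_drho_ext] linear_scale[OF linear_drho_ext] linear_neg[OF linear_drho_ext]
    linear_0[OF linear_drho_ext] plus_sqmat.rep_eq minus_sqmat.rep_eq scaleR_sqmat.rep_eq uminus_sqmat.rep_eq zero_sqmat.rep_eq)
    (simp_all add: vec_eq_iff matrix_vector_mult_def algebra_simps sum.distrib sum_subtractf sum_negf scaleR_sum_right)

lemma linear_op: "Vector_Spaces.linear (*s) (*s) (op X)"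
  unfolding op_def by (rule matrix_vector_mul_linear_gen)

lemma op_vec: "op X (v + w) = op X v + op X w" "op X (v - w) = op X v - op X w" "op X (c *s v) = c *s op X v"
  "op X (- v) = - op X v" "op X 0 = 0"
proof -
  interpret L: Vector_Spaces.linear "(*s)" "(*s)" "op X" by (rule linear_op)
  show "op X (v + w) = op X v + op X w" "op X (v - w) = op X v - op X w" "op X (c *s v) = c *s op X v"
  "op X (- v) = - op X v" "op X 0 = 0" by (simp_all add: L.add L.diff L.scale L.neg L.zero)
qed

lemma op_brk: "X \<in> spinalg \<Longrightarrow> Y \<in> spinalg \<Longrightarrow> op (brk X Y) v = op X (op Y v) - op Y (op X v)"
proof -
  assume X: "X \<in> spinalg" and Y: "Y \<in> spinalg"
  have "drho_ext (brk X Y) = drho_ext X * drho_ext Y - drho_ext Y * drho_ext X"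
    by (simp only: drho_ext_eq[OF brk_spinalg[OF X Y]] drho_ext_eq[OF X] drho_ext_eq[OF Y] drho_brk[OF X Y] brk_def[of "drho X"])
  then show ?thesis
    by (simp add: op_def minus_sqmat.rep_eq times_sqmat.rep_eq matrix_vector_mult_diff_rdistrib matrix_vector_mul_assoc)
qed

lemma op_norm: "norm (op X v) \<le> norm (drho_ext X) * norm v"
  unfolding op_def norm_sqmat_def by (rule onorm[OF bounded_linear_matvec])

lemma scaleR_vscale: "r *\<^sub>R (v::complex^'m) = of_real r *s v"
  by (simp add: vec_eq_iff complex_eq_iff)

text \<open>The Cartan element \<open>cartan k\<close> is \<open>\<i>\<close> times this real matrix, see \<open>cartan_parts\<close>; hence the factor
  \<open>\<i>\<close> in \<open>hk\<close>.\<close>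
definition cE :: "nat \<Rightarrow> spinmat" where
  "cE k = (1/2) *\<^sub>R Eg (of_nat (2 * k - 1)) (of_nat (2 * k))"

lemma cE_simps: "cE 1 = (1/2) *\<^sub>R Eg 1 2" "cE 2 = (1/2) *\<^sub>R Eg 3 4" "cE 3 = (1/2) *\<^sub>R Eg 5 6"
  "cE (Suc 0) = (1/2) *\<^sub>R Eg 1 2"
  by (simp_all add: cE_def)

lemma cE_spinalg: "cE k \<in> spinalg" unfolding cE_def by (intro subspace_scale subspace_spinalg Eg_spinalg)

definition hk :: "nat \<Rightarrow> complex^'n \<Rightarrow> complex^'n" where "hk k v = \<i> *s op (cE k) v"

text \<open>A root vector \<open>X + \<i> Y\<close> of the complexified Lie algebra, for the root \<open>(a1, a2, a3)\<close>, is handled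
  through its real and imaginary parts: separating them in \<open>[\<i> c, X + \<i> Y] = a (X + \<i> Y)\<close> gives
  \<open>[c, X] = a Y\<close> and \<open>[c, Y] = - a X\<close>.\<close>
definition pairrel :: "spinmat \<Rightarrow> spinmat \<Rightarrow> real \<Rightarrow> real \<Rightarrow> real \<Rightarrow> bool" where
  "pairrel X Y a1 a2 a3 \<longleftrightarrow> X \<in> spinalg \<and> Y \<in> spinalg \<and>
    brk (cE 1) X = a1 *\<^sub>R Y \<and> brk (cE 1) Y = - (a1 *\<^sub>R X) \<and>
    brk (cE 2) X = a2 *\<^sub>R Y \<and> brk (cE 2) Y = - (a2 *\<^sub>R X) \<and>
    brk (cE 3) X = a3 *\<^sub>R Y \<and> brk (cE 3) Y = - (a3 *\<^sub>R X)"

definition opC :: "spinmat \<Rightarrow> spinmat \<Rightarrow> complex^'n \<Rightarrow> complex^'n" where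
  "opC X Y v = op X v + \<i> *s op Y v"

lemma linear_hk: "Vector_Spaces.linear (*s) (*s) (hk k)"
  by unfold_locales (simp_all add: hk_def op_vec vec_eq_iff algebra_simps)

lemma linear_opC: "Vector_Spaces.linear (*s) (*s) (opC X Y)"
  by unfold_locales (simp_all add: opC_def op_vec vec_eq_iff algebra_simps)

text \<open>A root vector shifts the eigenvalues of the Cartan subalgebra by its root.\<close>
lemma opC_raises_weight:
  assumes c: "c \<in> spinalg" "X \<in> spinalg" "Y \<in> spinalg" and r: "brk c X = a *\<^sub>R Y" "brk c Y = - (a *\<^sub>R X)"
  shows "\<i> *s op c (opC X Y v) = opC X Y (\<i> *s op c v) + of_real a *s opC X Y v"
proof -
  have 1: "op c (op X v) = op X (op c v) + of_real a *s op Y v"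
    using op_brk[OF c(1,2), of v] r by (simp add: op_lin scaleR_vscale algebra_simps)
  have 2: "op c (op Y v) = op Y (op c v) - of_real a *s op X v"
    using op_brk[OF c(1,3), of v] r by (simp add: op_lin scaleR_vscale algebra_simps)
  show ?thesis unfolding opC_def op_vec 1 2 by (simp add: vec_eq_iff algebra_simps)
qed

lemma hk_commute: "hk j (hk k v) = hk k (hk j v)" if "j \<in> {1,2,3}" "k \<in> {1,2,3}"
proof -
  have "brk (cE j) (cE k) = 0"
    using that by (auto simp: cE_simps brk_Eg_Eg Eg_same linear_scale[OF linear_brk] linear_scale[OF linear_brk_left])
  then have "op (cE j) (op (cE k) v) = op (cE k) (op (cE j) v)"
    using op_brk[OF cE_spinalg cE_spinalg, of j k v] by (simp add: op_lin)
  then show ?thesis by (simp add: hk_def op_vec)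
qed

text \<open>Each positive root takes a value of at least \<open>1\<close> on \<open>H = 3 h\<^sub>1 + 2 h\<^sub>2 + h\<^sub>3\<close>. The real parts of the
  eigenvalues of \<open>H\<close> are bounded; on an eigenvector whose eigenvalue has a real part within distance
  less than \<open>1\<close> of their supremum, every positive root vector vanishes, for otherwise it would
  produce an eigenvalue beyond the supremum.\<close>
lemma highest_weight_vector:
  obtains v l1 l2 l3 where "v \<noteq> 0" "hk 1 v = l1 *s v" "hk 2 v = l2 *s v" "hk 3 v = l3 *s v"
    "\<And>X Y a1 a2 a3. pairrel X Y a1 a2 a3 \<Longrightarrow> 3 * a1 + 2 * a2 + a3 \<ge> 1 \<Longrightarrow> opC X Y v = 0"
proof -
  define c where "c = 3 *\<^sub>R cE 1 + 2 *\<^sub>R cE 2 + cE 3"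
  have cs: "c \<in> spinalg" unfolding c_def by (intro subspace_add subspace_scale subspace_spinalg cE_spinalg)
  define H where "H v = \<i> *s op c v" for v
  have H: "H v = 3 *s hk 1 v + 2 *s hk 2 v + hk 3 v" for v
    by (simp add: H_def c_def hk_def op_lin scaleR_vscale vec_eq_iff algebra_simps)
  have linH: "Vector_Spaces.linear (*s) (*s) H"
    by unfold_locales (simp_all add: H_def op_vec vec_eq_iff algebra_simps)
  interpret H: Vector_Spaces.linear "(*s)" "(*s)" H by (rule linH)
  have bH: "norm (H v) \<le> norm (drho_ext c) * norm v" for v
    unfolding H_def norm_vscale using op_norm[of c v] by simp
  define E where "E = {z. \<exists>w. w \<noteq> 0 \<and> H w = z *s w}"
  have "\<exists>x::complex^'n. x \<noteq> 0" by (rule exI[of _ "axis undefined 1"]) (simp add: axis_eq_0_iff)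
  then obtain x :: "complex^'n" where "x \<noteq> 0" by blast
  then obtain w z where "w \<noteq> 0" "H w = z *s w"
    using eigenvector_exists[OF linH vec.subspace_UNIV _ UNIV_I \<open>x \<noteq> 0\<close>] by blast
  then have Ene: "E \<noteq> {}" by (auto simp: E_def)
  have Eb: "Re z \<le> norm (drho_ext c)" if zE: "z \<in> E" for z
  proof -
    obtain w where w: "w \<noteq> 0" "H w = z *s w" using zE by (auto simp: E_def)
    have "norm z * norm w \<le> norm (drho_ext c) * norm w" using bH[of w] by (simp only: w(2) norm_vscale)
    then have "norm z \<le> norm (drho_ext c)" using w(1) by simp
    then show ?thesis using complex_Re_le_cmod order_trans by blast
  qed
  then have bdd: "bdd_above (Re ` E)" by (auto simp: bdd_above_def)
  obtain z where z: "z \<in> E" "Re z > Sup (Re ` E) - 1"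
    using less_cSupE[of "Sup (Re ` E) - 1" "Re ` E"] Ene by auto
  have max: "z' \<in> E \<Longrightarrow> Re z' < Re z + 1" for z'
    using cSup_upper[OF _ bdd, of "Re z'"] z(2) by force
  obtain w0 where w0: "w0 \<noteq> 0" "H w0 = z *s w0" using z(1) by (auto simp: E_def)
  \<comment> \<open>Inside the eigenspace of \<open>H\<close> there is an eigenvector of \<open>h\<^sub>1\<close>, inside their joint eigenspace one of \<open>h\<^sub>2\<close>; it is one of \<open>h\<^sub>3\<close> too.\<close>
  have hH: "H (hk k v) = hk k (H v)" if "k \<in> {1,2,3}" for k v
  proof -
    interpret h: Vector_Spaces.linear "(*s)" "(*s)" "hk k" by (rule linear_hk)
    have cm: "hk 1 (hk k v) = hk k (hk 1 v)" "hk 2 (hk k v) = hk k (hk 2 v)" "hk 3 (hk k v) = hk k (hk 3 v)"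
      by (rule hk_commute; use that in simp)+
    show ?thesis by (simp only: H h.add h.scale cm)
  qed
  define S1 where "S1 = {v. H v = z *s v}"
  have S1: "vec.subspace S1" unfolding S1_def
    by (rule vec.subspaceI) (simp_all add: H.zero H.add H.scale vec_eq_iff algebra_simps)
  interpret h1: Vector_Spaces.linear "(*s)" "(*s)" "hk 1" by (rule linear_hk)
  interpret h2: Vector_Spaces.linear "(*s)" "(*s)" "hk 2" by (rule linear_hk)
  have "hk 1 v \<in> S1" if "v \<in> S1" for v using that by (simp add: S1_def hH h1.scale del: One_nat_def)
  then obtain w1 l1 where w1: "w1 \<in> S1" "w1 \<noteq> 0" "hk 1 w1 = l1 *s w1"
    using eigenvector_exists[OF linear_hk S1, of 1 w0] w0 by (auto simp: S1_def)
  define S2 where "S2 = {v. v \<in> S1 \<and> hk 1 v = l1 *s v}"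
  have S2: "vec.subspace S2" unfolding S2_def
  proof (rule vec.subspaceI)
    show "0 \<in> {v. v \<in> S1 \<and> hk 1 v = l1 *s v}" by (simp add: vec.subspace_0[OF S1] h1.zero del: One_nat_def)
    show "x + y \<in> {v. v \<in> S1 \<and> hk 1 v = l1 *s v}"
      if "x \<in> {v. v \<in> S1 \<and> hk 1 v = l1 *s v}" "y \<in> {v. v \<in> S1 \<and> hk 1 v = l1 *s v}" for x y
      using that by (simp add: vec.subspace_add[OF S1] h1.add vec.scale_right_distrib del: One_nat_def)
    show "c *s x \<in> {v. v \<in> S1 \<and> hk 1 v = l1 *s v}" if "x \<in> {v. v \<in> S1 \<and> hk 1 v = l1 *s v}" for c x
      using that by (simp add: vec.subspace_scale[OF S1] h1.scale del: One_nat_def)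
  qed
  have "hk 2 v \<in> S2" if "v \<in> S2" for v using that by (auto simp: S2_def S1_def hH h2.scale hk_commute[of 1 2] simp del: One_nat_def)
  then obtain v l2 where v: "v \<in> S2" "v \<noteq> 0" "hk 2 v = l2 *s v"
    using eigenvector_exists[OF linear_hk S2, of 2 w1] w1 by (auto simp: S2_def)
  have v1: "hk 1 v = l1 *s v" and vH: "H v = z *s v" using v by (auto simp: S2_def S1_def)
  have v3: "hk 3 v = (z - 3 * l1 - 2 * l2) *s v"
    using H[of v] unfolding vH v1 v(3) by (simp add: vec_eq_iff algebra_simps)
  have kill: "opC X Y v = 0" if p: "pairrel X Y a1 a2 a3" and a: "3 * a1 + 2 * a2 + a3 \<ge> 1" for X Y a1 a2 a3
  proof (rule ccontr)
    assume nz: "opC X Y v \<noteq> 0"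
    interpret o: Vector_Spaces.linear "(*s)" "(*s)" "opC X Y" by (rule linear_opC)
    have "H (opC X Y v) = opC X Y (H v) + of_real (3 * a1 + 2 * a2 + a3) *s opC X Y v"
      unfolding H_def
    proof (rule opC_raises_weight[OF cs])
      show "X \<in> spinalg" "Y \<in> spinalg" using p by (auto simp: pairrel_def)
      show "brk c X = (3 * a1 + 2 * a2 + a3) *\<^sub>R Y" "brk c Y = - ((3 * a1 + 2 * a2 + a3) *\<^sub>R X)"
        using p unfolding c_def
        by (auto simp: pairrel_def linear_add[OF linear_brk_left] linear_scale[OF linear_brk_left] scaleR_left_distrib)
    qed
    also have "\<dots> = (z + of_real (3 * a1 + 2 * a2 + a3)) *s opC X Y v"
      by (simp add: vH o.scale vec.scale_left_distrib)
    finally have "z + of_real (3 * a1 + 2 * a2 + a3) \<in> E" using nz by (auto simp: E_def)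
    from max[OF this] show False using a by simp
  qed
  show thesis
  proof (rule that[OF v(2) v1 v(3) v3])
    show "opC X Y v = 0" if p: "pairrel X Y a1 a2 a3" and a: "3 * a1 + 2 * a2 + a3 \<ge> 1" for X Y a1 a2 a3
      by (rule kill[OF p a])
  qed
qed

text \<open>From \<open>(X - \<i> Y) (X + \<i> Y) v = 0\<close>. This evaluates the Casimir operator on a highest weight vector
  without choosing a basis of root vectors.\<close>
lemma sum_squares_on_killed_vector:
  assumes s: "X \<in> spinalg" "Y \<in> spinalg" and k: "opC X Y v = 0"
  shows "op X (op X v) + op Y (op Y v) = - (\<i> *s op (brk X Y) v)"
proof -
  have "op X (opC X Y v) - \<i> *s op Y (opC X Y v) = 0" by (simp add: k op_vec)
  then show ?thesis unfolding opC_def op_vec op_brk[OF s]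
    by (simp add: vec_eq_iff algebra_simps add_eq_0_iff2)
qed

text \<open>The operators \<open>X + \<i> Y\<close>, a multiple of \<open>X - \<i> Y\<close>, and \<open>\<i> c\<close> form an \<open>sl\<^sub>2\<close>-triple.\<close>
lemma simple_coroot_eigenvalue_nat:
  assumes s: "X \<in> spinalg" "Y \<in> spinalg" "c \<in> spinalg"
    and r: "brk c X = 2 *\<^sub>R Y" "brk c Y = - (2 *\<^sub>R X)" "brk X Y = t *\<^sub>R c" "t \<noteq> 0"
    and v: "v \<noteq> 0" "opC X Y v = 0" "\<i> *s op c v = \<mu> *s v"
  shows "\<exists>n. \<mu> = of_nat n"
proof -
  \<comment> \<open>The factor makes the commutator with \<open>X + \<i> Y\<close> equal to \<open>\<i> c\<close>.\<close>
  define f where "f v = of_real (- 1 / (2 * t)) *s (op X v - \<i> *s op Y v)" for v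
  have lf: "Vector_Spaces.linear (*s) (*s) f"
    by unfold_locales (simp_all add: f_def op_vec vec_eq_iff algebra_simps)
  have f': "op X v - \<i> *s op Y v = opC X (- Y) v" for v by (simp add: opC_def op_lin vec_eq_iff)
  show ?thesis
  proof (rule sl2_highest_weight_nat[where h = "\<lambda>v. \<i> *s op c v" and K = "norm (drho_ext c)" and e = "opC X Y" and f = f, OF linear_opC lf _ _ _ v])
    show "norm (\<i> *s op c x) \<le> norm (drho_ext c) * norm x" for x using op_norm[of c x] by (simp add: norm_vscale)
    show "opC X Y (f x) = f (opC X Y x) + \<i> *s op c x" for x
    proof -
      have xy: "op X (op Y x) = op Y (op X x) + of_real t *s op c x"
        using op_brk[OF s(1,2), of x] r by (simp add: op_lin scaleR_vscale algebra_simps)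
      have "opC X Y (f x) - f (opC X Y x) = of_real (- 1 / (2 * t)) *s ((- 2 * \<i> * of_real t) *s op c x)"
        unfolding opC_def f_def op_vec xy by (simp add: vec_eq_iff algebra_simps)
      also have "\<dots> = \<i> *s op c x" using r(4) by (simp add: vec_eq_iff)
      finally show ?thesis by (simp add: algebra_simps)
    qed
    show "\<i> *s op c (f x) = f (\<i> *s op c x) - 2 *s f x" for x
    proof -
      have nY: "- Y \<in> spinalg" using s by (simp add: subspace_neg subspace_spinalg)
      have "\<i> *s op c (opC X (- Y) x) = opC X (- Y) (\<i> *s op c x) + of_real (- 2) *s opC X (- Y) x"
        by (rule opC_raises_weight[OF s(3,1) nY]) (use r in \<open>simp_all add: linear_neg[OF linear_brk]\<close>)
      note sh = this
      define r where "r = complex_of_real (- 1 / (2 * t))"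
      have fx: "f y = r *s opC X (- Y) y" for y by (simp only: f_def f' r_def)
      have "\<i> *s op c (f x) = r *s (\<i> *s op c (opC X (- Y) x))"
        unfolding fx op_vec by (rule vec.scale_left_commute)
      also have "\<dots> = f (\<i> *s op c x) - 2 *s f x"
        unfolding sh fx by (simp add: vec_eq_iff algebra_simps)
      finally show ?thesis .
    qed
  qed
qed

text \<open>Summed over all \<open>i\<close>, \<open>j\<close>, this is \<open>- 6\<close> times the Casimir operator for the inner product \<open>ip\<close>.\<close>
definition sq :: "7 \<Rightarrow> 7 \<Rightarrow> complex^'n \<Rightarrow> complex^'n" where "sq i j v = op (Eg i j) (op (Eg i j) v)"

text \<open>For the planes \<open>p, q\<close> and \<open>r, s\<close> of two coordinates \<open>\<epsilon>\<^sub>k\<close>, \<open>\<epsilon>\<^sub>l\<close>, the two root vectors belong to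
  \<open>\<epsilon>\<^sub>k - \<epsilon>\<^sub>l\<close> and \<open>\<epsilon>\<^sub>k + \<epsilon>\<^sub>l\<close>. The contributions of \<open>\<epsilon>\<^sub>l\<close> cancel, and \<open>l\<close> is the value of the weight on
  \<open>\<epsilon>\<^sub>k\<close>.\<close>
lemma casimir_long_roots:
  assumes d: "distinct [p, q, r, s]"
    and k: "opC (Eg p r + Eg q s) (Eg q r - Eg p s) v = 0" "opC (Eg p r - Eg q s) (Eg q r + Eg p s) v = 0"
    and h: "op (Eg p q) v = (- 2 * \<i> * l) *s v"
  shows "sq p r v + sq p s v + sq q r v + sq q s v = (- 8 * l) *s v"
proof -
  have ne: "p \<noteq> q" "q \<noteq> p" "p \<noteq> r" "r \<noteq> p" "p \<noteq> s" "s \<noteq> p" "q \<noteq> r" "r \<noteq> q" "q \<noteq> s" "s \<noteq> q" "r \<noteq> s" "s \<noteq> r"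
    using d by auto
  note E = Eg_spinalg subspace_add[OF subspace_spinalg] subspace_diff[OF subspace_spinalg]
  have "brk (Eg p r + Eg q s) (Eg q r - Eg p s) + brk (Eg p r - Eg q s) (Eg q r + Eg p s) = 2 *\<^sub>R (brk (Eg p r) (Eg q r) - brk (Eg q s) (Eg p s))"
    by (simp add: brk_def algebra_simps scaleR_2)
  also have "\<dots> = 8 *\<^sub>R Eg p q"
    using d by (intro sqmat_eqI) (simp add: brk_Eg_Eg Eg_swap[of q p] entries ne)
  finally have b: "brk (Eg p r + Eg q s) (Eg q r - Eg p s) + brk (Eg p r - Eg q s) (Eg q r + Eg p s) = 8 *\<^sub>R Eg p q" .
  have "2 *s (sq p r v + sq p s v + sq q r v + sq q s v)
    = (op (Eg p r + Eg q s) (op (Eg p r + Eg q s) v) + op (Eg q r - Eg p s) (op (Eg q r - Eg p s) v))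
     + (op (Eg p r - Eg q s) (op (Eg p r - Eg q s) v) + op (Eg q r + Eg p s) (op (Eg q r + Eg p s) v))"
    by (simp add: sq_def op_lin op_vec vec_eq_iff algebra_simps)
  also have "\<dots> = - (\<i> *s op (8 *\<^sub>R Eg p q) v)"
    unfolding sum_squares_on_killed_vector[OF E(2)[OF E(1) E(1)] E(3)[OF E(1) E(1)] k(1)]
      sum_squares_on_killed_vector[OF E(3)[OF E(1) E(1)] E(2)[OF E(1) E(1)] k(2)]
    unfolding b[symmetric] op_lin(1) by (simp add: vec_eq_iff algebra_simps)
  also have "\<dots> = 2 *s ((- 8 * l) *s v)"
    by (simp add: op_lin h scaleR_vscale vec_eq_iff algebra_simps)
  finally show ?thesis by (rule vec.scale_left_imp_eq[rotated]) simp
qed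

lemma casimir_short_root:
  assumes d: "distinct [p, q, r]" and k: "opC (Eg p r) (Eg q r) v = 0"
    and h: "op (Eg p q) v = (- 2 * \<i> * l) *s v"
  shows "sq p r v + sq q r v = (- 4 * l) *s v"
proof -
  have ne: "p \<noteq> q" "q \<noteq> p" "p \<noteq> r" "r \<noteq> p" "q \<noteq> r" "r \<noteq> q" using d by auto
  have "brk (Eg p r) (Eg q r) = 2 *\<^sub>R Eg p q" by (simp add: brk_Eg_Eg Eg_swap[of q p] ne)
  then show ?thesis using sum_squares_on_killed_vector[OF Eg_spinalg Eg_spinalg k]
    by (simp add: sq_def op_lin h scaleR_vscale vec_eq_iff algebra_simps)
qed

lemma pairrel_roots:
  "pairrel (Eg 1 3 + Eg 2 4) (Eg 2 3 - Eg 1 4) 1 (-1) 0"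
  "pairrel (Eg 1 3 - Eg 2 4) (Eg 2 3 + Eg 1 4) 1 1 0"
  "pairrel (Eg 1 5 + Eg 2 6) (Eg 2 5 - Eg 1 6) 1 0 (-1)"
  "pairrel (Eg 1 5 - Eg 2 6) (Eg 2 5 + Eg 1 6) 1 0 1"
  "pairrel (Eg 3 5 + Eg 4 6) (Eg 4 5 - Eg 3 6) 0 1 (-1)"
  "pairrel (Eg 3 5 - Eg 4 6) (Eg 4 5 + Eg 3 6) 0 1 1"
  "pairrel (Eg 1 7) (Eg 2 7) 1 0 0"
  "pairrel (Eg 3 7) (Eg 4 7) 0 1 0"
  "pairrel (Eg 5 7) (Eg 6 7) 0 0 1"
  unfolding pairrel_def cE_simps linear_scale[OF linear_brk_left] linear_add[OF linear_brk] linear_diff[OF linear_brk] brk_Eg_Eg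
  by (simp_all add: Eg_spinalg subspace_add[OF subspace_spinalg] subspace_diff[OF subspace_spinalg] Eg_same)
    (simp_all add: algebra_simps)?

lemma sq_swap: "sq j i v = sq i j v"
  unfolding sq_def Eg_swap[of j i] op_lin op_vec by simp

lemma sq_same: "sq i i v = 0" by (simp add: sq_def Eg_same op_lin)

lemma sum_sq: "(\<Sum>i\<in>UNIV. \<Sum>j\<in>UNIV. sq i j v) = 2 *s (sq 1 2 v + sq 3 4 v + sq 5 6 v
   + (sq 1 3 v + sq 1 4 v + sq 2 3 v + sq 2 4 v) + (sq 1 5 v + sq 1 6 v + sq 2 5 v + sq 2 6 v)
   + (sq 3 5 v + sq 3 6 v + sq 4 5 v + sq 4 6 v) + (sq 1 7 v + sq 2 7 v) + (sq 3 7 v + sq 4 7 v) + (sq 5 7 v + sq 6 7 v))"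
  by (simp only: sum_7 sq_same sq_swap[of 2 1] sq_swap[of 3 1] sq_swap[of 3 2] sq_swap[of 4 1] sq_swap[of 4 2] 
    sq_swap[of 4 3] sq_swap[of 5 1] sq_swap[of 5 2] sq_swap[of 5 3] sq_swap[of 5 4] 
    sq_swap[of 6 1] sq_swap[of 6 2] sq_swap[of 6 3] sq_swap[of 6 4] sq_swap[of 6 5] 
    sq_swap[of 7 1] sq_swap[of 7 2] sq_swap[of 7 3] sq_swap[of 7 4] sq_swap[of 7 5] 
    sq_swap[of 7 6]) (simp add: vec_eq_iff)

lemma diff_repC_op:
  assumes "of_mat (Re_mat Z) \<in> spinalg" "of_mat (Im_mat Z) \<in> spinalg"
  shows "diff_repC \<rho> Z *v v = opC (of_mat (Re_mat Z)) (of_mat (Im_mat Z)) v"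
proof -
  have "mscale c A *v v = c *s (A *v v)" for c and A :: "complex^'n^'n"
    by (simp add: vec_eq_iff mscale_def matrix_vector_mult_def sum_distrib_left mult.assoc)
  then show ?thesis
    by (simp add: diff_repC_def opC_def op_def drho_ext_eq assms drho_def matrix_vector_mult_add_rdistrib)
qed

lemma cartan_parts:
  assumes "k \<in> {1,2,3}"
  shows "Re_mat (cartan k) = 0" "Im_mat (cartan k) = to_mat (cE k)"
proof -
  show "Re_mat (cartan k) = 0"
    by (simp add: vec_eq_iff Re_mat_def cartan_def mscale_def complex_mat_def)
  have "to_mat (cE k) = (1/2) *\<^sub>R (gam (axis (of_nat (2 * k - 1)) 1) ** gam (axis (of_nat (2 * k)) 1))"
    using assms by (auto simp: cE_def Eg_def scaleR_sqmat.rep_eq times_sqmat.rep_eq to_mat_cliff)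
  then show "Im_mat (cartan k) = to_mat (cE k)"
    by (simp add: vec_eq_iff Im_mat_def cartan_def mscale_def complex_mat_def)
qed

lemma root_space_pairrel:
  assumes "Z \<in> root_space (a1, a2, a3)"
  shows "pairrel (of_mat (Re_mat Z)) (of_mat (Im_mat Z)) a1 a2 a3"
proof -
  have Zs: "of_mat (Re_mat Z) \<in> spinalg" "of_mat (Im_mat Z) \<in> spinalg"
    using assms by (auto simp: root_space_def spin7C_def Re_Im_mat_simps spin7_eq)
  have r: "brk (cE k) (of_mat (Re_mat Z)) = real_of_int a *\<^sub>R of_mat (Im_mat Z)"
       "brk (cE k) (of_mat (Im_mat Z)) = - (real_of_int a *\<^sub>R of_mat (Re_mat Z))"
    if k: "k \<in> {1,2,3}" and b: "bracket (cartan k) Z = mscale (of_int a) Z" for k a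
  proof -
    have m: "Re_mat (mscale (of_int a) Z) = real_of_int a *\<^sub>R Re_mat Z" "Im_mat (mscale (of_int a) Z) = real_of_int a *\<^sub>R Im_mat Z"
      using Re_Im_mat_simps(3,4)[of "real_of_int a" Z] by simp_all
    have "bracket (to_mat (cE k)) (Re_mat Z) = real_of_int a *\<^sub>R Im_mat Z"
      using arg_cong[OF b, of Im_mat] by (simp add: m bracket_def Re_Im_mat_simps Re_Im_mat_mult cartan_parts[OF k])
    from arg_cong[OF this, of of_mat] show "brk (cE k) (of_mat (Re_mat Z)) = real_of_int a *\<^sub>R of_mat (Im_mat Z)"
      by (simp add: of_mat_bracket linear_scale[OF bounded_linear.linear[OF bounded_linear_of_mat]])
    have "Im_mat Z ** to_mat (cE k) - to_mat (cE k) ** Im_mat Z = real_of_int a *\<^sub>R Re_mat Z"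
      using arg_cong[OF b, of Re_mat] by (simp add: m bracket_def Re_Im_mat_simps Re_Im_mat_mult cartan_parts[OF k])
    then have "bracket (to_mat (cE k)) (Im_mat Z) = - (real_of_int a *\<^sub>R Re_mat Z)"
      by (simp add: bracket_def algebra_simps)
    from arg_cong[OF this, of of_mat] show "brk (cE k) (of_mat (Im_mat Z)) = - (real_of_int a *\<^sub>R of_mat (Re_mat Z))"
      by (simp add: of_mat_bracket linear_neg[OF bounded_linear.linear[OF bounded_linear_of_mat]]
         linear_scale[OF bounded_linear.linear[OF bounded_linear_of_mat]])
  qed
  show ?thesis using assms Zs r by (auto simp: pairrel_def root_space_def)
qed

text \<open>With \<open>\<lambda>\<close> the weight in the coordinates \<open>\<epsilon>\<^sub>1, \<epsilon>\<^sub>2, \<epsilon>\<^sub>3\<close>, namely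
  \<open>(a + b + c/2, b + c/2, c/2)\<close>, the scalar is \<open>- 8 \<langle>\<lambda>, \<lambda> + 2 \<delta>\<rangle>\<close>. The Cartan elements contribute the
  squares, and each positive root one term of \<open>2 \<delta> = (5, 3, 1)\<close>.\<close>
lemma highest_weight_casimir:
  obtains v a b c where "v \<noteq> 0" "has_highest_weight \<rho> (a, b, c)"
    "(\<Sum>i\<in>UNIV. \<Sum>j\<in>UNIV. sq i j v) = of_real (- 8 * ((real a + b + c / 2)\<^sup>2 + (real b + c / 2)\<^sup>2 + (c / 2)\<^sup>2
        + 5 * (real a + b + c / 2) + 3 * (real b + c / 2) + c / 2)) *s v"
proof -
  obtain v l1 l2 l3 where v: "v \<noteq> 0" and h: "hk 1 v = l1 *s v" "hk 2 v = l2 *s v" "hk 3 v = l3 *s v"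
    and kill: "\<And>X Y a1 a2 a3. pairrel X Y a1 a2 a3 \<Longrightarrow> 3 * a1 + 2 * a2 + a3 \<ge> 1 \<Longrightarrow> opC X Y v = 0"
    by (rule highest_weight_vector) blast
  have E: "op (Eg 1 2) v = (- 2 * \<i> * l1) *s v" "op (Eg 3 4) v = (- 2 * \<i> * l2) *s v" "op (Eg 5 6) v = (- 2 * \<i> * l3) *s v"
  proof -
    have *: "op X v = (- 2 * \<i> * l) *s v" if "\<i> *s op ((1/2) *\<^sub>R X) v = l *s v" for X l
    proof -
      have "op X v = (- 2 * \<i>) *s (\<i> *s op ((1/2) *\<^sub>R X) v)"
        by (simp add: op_lin scaleR_vscale vec_eq_iff)
      then show ?thesis unfolding that by (simp add: vec_eq_iff)
    qed
    show "op (Eg 1 2) v = (- 2 * \<i> * l1) *s v" "op (Eg 3 4) v = (- 2 * \<i> * l2) *s v" "op (Eg 5 6) v = (- 2 * \<i> * l3) *s v"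
      using *[of "Eg 1 2" l1] *[of "Eg 3 4" l2] *[of "Eg 5 6" l3] h unfolding hk_def cE_simps by blast+
  qed
  note K = kill[OF pairrel_roots(1)] kill[OF pairrel_roots(2)] kill[OF pairrel_roots(3)] kill[OF pairrel_roots(4)]
    kill[OF pairrel_roots(5)] kill[OF pairrel_roots(6)] kill[OF pairrel_roots(7)] kill[OF pairrel_roots(8)] kill[OF pairrel_roots(9)]
  have cart: "sq 1 2 v = (- 4 * l1\<^sup>2) *s v" "sq 3 4 v = (- 4 * l2\<^sup>2) *s v" "sq 5 6 v = (- 4 * l3\<^sup>2) *s v"
    by (simp_all add: sq_def E op_vec vec_eq_iff power2_eq_square)
  have "(\<Sum>i\<in>UNIV. \<Sum>j\<in>UNIV. sq i j v) = (- 8 * (l1\<^sup>2 + l2\<^sup>2 + l3\<^sup>2 + 5 * l1 + 3 * l2 + l3)) *s v"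
    unfolding sum_sq cart
      casimir_long_roots[of 1 2 3 4 v l1, simplified, OF K(1)[simplified] K(2)[simplified] E(1)[simplified]]
      casimir_long_roots[of 1 2 5 6 v l1, simplified, OF K(3)[simplified] K(4)[simplified] E(1)[simplified]]
      casimir_long_roots[of 3 4 5 6 v l2, simplified, OF K(5)[simplified] K(6)[simplified] E(2)[simplified]]
      casimir_short_root[of 1 2 7 v l1, simplified, OF K(7)[simplified] E(1)[simplified]]
      casimir_short_root[of 3 4 7 v l2, simplified, OF K(8)[simplified] E(2)[simplified]]
      casimir_short_root[of 5 6 7 v l3, simplified, OF K(9)[simplified] E(3)[simplified]]
    by (simp add: vec_eq_iff algebra_simps)
  note cas = this
  have lab: "\<exists>n. l1 - l2 = of_nat n" "\<exists>n. l2 - l3 = of_nat n" "\<exists>n. 2 * l3 = of_nat n"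
  proof -
    have b: "brk (Eg 1 3 + Eg 2 4) (Eg 2 3 - Eg 1 4) = 4 *\<^sub>R (Eg 1 2 - Eg 3 4)"
      "brk (Eg 3 5 + Eg 4 6) (Eg 4 5 - Eg 3 6) = 4 *\<^sub>R (Eg 3 4 - Eg 5 6)"
      "brk (Eg 5 7) (Eg 6 7) = 2 *\<^sub>R Eg 5 6"
      unfolding linear_add[OF linear_brk_left] linear_diff[OF linear_brk] brk_Eg_Eg
      by (rule sqmat_eqI, simp add: entries Eg_swap[of 2 1] Eg_swap[of 4 3] Eg_swap[of 6 5])+
    note S = Eg_spinalg subspace_add[OF subspace_spinalg] subspace_diff[OF subspace_spinalg] cE_spinalg subspace_scale[OF subspace_spinalg]
    show "\<exists>n. l1 - l2 = of_nat n"
    proof (rule simple_coroot_eigenvalue_nat[of "Eg 1 3 + Eg 2 4" "Eg 2 3 - Eg 1 4" "cE 1 - cE 2" 8 v])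
      show "brk (cE 1 - cE 2) (Eg 1 3 + Eg 2 4) = 2 *\<^sub>R (Eg 2 3 - Eg 1 4)" "brk (cE 1 - cE 2) (Eg 2 3 - Eg 1 4) = - (2 *\<^sub>R (Eg 1 3 + Eg 2 4))"
        using pairrel_roots(1) unfolding pairrel_def linear_diff[OF linear_brk_left] by (simp_all add: scaleR_2)
      show "\<i> *s op (cE 1 - cE 2) v = (l1 - l2) *s v"
        using h by (simp add: hk_def op_lin vec.scale_right_diff_distrib vec.scale_left_diff_distrib)
    qed (use K v in \<open>simp_all add: S b cE_simps scaleR_right_diff_distrib\<close>)
    show "\<exists>n. l2 - l3 = of_nat n"
    proof (rule simple_coroot_eigenvalue_nat[of "Eg 3 5 + Eg 4 6" "Eg 4 5 - Eg 3 6" "cE 2 - cE 3" 8 v])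
      show "brk (cE 2 - cE 3) (Eg 3 5 + Eg 4 6) = 2 *\<^sub>R (Eg 4 5 - Eg 3 6)" "brk (cE 2 - cE 3) (Eg 4 5 - Eg 3 6) = - (2 *\<^sub>R (Eg 3 5 + Eg 4 6))"
        using pairrel_roots(5) unfolding pairrel_def linear_diff[OF linear_brk_left] by (simp_all add: scaleR_2)
      show "\<i> *s op (cE 2 - cE 3) v = (l2 - l3) *s v"
        using h by (simp add: hk_def op_lin vec.scale_right_diff_distrib vec.scale_left_diff_distrib)
    qed (use K v in \<open>simp_all add: S b cE_simps scaleR_right_diff_distrib\<close>)
    show "\<exists>n. 2 * l3 = of_nat n"
    proof (rule simple_coroot_eigenvalue_nat[of "Eg 5 7" "Eg 6 7" "2 *\<^sub>R cE 3" 2 v])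
      show "brk (2 *\<^sub>R cE 3) (Eg 5 7) = 2 *\<^sub>R Eg 6 7" "brk (2 *\<^sub>R cE 3) (Eg 6 7) = - (2 *\<^sub>R Eg 5 7)"
        using pairrel_roots(9) unfolding pairrel_def linear_scale[OF linear_brk_left] by simp_all
      show "\<i> *s op (2 *\<^sub>R cE 3) v = (2 * l3) *s v"
        using h(3) by (simp add: hk_def op_lin scaleR_vscale vec_eq_iff)
    qed (use K v in \<open>simp_all add: S b cE_simps\<close>)
  qed
  then obtain a b c where abc: "l1 - l2 = of_nat a" "l2 - l3 = of_nat b" "2 * l3 = of_nat c" by blast
  have l3: "l3 = of_real (c / 2)" using abc(3) by (simp add: field_simps)
  have l2: "l2 = of_real (real b + c / 2)" using abc(2) l3 by (simp add: algebra_simps)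
  have l1: "l1 = of_real (real a + b + c / 2)" using abc(1) l2 by (simp add: algebra_simps)
  have "has_highest_weight \<rho> (a, b, c)"
    unfolding has_highest_weight_def split
  proof (rule exI[of _ v], intro conjI ballI)
    fix \<alpha> Z assume \<alpha>: "\<alpha> \<in> positive_roots" and Z: "Z \<in> root_space \<alpha>"
    obtain a1 a2 a3 where a: "\<alpha> = (a1, a2, a3)" by (cases \<alpha>)
    have p: "pairrel (of_mat (Re_mat Z)) (of_mat (Im_mat Z)) a1 a2 a3" using root_space_pairrel Z a by blast
    have "3 * a1 + 2 * a2 + a3 \<ge> 1" using \<alpha> a by (auto simp: positive_roots_def)
    then have "3 * real_of_int a1 + 2 * real_of_int a2 + real_of_int a3 \<ge> 1" by linarith
    from kill[OF p this] show "diff_repC \<rho> Z *v v = 0"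
      using p by (subst diff_repC_op) (auto simp: pairrel_def)
  next
    have o: "diff_repC \<rho> Z *v v = \<i> *s op X v" if "Re_mat Z = 0" "Im_mat Z = to_mat X" "X \<in> spinalg" for Z X
      using that subspace_0[OF subspace_spinalg]
      by (subst diff_repC_op) (simp_all add: opC_def op_lin linear_0[OF bounded_linear.linear[OF bounded_linear_of_mat]])
    show "diff_repC \<rho> (cartan 1 - cartan 2) *v v = of_nat a *s v"
      unfolding abc(1)[symmetric] using h
      by (subst o[of _ "cE 1 - cE 2"]) (simp_all add: Re_Im_mat_simps cartan_parts minus_sqmat.rep_eq subspace_diff[OF subspace_spinalg] cE_spinalg
        hk_def op_lin vec.scale_right_diff_distrib vec.scale_left_diff_distrib)
    show "diff_repC \<rho> (cartan 2 - cartan 3) *v v = of_nat b *s v"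
      unfolding abc(2)[symmetric] using h
      by (subst o[of _ "cE 2 - cE 3"]) (simp_all add: Re_Im_mat_simps cartan_parts minus_sqmat.rep_eq subspace_diff[OF subspace_spinalg] cE_spinalg
        hk_def op_lin vec.scale_right_diff_distrib vec.scale_left_diff_distrib)
    show "diff_repC \<rho> (mscale 2 (cartan 3)) *v v = of_nat c *s v"
      unfolding abc(3)[symmetric] using h(3) Re_Im_mat_simps(3,4)[of 2 "cartan 3"]
      by (subst o[of _ "2 *\<^sub>R cE 3"]) (simp_all add: cartan_parts scaleR_sqmat.rep_eq subspace_scale[OF subspace_spinalg] cE_spinalg
        hk_def op_lin scaleR_vscale vec_eq_iff)
  qed (rule v)
  then show thesis by (rule that[OF v]) (use cas in \<open>simp add: l1 l2 l3\<close>)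
qed

text \<open>Schur's lemma: the eigenspaces of the Casimir operator are invariant under the group, because
  conjugation by an element of Spin(7) rotates the orthonormal basis \<open>e\<^sub>i\<close> of \<open>\<real>\<^sup>7\<close> in each of the two
  factors of \<open>e\<^sub>i \<and> e\<^sub>j\<close>.\<close>
lemma casimir_scalar:
  assumes irr: "irreducible_spin7_rep \<rho>" and v: "v \<noteq> 0" "(\<Sum>i\<in>UNIV. \<Sum>j\<in>UNIV. sq i j v) = \<kappa> *s v"
  shows "(\<Sum>i\<in>UNIV. \<Sum>j\<in>UNIV. sq i j w) = \<kappa> *s w"
proof -
  define Cas where "Cas w = (\<Sum>i\<in>UNIV. \<Sum>j\<in>UNIV. sq i j w)" for w
  define W where "W = {w. Cas w = \<kappa> *s w}"
  have W: "vec.subspace W"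
    unfolding W_def Cas_def
    by (rule vec.subspaceI) (simp_all add: sq_def op_vec sum.distrib vec.scale_right_distrib vec.scale_sum_right[symmetric] vec.scale_left_commute)
  have inv: "\<rho> g *v w \<in> W" if g: "g \<in> Spin7" and w: "w \<in> W" for g w
  proof -
    define G where "G = (of_mat g :: spinmat)"
    have G: "G \<in> spingrp" using g by (simp add: G_def spingrp_def)
    have tG: "tp G \<in> spingrp" by (rule spingrp_tp[OF G])
    have gi: "tp G * G = 1" "G * tp G = 1" using spingrp_inverse[OF G] by auto
    have RG: "to_mat (rho G) = \<rho> g" by (simp add: rho_def G_def)
    have "\<forall>i. \<exists>u. tp G * gm i * G = cliff u"
      using spingrp_normaliser[OF tG] by (auto simp: normaliser_def tp_tp)
    then obtain U where U: "\<And>i. tp G * gm i * G = cliff (U i)" by metis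
    have UU: "cliff (U i) * cliff (U j) = tp G * (gm i * gm j) * G" for i j
    proof -
      have "cliff (U i) * cliff (U j) = tp G * gm i * (G * tp G) * gm j * G" by (simp only: U[symmetric] mult.assoc)
      then show ?thesis by (simp add: gi mult.assoc)
    qed
    have Uo: "U i \<bullet> U j = (if i = j then 1 else 0)" for i j
    proof -
      have "cliff (U i) * cliff (U j) + cliff (U j) * cliff (U i) = tp G * (gm i * gm j + gm j * gm i) * G"
        by (simp add: UU distrib_left distrib_right)
      then have "- (2 * (U i \<bullet> U j)) *\<^sub>R (1::spinmat) = (- (if i = j then 2 else 0)) *\<^sub>R 1"
        unfolding cliff_anticomm[of "U i" "U j"] gm_anticomm by (simp add: gi)
      from arg_cong[OF this, of "\<lambda>M. to_mat M $ None $ None"] show ?thesis by (simp add: entries e7_inner split: if_splits)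
    qed
    \<comment> \<open>The bilinear extension of \<open>Eg\<close>.\<close>
    define F where "F u v = cliff u * cliff v + (u \<bullet> v) *\<^sub>R 1" for u v
    have F: "bilinear F" unfolding bilinear_def F_def
      by (auto intro!: linearI simp: cliff_simps algebra_simps inner_add_left inner_add_right)
    have FE: "F (e7 i) (e7 j) = Eg i j" for i j by (simp add: F_def Eg_def e7_inner)
    have FU: "tp G * Eg i j * G = F (U i) (U j)" for i j
      by (simp add: F_def UU Uo Eg_def distrib_left distrib_right gi)
    have lF: "linear (F x)" "linear (\<lambda>x. F x y)" for x y using F by (auto simp: bilinear_def)
    define B where "B X Y = op X (op Y w)" for X Y
    have B: "bilinear B" unfolding bilinear_def B_def by (auto intro!: linearI simp: op_lin op_vec scaleR_vscale)
    have lB: "linear (B x)" "linear (\<lambda>x. B x y)" for x y using B by (auto simp: bilinear_def)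
    have bil: "bilinear (\<lambda>u v. B (L u) (L v))" if "linear L" for L :: "real^7 \<Rightarrow> spinmat"
      unfolding bilinear_def using lB that
      by (auto intro!: linearI simp: linear_add[OF that] linear_scale[OF that] linear_add[OF lB(1)] linear_add[OF lB(2)] linear_scale[OF lB(1)] linear_scale[OF lB(2)])
    have mv: "op X (\<rho> g *v x) = \<rho> g *v op (tp G * X * G) x" if X: "X \<in> spinalg" for X x
    proof -
      have c: "tp G * X * G \<in> spinalg" "rho (tp G) * drho X * rho G = drho (tp G * X * G)"
        using conj_spinalg[OF tG X] by (simp_all add: tp_tp)
      have "rho G * rho (tp G) = 1" using rho_mult[OF G tG] gi rho_one by simp
      then have "drho X * rho G = rho G * drho (tp G * X * G)" using c(2) by (metis mult.assoc mult_1_left)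
      from arg_cong[OF this, of to_mat] have "to_mat (drho X) ** \<rho> g = \<rho> g ** to_mat (drho (tp G * X * G))"
        by (simp add: times_sqmat.rep_eq RG)
      then show ?thesis by (simp add: op_def drho_ext_eq X c(1) matrix_vector_mul_assoc)
    qed
    have "Cas (\<rho> g *v w) = \<rho> g *v (\<Sum>i\<in>UNIV. \<Sum>j\<in>UNIV. B (F (U i) (U j)) (F (U i) (U j)))"
    proof -
      have "sq i j (\<rho> g *v w) = \<rho> g *v B (F (U i) (U j)) (F (U i) (U j))" for i j
        by (simp add: sq_def mv Eg_spinalg FU B_def)
      then show ?thesis by (simp add: Cas_def vec.linear_sum[OF matrix_vector_mul_linear_gen])
    qed
    also have "(\<Sum>i\<in>UNIV. \<Sum>j\<in>UNIV. B (F (U i) (U j)) (F (U i) (U j))) = (\<Sum>i\<in>UNIV. \<Sum>j\<in>UNIV. B (F (U i) (e7 j)) (F (U i) (e7 j)))"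
      by (intro sum.cong refl orthonormal_basis_trace[OF bil[OF lF(1)] Uo])
    also have "\<dots> = (\<Sum>j\<in>UNIV. \<Sum>i\<in>UNIV. B (F (U i) (e7 j)) (F (U i) (e7 j)))" by (rule sum.swap)
    also have "\<dots> = (\<Sum>j\<in>UNIV. \<Sum>i\<in>UNIV. B (F (e7 i) (e7 j)) (F (e7 i) (e7 j)))"
      by (intro sum.cong refl orthonormal_basis_trace[OF bil[OF lF(2)] Uo])
    also have "\<dots> = Cas w" unfolding FE Cas_def sq_def B_def by (rule sum.swap)
    finally have "Cas (\<rho> g *v w) = \<rho> g *v (\<kappa> *s w)" using w by (simp add: W_def)
    then show ?thesis by (simp add: W_def vec.linear_scale[OF matrix_vector_mul_linear_gen])
  qed
  have "W = {0} \<or> W = UNIV" using irr W inv unfolding irreducible_spin7_rep_def by blast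
  moreover have "v \<in> W" using v by (simp add: W_def Cas_def)
  ultimately have "W = UNIV" using v by auto
  then show ?thesis by (auto simp: W_def Cas_def)
qed

end

text \<open>\<open>\<langle>\<lambda>, \<lambda> + 2 \<delta>\<rangle>\<close> increases with each Dynkin label, so it suffices to look at the minimal
  labels \<open>(0, 1, 0)\<close>, \<open>(2, 0, 0)\<close>, \<open>(0, 0, 2)\<close> and \<open>(1, 0, 1)\<close>.\<close>
lemma weight_bound:
  fixes a b c :: nat
  assumes "(a, b, c) \<notin> {(0,0,0), (1,0,0), (0,0,1)}"
  shows "(real a + b + c / 2)\<^sup>2 + (real b + c / 2)\<^sup>2 + (c / 2)\<^sup>2
        + 5 * (real a + b + c / 2) + 3 * (real b + c / 2) + c / 2 \<ge> 37/4"
proof -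
  define q where "q a b c = (a + b + c / 2)\<^sup>2 + (b + c / 2)\<^sup>2 + (c / 2)\<^sup>2
        + 5 * (a + b + c / 2) + 3 * (b + c / 2) + c / 2" for a b c :: real
  have mono: "q x y z \<le> q x' y' z'" if "0 \<le> x" "0 \<le> y" "0 \<le> z" "x \<le> x'" "y \<le> y'" "z \<le> z'" for x y z x' y' z'
    unfolding q_def using that by (intro add_mono power_mono mult_left_mono divide_right_mono) auto
  consider "b \<ge> 1" | "a \<ge> 2" | "c \<ge> 2" | "a \<ge> 1" "c \<ge> 1" using assms by force
  then have "q a b c \<ge> 37/4"
  proof cases
    case 1
    then have "q 0 1 0 \<le> q a b c" by (intro mono) auto
    then show ?thesis by (simp add: q_def)
  next
    case 2
    then have "q 2 0 0 \<le> q a b c" by (intro mono) auto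
    then show ?thesis by (simp add: q_def)
  next
    case 3
    then have "q 0 0 2 \<le> q a b c" by (intro mono) auto
    then show ?thesis by (simp add: q_def)
  next
    case 4
    then have "q 1 0 1 \<le> q a b c" by (intro mono) auto
    then show ?thesis by (simp add: q_def power2_eq_square)
  qed
  then show ?thesis by (simp add: q_def)
qed

section \<open>The square of the cubic Dirac operator\<close>

text \<open>An element of the tensor product of the real spin space with the real Lie algebra, as a tuple of
  matrices indexed by the coordinates of the spin space. \<open>sact\<close> acts on the first and \<open>eact\<close> on the
  second factor.\<close>
type_synonym spinor = "spinmat^ix"

definition sact :: "spinmat \<Rightarrow> spinor \<Rightarrow> spinor" where
  "sact M \<Psi> = (\<chi> s. \<Sum>t\<in>UNIV. to_mat M $ s $ t *\<^sub>R \<Psi> $ t)"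

definition eact :: "spinmat \<Rightarrow> spinor \<Rightarrow> spinor" where
  "eact X \<Psi> = (\<chi> s. brk X (\<Psi> $ s))"

lemma bilinear_sact: "bilinear sact"
  unfolding bilinear_def
  by (auto intro!: linearI simp: sact_def vec_eq_iff entries algebra_simps sum.distrib scaleR_sum_right)

lemma bilinear_eact: "bilinear eact"
  unfolding bilinear_def
  by (auto intro!: linearI simp: eact_def vec_eq_iff brk_def algebra_simps)

lemma sact_linear: "linear (sact M)" "linear (\<lambda>M. sact M \<Psi>)"
  using bilinear_sact by (auto simp: bilinear_def)

lemma eact_linear: "linear (eact M)" "linear (\<lambda>M. eact M \<Psi>)"
  using bilinear_eact by (auto simp: bilinear_def)

lemmas sact_simps = linear_add[OF sact_linear(1)] linear_diff[OF sact_linear(1)] linear_neg[OF sact_linear(1)]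
  linear_0[OF sact_linear(1)] linear_scale[OF sact_linear(1)] linear_sum[OF sact_linear(1)]

lemmas sact_simps_left = linear_add[OF sact_linear(2)] linear_diff[OF sact_linear(2)] linear_neg[OF sact_linear(2)]
  linear_0[OF sact_linear(2)] linear_scale[OF sact_linear(2)] linear_sum[OF sact_linear(2)]

lemmas eact_simps = linear_add[OF eact_linear(1)] linear_diff[OF eact_linear(1)] linear_neg[OF eact_linear(1)]
  linear_0[OF eact_linear(1)] linear_scale[OF eact_linear(1)] linear_sum[OF eact_linear(1)]

lemma sact_mult: "sact (A * B) \<Psi> = sact A (sact B \<Psi>)"
  unfolding sact_def vec_eq_iff
proof
  fix s
  have "(\<Sum>t\<in>UNIV. to_mat (A * B) $ s $ t *\<^sub>R \<Psi> $ t) = (\<Sum>t\<in>UNIV. \<Sum>k\<in>UNIV. (to_mat A $ s $ k * to_mat B $ k $ t) *\<^sub>R \<Psi> $ t)"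
    by (simp add: times_entries scaleR_sum_left)
  also have "\<dots> = (\<Sum>k\<in>UNIV. \<Sum>t\<in>UNIV. (to_mat A $ s $ k * to_mat B $ k $ t) *\<^sub>R \<Psi> $ t)" by (rule sum.swap)
  finally show "(\<chi> s. \<Sum>t\<in>UNIV. to_mat (A * B) $ s $ t *\<^sub>R \<Psi> $ t) $ s
    = (\<chi> s. \<Sum>t\<in>UNIV. to_mat A $ s $ t *\<^sub>R (\<chi> s. \<Sum>t\<in>UNIV. to_mat B $ s $ t *\<^sub>R \<Psi> $ t) $ t) $ s"
    by (simp add: scaleR_sum_right)
qed

lemma sact_one: "sact 1 \<Psi> = \<Psi>"
  by (simp add: sact_def vec_eq_iff entries if_distrib[of "\<lambda>x. x *\<^sub>R _"] cong: if_cong)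

lemma eact_sact: "eact X (sact M \<Psi>) = sact M (eact X \<Psi>)"
  by (simp add: eact_def sact_def vec_eq_iff linear_sum[OF linear_brk] linear_scale[OF linear_brk])

definition cubicD :: "(spinmat \<Rightarrow> 'v \<Rightarrow> 'v) \<Rightarrow> ('v \<Rightarrow> spinor) \<Rightarrow> 'v \<Rightarrow> spinor" where
  "cubicD act F v = - (\<Sum>k\<in>UNIV. sact (gm k) (F (act (msp (e7 k)) v))) - (1/3) *\<^sub>R sact phimat (F v)"

lemma cubicD_combination:
  "cubicD act (\<lambda>v. a *\<^sub>R F v + b *\<^sub>R G v) v = a *\<^sub>R cubicD act F v + b *\<^sub>R cubicD act G v"
  by (simp add: cubicD_def sact_simps sum.distrib scaleR_sum_right algebra_simps)

lemma phimat_square: "phimat * phimat = 48 *\<^sub>R vac + 1"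
proof -
  have "phimat * phimat = 64 *\<^sub>R (vac * vac) - 16 *\<^sub>R vac + 1"
    unfolding phimat_def by (rule sqmat_eqI, simp only: expand_mult entries, simp)
  then show ?thesis unfolding vac_vac by (rule trans) (rule sqmat_eqI, simp only: entries, simp)
qed

text \<open>Squaring produces the terms \<open>\<gamma>\<^sub>k \<gamma>\<^sub>j F \<circ> N\<^sub>j N\<^sub>k\<close> with \<open>N\<^sub>k = msp e\<^sub>k\<close>. The Clifford relation splits
  them into \<open>- \<Sum>\<^sub>k F \<circ> N\<^sub>k\<^sup>2\<close> and half the sum of the \<open>\<gamma>\<^sub>k \<gamma>\<^sub>j F \<circ> [N\<^sub>j, N\<^sub>k]\<close>. The \<open>m\<close>-component of the bracket
  cancels the first order terms coming from \<open>\<phi>\<close>; here the coefficient \<open>1/3\<close> is used. For the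
  \<open>g\<^sub>2\<close>-component and for \<open>- \<Sum>\<^sub>k F \<circ> N\<^sub>k\<^sup>2\<close>, which is \<open>C F\<close> corrected by the Casimir operator of \<open>g\<^sub>2\<close>,
  equivariance replaces the action on the representation by the action \<open>x + y\<close> on the tensor
  product, \<open>x\<close> on spinors and \<open>y\<close> on the Lie algebra. As \<open>(x + y)\<^sup>2 - 2 x (x + y) = y\<^sup>2 - x\<^sup>2\<close>, the mixed
  terms disappear. Finally \<open>- x\<^sup>2\<close> is the Casimir operator of \<open>g\<^sub>2\<close> on spinors, which together with
  \<open>\<phi>\<^sup>2/9\<close> makes the scalar \<open>49/9\<close>.\<close>
lemma kostant_square:
  fixes act :: "spinmat \<Rightarrow> 'v::real_vector \<Rightarrow> 'v"
  assumes F: "linear F" and act: "\<And>v. linear (\<lambda>X. act X v)" "\<And>X. linear (act X)"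
    and rep: "\<And>X Y v. X \<in> spinalg \<Longrightarrow> Y \<in> spinalg \<Longrightarrow> act (brk X Y) v = act X (act Y v) - act Y (act X v)"
    and equiv: "\<And>X v. X \<in> g2alg \<Longrightarrow> F (act X v) = sact X (F v) + eact X (F v)"
    and cas: "\<And>v. (\<Sum>i\<in>UNIV. \<Sum>j\<in>UNIV. act (Eg i j) (act (Eg i j) v)) = (- 6 * C) *\<^sub>R v"
    and ecas: "\<And>v. (\<Sum>i\<in>UNIV. \<Sum>j\<in>UNIV. eact (Gg i j) (eact (Gg i j) (F v))) = (- (8/3) * c) *\<^sub>R F v"
  shows "cubicD act (cubicD act F) v = (C + 49/9 - c) *\<^sub>R F v"
proof -
  define n where "n k v = act (msp (e7 k)) v" for k v
  have lFa: "linear (\<lambda>X. F (act X v))" for v using linear_compose[OF act(1) F] by (simp add: o_def)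
  note Fs = linear_add[OF F] linear_diff[OF F] linear_neg[OF F] linear_scale[OF F] linear_sum[OF F]
  \<comment> \<open>\<open>P\<close> and \<open>Q\<close> are the terms \<open>x\<^sup>2\<close> and \<open>x y\<close>, \<open>R\<close> the first order terms and \<open>S\<close> the second order terms.\<close>
  define P Q R S where "P = (\<Sum>i\<in>UNIV. \<Sum>j\<in>UNIV. sact (Gg i j) (sact (Gg i j) (F v)))"
    and "Q = (\<Sum>i\<in>UNIV. \<Sum>j\<in>UNIV. sact (Gg i j) (eact (Gg i j) (F v)))"
    and "R = (\<Sum>k\<in>UNIV. sact (msp (e7 k)) (F (n k v)))"
    and "S = (\<Sum>k\<in>UNIV. \<Sum>j\<in>UNIV. sact (gm k * gm j) (F (n j (n k v))))"
  have expand: "cubicD act (cubicD act F) v = S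
     + (1/3) *\<^sub>R (\<Sum>k\<in>UNIV. sact (gm k * phimat + phimat * gm k) (F (n k v)))
     + (1/9) *\<^sub>R sact (phimat * phimat) (F v)"
    unfolding cubicD_def S_def n_def
    by (simp add: sact_simps sact_simps_left sact_mult sum_subtractf sum_negf sum.distrib scaleR_sum_right algebra_simps)
  have "(\<Sum>k\<in>UNIV. sact (gm k * phimat + phimat * gm k) (F (n k v))) = - 6 *\<^sub>R R"
    unfolding R_def phimat_anticomm by (simp add: sact_simps_left scaleR_sum_right)
  note mid = this
  have B1: "bilinear (\<lambda>X Y. sact X (F (act Y v)))"
    unfolding bilinear_def using sact_linear(2) linear_compose[OF lFa sact_linear(1)] by (simp add: o_def)
  have B2: "bilinear (\<lambda>X Y. F (act X (act Y v)))"
    unfolding bilinear_def using lFa linear_compose[OF linear_compose[OF act(1) act(2)] F] by (simp add: o_def)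
  have brkN: "brk (msp (e7 j)) (msp (e7 k)) = Gg j k - (2/3) *\<^sub>R msp (cross (e7 j) (e7 k))" for j k
  proof -
    have "brk (msp (e7 j)) (msp (e7 k)) = (2/3) *\<^sub>R Eg j k - (4/3) *\<^sub>R msp (cross (e7 j) (e7 k))"
      unfolding brk_def msp_commutator by (simp add: Eg_def e7_inner)
    then show ?thesis unfolding Eg_decomp
      by (rule trans) (rule sqmat_eqI, simp only: entries, simp add: field_simps)
  qed
  have S2: "2 *\<^sub>R S = (\<Sum>j\<in>UNIV. \<Sum>k\<in>UNIV. sact (gm k * gm j) (F (act (brk (msp (e7 j)) (msp (e7 k))) v))) - 2 *\<^sub>R (\<Sum>k\<in>UNIV. F (n k (n k v)))"
  proof -
    have sw: "S = (\<Sum>j\<in>UNIV. \<Sum>k\<in>UNIV. sact (gm k * gm j) (F (n j (n k v))))"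
      unfolding S_def by (rule sum.swap)
    have "2 *\<^sub>R S = (\<Sum>j\<in>UNIV. \<Sum>k\<in>UNIV. sact (gm k * gm j) (F (n j (n k v))) + sact (gm j * gm k) (F (n k (n j v))))"
      by (simp add: scaleR_2 sum.distrib) (simp only: S_def[symmetric] sw[symmetric])
    also have "\<dots> = (\<Sum>j\<in>UNIV. \<Sum>k\<in>UNIV. sact (gm k * gm j) (F (act (brk (msp (e7 j)) (msp (e7 k))) v)) - (if k = j then 2 *\<^sub>R F (n k (n k v)) else 0))"
    proof (intro sum.cong refl)
      fix j k
      have "sact (gm j * gm k) (F (n k (n j v))) = - sact (gm k * gm j) (F (n k (n j v))) - (if k = j then 2 *\<^sub>R F (n k (n k v)) else 0)"
        by (subst gm_swap_delta) (simp add: sact_simps_left sact_one)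
      then show "sact (gm k * gm j) (F (n j (n k v))) + sact (gm j * gm k) (F (n k (n j v)))
        = sact (gm k * gm j) (F (act (brk (msp (e7 j)) (msp (e7 k))) v)) - (if k = j then 2 *\<^sub>R F (n k (n k v)) else 0)"
        by (simp add: rep msp_spinalg Fs sact_simps n_def)
    qed
    finally show ?thesis by (simp add: sum_subtractf scaleR_sum_right)
  qed
  have "(\<Sum>j\<in>UNIV. \<Sum>k\<in>UNIV. sact (gm k * gm j) (F (act (brk (msp (e7 j)) (msp (e7 k))) v)))
    = (\<Sum>j\<in>UNIV. \<Sum>k\<in>UNIV. sact (gm k * gm j) (F (act (Gg j k) v)))
     - (2/3) *\<^sub>R (\<Sum>j\<in>UNIV. \<Sum>k\<in>UNIV. sact (gm k * gm j) (F (act (msp (cross (e7 j) (e7 k))) v)))"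
    unfolding brkN linear_diff[OF lFa] linear_scale[OF lFa] sact_simps by (simp add: sum_subtractf scaleR_sum_right)
  also have "(\<Sum>j\<in>UNIV. \<Sum>k\<in>UNIV. sact (gm k * gm j) (F (act (Gg j k) v)))
      = - (3/2) *\<^sub>R (\<Sum>i\<in>UNIV. \<Sum>j\<in>UNIV. sact (Gg i j) (F (act (Gg i j) v)))"
    by (rule clifford_bivector_casimir[OF B1])
  also have "(\<Sum>i\<in>UNIV. \<Sum>j\<in>UNIV. sact (Gg i j) (F (act (Gg i j) v))) = P + Q"
    unfolding P_def Q_def by (simp add: equiv Gg_g2alg sact_simps sum.distrib)
  also have "(\<Sum>j\<in>UNIV. \<Sum>k\<in>UNIV. sact (gm k * gm j) (F (act (msp (cross (e7 j) (e7 k))) v)))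
      = (\<Sum>l\<in>UNIV. sact (\<Sum>j\<in>UNIV. \<Sum>k\<in>UNIV. eps j k l *\<^sub>R (gm k * gm j)) (F (n l v)))"
    unfolding n_def by (rule bilinear_eps_sum(2)[OF B1])
  also have "\<dots> = - 6 *\<^sub>R R"
  proof -
    have "(\<Sum>j\<in>UNIV. \<Sum>k\<in>UNIV. eps j k l *\<^sub>R (gm k * gm j)) = - 6 *\<^sub>R msp (e7 l)" for l
    proof -
      have "(\<Sum>j\<in>UNIV. \<Sum>k\<in>UNIV. eps j k l *\<^sub>R (gm k * gm j)) = (\<Sum>k\<in>UNIV. \<Sum>j\<in>UNIV. eps j k l *\<^sub>R (gm k * gm j))"
        by (rule sum.swap)
      also have "\<dots> = (\<Sum>k\<in>UNIV. \<Sum>j\<in>UNIV. - (eps k j l *\<^sub>R (gm k * gm j)))"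
      proof (intro sum.cong refl)
        fix k j show "eps j k l *\<^sub>R (gm k * gm j) = - (eps k j l *\<^sub>R (gm k * gm j))"
          using eps_swap(1)[of j k l] by simp
      qed
      also have "\<dots> = - 6 *\<^sub>R msp (e7 l)" using sum_eps_gm_gm[of l] by (simp add: sum_negf)
      finally show ?thesis .
    qed
    then show ?thesis unfolding R_def by (simp add: sact_simps_left scaleR_sum_right sum_negf)
  qed
  finally have S3: "2 *\<^sub>R S = - (3/2) *\<^sub>R (P + Q) - (2/3) *\<^sub>R (- 6 *\<^sub>R R) - 2 *\<^sub>R (\<Sum>k\<in>UNIV. F (n k (n k v)))"
    unfolding S2 by simp
  have FG: "F (act (Gg i j) (act (Gg i j) v)) = sact (Gg i j) (sact (Gg i j) (F v)) + 2 *\<^sub>R sact (Gg i j) (eact (Gg i j) (F v))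
      + eact (Gg i j) (eact (Gg i j) (F v))" for i j
    by (simp add: equiv Gg_g2alg sact_simps eact_simps eact_sact scaleR_2)
  have "(\<Sum>i\<in>UNIV. \<Sum>j\<in>UNIV. F (act (Eg i j) (act (Eg i j) v))) = (- 6 * C) *\<^sub>R F v"
    using arg_cong[OF cas[of v], of F] by (simp only: Fs)
  then have "(- 6 * C) *\<^sub>R F v = (9/4) *\<^sub>R (P + 2 *\<^sub>R Q + (- (8/3) * c) *\<^sub>R F v) + 6 *\<^sub>R (\<Sum>k\<in>UNIV. F (n k (n k v)))"
    unfolding casimir_split[OF B2] FG P_def Q_def ecas[symmetric] n_def
    by (simp add: sum.distrib scaleR_sum_right)
  note S4 = this
  define T where "T = (\<Sum>k\<in>UNIV. F (n k (n k v)))"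
  have P: "P = (128/9) *\<^sub>R (sact vac (F v) - F v)"
    unfolding P_def sact_mult[symmetric] linear_sum[OF sact_linear(2), symmetric] sum_Gg_square
    by (simp add: sact_simps_left sact_one)
  have phi2: "sact (phimat * phimat) (F v) = 48 *\<^sub>R sact vac (F v) + F v"
    by (simp add: phimat_square sact_simps_left sact_one)
  have T: "T = - (C *\<^sub>R F v) - (3/8) *\<^sub>R (P + 2 *\<^sub>R Q + (- (8/3) * c) *\<^sub>R F v)"
  proof -
    have "6 *\<^sub>R T = 6 *\<^sub>R (- (C *\<^sub>R F v) - (3/8) *\<^sub>R (P + 2 *\<^sub>R Q + (- (8/3) * c) *\<^sub>R F v))"
      using S4 unfolding T_def[symmetric] by (simp add: scaleR_right_diff_distrib algebra_simps)
    then show ?thesis by (rule scaleR_numeral_cancel)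
  qed
  have S: "S = - (3/4) *\<^sub>R (P + Q) + 2 *\<^sub>R R - T"
  proof -
    have "2 *\<^sub>R S = 2 *\<^sub>R (- (3/4) *\<^sub>R (P + Q) + 2 *\<^sub>R R - T)"
      unfolding S3 T_def[symmetric] by (simp add: scaleR_right_diff_distrib scaleR_right_distrib)
    then show ?thesis by (rule scaleR_numeral_cancel)
  qed
  show ?thesis
    unfolding expand mid phi2 S T P
    by (simp add: vec_eq_iff, rule allI, rule sqmat_eqI) (simp add: entries field_simps)
qed

text \<open>The equation of the eigenvector expresses \<open>cubicD act F\<close> through \<open>F\<close> and \<open>P F\<close>, where \<open>P\<close> is the
  projection \<open>vac\<close>. Inserting this into the square and comparing the components in the image of \<open>P\<close>
  determines \<open>K = C + 49/9 - c\<close> from \<open>r\<close>.\<close>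
lemma no_small_eigenvalue:
  fixes act :: "spinmat \<Rightarrow> 'v::real_vector \<Rightarrow> 'v"
  assumes F: "linear F" and act: "\<And>v. linear (\<lambda>X. act X v)" "\<And>X. linear (act X)"
    and rep: "\<And>X Y v. X \<in> spinalg \<Longrightarrow> Y \<in> spinalg \<Longrightarrow> act (brk X Y) v = act X (act Y v) - act Y (act X v)"
    and equiv: "\<And>X v. X \<in> g2alg \<Longrightarrow> F (act X v) = sact X (F v) + eact X (F v)"
    and cas: "\<And>v. (\<Sum>i\<in>UNIV. \<Sum>j\<in>UNIV. act (Eg i j) (act (Eg i j) v)) = (- 6 * C) *\<^sub>R v"
    and ecas: "\<And>v. (\<Sum>i\<in>UNIV. \<Sum>j\<in>UNIV. eact (Gg i j) (eact (Gg i j) (F v))) = (- (8/3) * c) *\<^sub>R F v"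
    and C: "C \<ge> 37/3" and c: "c \<le> 32/3"
    and eig: "\<And>v. - (\<Sum>k\<in>UNIV. sact (gm k) (F (act (msp (e7 k)) v))) - (1/2) *\<^sub>R sact phimat (F v) = r *\<^sub>R F v"
    and r: "- (5/2) < r" "r < 5/2"
  shows "F v = 0"
proof (rule ccontr)
  assume nz: "F v \<noteq> 0"
  define K where "K = C + 49/9 - c"
  have K: "K \<ge> 64/9" using C c by (simp add: K_def)
  have D: "cubicD act F = (\<lambda>v. (r - 1/6) *\<^sub>R F v + (4/3) *\<^sub>R sact vac (F v))"
  proof
    fix v
    have "cubicD act F v = r *\<^sub>R F v + (1/6) *\<^sub>R sact phimat (F v)"
      unfolding eig[of v, symmetric] cubicD_def
      by (simp add: vec_eq_iff, rule allI, rule sqmat_eqI) (simp add: entries)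
    then show "cubicD act F v = (r - 1/6) *\<^sub>R F v + (4/3) *\<^sub>R sact vac (F v)"
      by (rule trans) (simp add: phimat_def sact_simps_left sact_one algebra_simps)
  qed
  have K2: "K *\<^sub>R F v = (r - 1/6) *\<^sub>R ((r - 1/6) *\<^sub>R F v + (4/3) *\<^sub>R sact vac (F v)) + (4/3) *\<^sub>R cubicD act (\<lambda>v. sact vac (F v)) v" for v
  proof -
    have "K *\<^sub>R F v = cubicD act (cubicD act F) v"
      unfolding K_def by (rule kostant_square[OF F act rep equiv cas ecas, symmetric])
    also have "\<dots> = cubicD act (\<lambda>v. (r - 1/6) *\<^sub>R F v + (4/3) *\<^sub>R sact vac (F v)) v" by (simp only: D)
    also have "\<dots> = (r - 1/6) *\<^sub>R cubicD act F v + (4/3) *\<^sub>R cubicD act (\<lambda>v. sact vac (F v)) v"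
      by (rule cubicD_combination)
    finally show ?thesis by (simp only: D)
  qed
  show False
  proof (cases "\<forall>v. sact vac (F v) = 0")
    case True
    then have "cubicD act (\<lambda>v. sact vac (F v)) v = 0" by (simp add: cubicD_def sact_simps)
    with K2[of v] True have "K *\<^sub>R F v = ((r - 1/6) * (r - 1/6)) *\<^sub>R F v" by simp
    then have "K = (r - 1/6) * (r - 1/6)" using scaleR_right_imp_eq[OF nz] by blast
    also have "\<dots> < 64/9"
    proof -
      have "\<bar>r - 1/6\<bar> < 8/3" using r by linarith
      then have "\<bar>r - 1/6\<bar>\<^sup>2 < (8/3)\<^sup>2" by (intro power_strict_mono) auto
      then show ?thesis by (simp add: power2_eq_square)
    qed
    finally show False using K by simp
  next
    case False
    then obtain w where w: "sact vac (F w) \<noteq> 0" by blast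
    have "sact vac (cubicD act (\<lambda>v. sact vac (F v)) w) = - (7/3) *\<^sub>R sact vac (F w)"
    proof -
      have "sact vac (sact (gm k) (sact vac \<Psi>)) = 0" for k \<Psi>
        by (simp only: sact_mult[symmetric] mult.assoc[symmetric] vac_cliff_vac sact_simps_left)
      moreover have "sact vac (sact phimat (sact vac \<Psi>)) = 7 *\<^sub>R sact vac \<Psi>" for \<Psi>
      proof -
        have "vac * phimat * vac = 8 *\<^sub>R (vac * vac * vac) - vac * vac" by (simp add: phimat_def algebra_simps)
        also have "\<dots> = 7 *\<^sub>R vac" unfolding vac_vac by (rule sqmat_eqI) (simp add: entries)
        finally show ?thesis by (simp only: sact_mult[symmetric] sact_simps_left(5)[symmetric] mult.assoc[symmetric])
      qed
      ultimately show ?thesis by (simp add: cubicD_def sact_simps)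
    qed
    moreover have "sact vac (sact vac \<Psi>) = sact vac \<Psi>" for \<Psi> by (simp add: sact_mult[symmetric] vac_vac)
    ultimately have "K *\<^sub>R sact vac (F w) = ((r - 1/6) * (r - 1/6 + 4/3) + (4/3) * (- (7/3))) *\<^sub>R sact vac (F w)"
    proof -
      assume D2: "sact vac (cubicD act (\<lambda>v. sact vac (F v)) w) = - (7/3) *\<^sub>R sact vac (F w)"
        and vv: "\<And>\<Psi>. sact vac (sact vac \<Psi>) = sact vac \<Psi>"
      have "K *\<^sub>R sact vac (F w) = (r - 1/6) *\<^sub>R ((r - 1/6) *\<^sub>R sact vac (F w) + (4/3) *\<^sub>R sact vac (F w))
          + (4/3) *\<^sub>R (- (7/3) *\<^sub>R sact vac (F w))"
        using arg_cong[OF K2[of w], of "sact vac"] by (simp only: sact_simps vv D2)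
      then show ?thesis
        by (rule trans) (simp only: scaleR_scaleR scaleR_left_distrib[symmetric])
    qed
    then have "K = (r - 1/6) * (r - 1/6 + 4/3) + (4/3) * (- (7/3))" using scaleR_right_imp_eq[OF w] by blast
    then have "K = r * r + r - 119/36" by (simp add: field_simps)
    moreover have "r * r < 25/4"
    proof -
      have "\<bar>r\<bar> < 5/2" using r by linarith
      then have "\<bar>r\<bar>\<^sup>2 < (5/2)\<^sup>2" by (intro power_strict_mono) auto
      then show ?thesis by (simp add: power2_eq_square)
    qed
    ultimately show False using K r by linarith
  qed
qed

section \<open>Spinors in coordinates\<close>
lemma tensor_map_id_nth: 
  "tensor_map A id \<psi> $ i $ j = A (\<psi> $ i $ j)"
proof -
  have d: "dscale (if P then 1 else 0) s = (if P then s else 0)" for P s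
    by (auto simp: dscale_def split_beta prod_eq_iff vec_eq_iff)
  have "tensor_map A id \<psi> $ i $ j = (\<Sum>k\<in>UNIV. \<Sum>l\<in>UNIV. if i = k \<and> j = l then A (\<psi> $ k $ l) else 0)"
    by (simp add: tensor_map_def tensor_def mat_unit_def d)
  also have "\<dots> = (\<Sum>k\<in>UNIV. if i = k then A (\<psi> $ k $ j) else 0)"
    by (intro sum.cong refl) simp
  finally show ?thesis by simp
qed

text \<open>The identification of \<open>\<Delta>\<close>, stored in coordinates with respect to the orthonormal basis \<open>iso (U a)\<close>
  of \<open>m\<close>, with the complexified spin space.\<close>
definition spin_coords :: "(7 \<Rightarrow> real^7) \<Rightarrow> delta \<Rightarrow> complex^ix" where
  "spin_coords U s = (\<chi> t. case t of None \<Rightarrow> fst s | Some i \<Rightarrow> \<Sum>a\<in>UNIV. snd s $ a * of_real (U a $ i))"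

lemma spin_coords_simps: "spin_coords U s $ None = fst s" "spin_coords U s $ Some i = (\<Sum>a\<in>UNIV. snd s $ a * of_real (U a $ i))"
  by (simp_all add: spin_coords_def)

lemma spin_coords_linear: "spin_coords U (x + y) = spin_coords U x + spin_coords U y" "spin_coords U (x - y) = spin_coords U x - spin_coords U y" "spin_coords U (- x) = - spin_coords U x"
  "spin_coords U (r *\<^sub>R x) = r *\<^sub>R spin_coords U x" "spin_coords U 0 = 0"
  "spin_coords U (dscale c x) = c *s spin_coords U x"
  by (simp_all add: vec_eq_iff spin_coords_def dscale_def split_beta algebra_simps sum.distrib sum_subtractf sum_negf
     scaleR_sum_right sum_distrib_left split: option.split)

lemma spin_coords_sum: "spin_coords U (sum f A) = (\<Sum>x\<in>A. spin_coords U (f x))"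
  by (induction A rule: infinite_finite_induct) (simp_all add: spin_coords_linear)

definition rmul :: "spinmat \<Rightarrow> complex^ix \<Rightarrow> complex^ix" where
  "rmul M x = (\<chi> s. \<Sum>t\<in>UNIV. of_real (to_mat M $ s $ t) * x $ t)"

lemma rmul_linear: "linear (\<lambda>M. rmul M x)"
  by (rule linearI) (simp_all add: rmul_def vec_eq_iff entries distrib_right sum.distrib scaleR_sum_right scaleR_conv_of_real[where ?'a=complex] sum_distrib_left mult.assoc)

lemma rmul_mult: "rmul (A * B) x = rmul A (rmul B x)"
  unfolding rmul_def vec_eq_iff
proof
  fix s
  have "(\<Sum>t\<in>UNIV. of_real (to_mat (A * B) $ s $ t) * x $ t) = (\<Sum>t\<in>UNIV. \<Sum>k\<in>UNIV. of_real (to_mat A $ s $ k) * (of_real (to_mat B $ k $ t) * x $ t))"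
    by (simp add: times_entries sum_distrib_right mult.assoc)
  also have "\<dots> = (\<Sum>k\<in>UNIV. \<Sum>t\<in>UNIV. of_real (to_mat A $ s $ k) * (of_real (to_mat B $ k $ t) * x $ t))" by (rule sum.swap)
  finally show "(\<chi> s. \<Sum>t\<in>UNIV. of_real (to_mat (A * B) $ s $ t) * x $ t) $ s =
    (\<chi> s. \<Sum>t\<in>UNIV. of_real (to_mat A $ s $ t) * (\<chi> s. \<Sum>t\<in>UNIV. of_real (to_mat B $ s $ t) * x $ t) $ t) $ s"
    by (simp add: sum_distrib_left)
qed

text \<open>With \<open>l\<close> the real or the imaginary part. All operators that occur are real, so both parts of an
  equivariant eigenvector are again equivariant eigenvectors.\<close>
definition spinor_part :: "(7 \<Rightarrow> real^7) \<Rightarrow> (complex \<Rightarrow> real) \<Rightarrow> delta_mat \<Rightarrow> spinor" where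
  "spinor_part U l \<psi> = (\<chi> s. of_mat (\<chi> i j. l (spin_coords U (\<psi> $ i $ j) $ s)))"

lemma spinor_part_nth: "to_mat (spinor_part U l \<psi> $ s) $ i $ j = l (spin_coords U (\<psi> $ i $ j) $ s)"
  by (simp add: spinor_part_def)

lemma spinor_eqI: "(\<And>s i j. to_mat (\<Psi> $ s) $ i $ j = to_mat (\<Phi> $ s) $ i $ j) \<Longrightarrow> \<Psi> = (\<Phi>::spinor)"
  by (simp add: vec_eq_iff sqmat_eq_iff)

locale frame =
  fixes U :: "7 \<Rightarrow> real^7" and I :: "7 \<Rightarrow> ix rmat"
  assumes I: "\<And>a. I a = iso (U a)" and U: "\<And>a b. U a \<bullet> U b = (if a = b then 1 else 0)"
begin

lemma complete: "(\<Sum>b\<in>UNIV. (x \<bullet> U b) * U b $ i) = x $ i"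
proof -
  have "(\<Sum>b\<in>UNIV. (x \<bullet> U b) * U b $ i) = (\<Sum>b\<in>UNIV. \<Sum>j\<in>UNIV. x $ j * (U b $ j * U b $ i))"
    by (simp add: inner_vec_def sum_distrib_right mult.assoc)
  also have "\<dots> = (\<Sum>j\<in>UNIV. x $ j * (\<Sum>b\<in>UNIV. U b $ j * U b $ i))"
    by (subst sum.swap) (simp add: sum_distrib_left)
  also have "\<dots> = x $ i" by (simp add: orthonormal_rows_columns[OF U] sum_delta_mult)
  finally show ?thesis .
qed

text \<open>The Clifford multiplication of the problem and the matrix \<open>gam u\<close> are given by the same formula,
  the first in the basis \<open>U\<close>, the second in the standard basis of \<open>\<real>\<^sup>7\<close>.\<close>
lemma spin_coords_clifford: "spin_coords U (clifford I (iso u) s) = rmul (cliff u) (spin_coords U s)"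
proof (cases s)
  case (Pair f v)
  have ph: "phi0 u w x = cross u w \<bullet> x" for w x
    unfolding inner_vec_def by (simp add: cross_nth phi0_expand3[of u w x])
  have 1: "(\<Sum>a\<in>UNIV. complex_of_real (u \<bullet> U a) * v $ a) = (\<Sum>i\<in>UNIV. of_real (u $ i) * (\<Sum>a\<in>UNIV. v $ a * of_real (U a $ i)))"
    by (simp add: inner_vec_def sum_distrib_left sum_distrib_right mult_ac) (rule sum.swap)
  have 2: "(\<Sum>b\<in>UNIV. (- f * of_real (u \<bullet> U b) - (\<Sum>c\<in>UNIV. v $ c * of_real (phi0 u (U c) (U b)))) * of_real (U b $ i))
      = - of_real (u $ i) * f + (\<Sum>j\<in>UNIV. of_real (- phi0 u (axis j 1) (axis i 1)) * (\<Sum>c\<in>UNIV. v $ c * of_real (U c $ j)))" for i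
  proof -
    have "(\<Sum>b\<in>UNIV. (- f * of_real (u \<bullet> U b) - (\<Sum>c\<in>UNIV. v $ c * of_real (phi0 u (U c) (U b)))) * of_real (U b $ i))
      = - f * of_real (\<Sum>b\<in>UNIV. (u \<bullet> U b) * U b $ i) - (\<Sum>b\<in>UNIV. \<Sum>c\<in>UNIV. v $ c * of_real ((cross u (U c) \<bullet> U b) * U b $ i))"
      by (simp add: left_diff_distrib sum_subtractf sum_distrib_left sum_distrib_right mult.assoc ph sum_negf)
    also have "(\<Sum>b\<in>UNIV. \<Sum>c\<in>UNIV. v $ c * of_real ((cross u (U c) \<bullet> U b) * U b $ i)) = (\<Sum>c\<in>UNIV. v $ c * of_real (\<Sum>b\<in>UNIV. (cross u (U c) \<bullet> U b) * U b $ i))"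
      by (subst sum.swap) (simp add: sum_distrib_left)
    also have "\<dots> = (\<Sum>c\<in>UNIV. v $ c * of_real (phi0 u (U c) (axis i 1)))" by (simp only: complete cross_nth)
    also have "\<dots> = (\<Sum>c\<in>UNIV. \<Sum>j\<in>UNIV. of_real (phi0 u (axis j 1) (axis i 1)) * (v $ c * of_real (U c $ j)))"
      by (subst phi0_expand2) (simp add: sum_distrib_left mult_ac)
    also have "\<dots> = (\<Sum>j\<in>UNIV. of_real (phi0 u (axis j 1) (axis i 1)) * (\<Sum>c\<in>UNIV. v $ c * of_real (U c $ j)))"
      by (subst sum.swap) (simp add: sum_distrib_left)
    also have "- f * of_real (\<Sum>b\<in>UNIV. (u \<bullet> U b) * U b $ i) = - f * of_real (u $ i)" by (simp only: complete)
    finally show ?thesis by (rule trans) (simp add: sum_negf)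
  qed
  show ?thesis unfolding vec_eq_iff
  proof
    fix t
    show "spin_coords U (clifford I (iso u) s) $ t = rmul (cliff u) (spin_coords U s) $ t"
      using 1 2 by (cases t) (simp_all add: Pair rmul_def spin_coords_simps clifford_def I ip_iso phi_iso sum_option to_mat_cliff gam_simps)
  qed
qed

lemma phi_cubic: "(\<Sum>a\<in>UNIV. \<Sum>b\<in>UNIV. \<Sum>c\<in>UNIV. phi0 (U a) (U b) (U c) *\<^sub>R (cliff (U a) * cliff (U b) * cliff (U c))) = 6 *\<^sub>R phimat"
proof -
  have l: "phi0 (x + y) v w = phi0 x v w + phi0 y v w" "phi0 (r *\<^sub>R x) v w = r * phi0 x v w"
     "phi0 v (x + y) w = phi0 v x w + phi0 v y w" "phi0 v (r *\<^sub>R x) w = r * phi0 v x w"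
     "phi0 v w (x + y) = phi0 v w x + phi0 v w y" "phi0 v w (r *\<^sub>R x) = r * phi0 v w x" for x y v w r
    unfolding phi0_coords by (simp_all add: algebra_simps)
  have b1: "bilinear (\<lambda>x y. phi0 a b x *\<^sub>R (P * cliff y))" for a b P
    unfolding bilinear_def by (auto intro!: linearI simp: l cliff_simps algebra_simps)
  have b2: "bilinear (\<lambda>x y. phi0 a x c *\<^sub>R (P * cliff y * Q))" for a c P Q
    unfolding bilinear_def by (auto intro!: linearI simp: l cliff_simps algebra_simps)
  have b3: "bilinear (\<lambda>x y. phi0 x b c *\<^sub>R (cliff y * P * Q))" for b c P Q
    unfolding bilinear_def by (auto intro!: linearI simp: l cliff_simps algebra_simps)
  have "(\<Sum>a\<in>UNIV. \<Sum>b\<in>UNIV. \<Sum>c\<in>UNIV. phi0 (U a) (U b) (U c) *\<^sub>R (cliff (U a) * cliff (U b) * cliff (U c)))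
    = (\<Sum>a\<in>UNIV. \<Sum>b\<in>UNIV. \<Sum>c\<in>UNIV. phi0 (U a) (U b) (e7 c) *\<^sub>R (cliff (U a) * cliff (U b) * gm c))"
    by (intro sum.cong refl orthonormal_basis_trace[OF b1 U])
  also have "\<dots> = (\<Sum>a\<in>UNIV. \<Sum>c\<in>UNIV. \<Sum>b\<in>UNIV. phi0 (U a) (U b) (e7 c) *\<^sub>R (cliff (U a) * cliff (U b) * gm c))"
    by (intro sum.cong refl sum.swap)
  also have "\<dots> = (\<Sum>a\<in>UNIV. \<Sum>c\<in>UNIV. \<Sum>b\<in>UNIV. phi0 (U a) (e7 b) (e7 c) *\<^sub>R (cliff (U a) * gm b * gm c))"
    by (intro sum.cong refl orthonormal_basis_trace[OF b2 U])
  also have "\<dots> = (\<Sum>c\<in>UNIV. \<Sum>b\<in>UNIV. \<Sum>a\<in>UNIV. phi0 (U a) (e7 b) (e7 c) *\<^sub>R (cliff (U a) * gm b * gm c))"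
    by (rule trans[OF sum.swap sum.cong[OF refl sum.swap]])
  also have "\<dots> = (\<Sum>c\<in>UNIV. \<Sum>b\<in>UNIV. \<Sum>a\<in>UNIV. phi0 (e7 a) (e7 b) (e7 c) *\<^sub>R (gm a * gm b * gm c))"
    by (intro sum.cong refl orthonormal_basis_trace[OF b3 U])
  also have "\<dots> = (\<Sum>a\<in>UNIV. \<Sum>b\<in>UNIV. \<Sum>c\<in>UNIV. eps a b c *\<^sub>R (gm a * gm b * gm c))"
    unfolding eps_def by (rule trans[OF trans[OF sum.cong[OF refl sum.swap] sum.swap] sum.cong[OF refl sum.swap]])
  finally show ?thesis unfolding sum_eps_cubic .
qed

lemma spin_coords_clifford_phi: "spin_coords U (clifford_phi I s) = rmul phimat (spin_coords U s)"
proof -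
  have "spin_coords U (clifford_phi I s) = (\<Sum>a\<in>UNIV. \<Sum>b\<in>UNIV. \<Sum>c\<in>UNIV. (phi0 (U a) (U b) (U c) / 6) *\<^sub>R rmul (cliff (U a) * cliff (U b) * cliff (U c)) (spin_coords U s))"
    by (simp add: clifford_phi_def spin_coords_sum spin_coords_linear I phi_iso spin_coords_clifford rmul_mult)
  also have "\<dots> = rmul ((1/6) *\<^sub>R (\<Sum>a\<in>UNIV. \<Sum>b\<in>UNIV. \<Sum>c\<in>UNIV. phi0 (U a) (U b) (U c) *\<^sub>R (cliff (U a) * cliff (U b) * cliff (U c)))) (spin_coords U s)"
    by (simp add: linear_sum[OF rmul_linear] linear_scale[OF rmul_linear] scaleR_sum_right)
  finally show ?thesis by (simp add: phi_cubic)
qed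

lemma spin_coords_eq_0: "spin_coords U s = 0 \<Longrightarrow> s = 0"
proof -
  assume h: "spin_coords U s = 0"
  have f: "fst s = 0" using arg_cong[OF h, of "\<lambda>x. x $ None"] by (simp add: spin_coords_simps)
  have z: "(\<Sum>a\<in>UNIV. snd s $ a * of_real (U a $ i)) = 0" for i
    using arg_cong[OF h, of "\<lambda>x. x $ Some i"] by (simp add: spin_coords_simps)
  have "snd s $ b = 0" for b
  proof -
    have "snd s $ b = (\<Sum>a\<in>UNIV. snd s $ a * of_real (U a \<bullet> U b))" by (simp add: U if_distrib[of of_real] if_distrib[of "\<lambda>x. _ * x"] cong: if_cong)
    also have "\<dots> = (\<Sum>i\<in>UNIV. (\<Sum>a\<in>UNIV. snd s $ a * of_real (U a $ i)) * of_real (U b $ i))"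
      by (simp add: inner_vec_def sum_distrib_left sum_distrib_right mult.assoc) (rule sum.swap)
    finally show ?thesis by (simp add: z)
  qed
  then show ?thesis using f by (simp add: prod_eq_iff vec_eq_iff)
qed

text \<open>On the complement \<open>\<real>\<^sup>7\<close> of the fixed spinor, an element of \<open>G\<^sub>2\<close> acts by the rotation that it induces
  on Clifford vectors; so \<open>\<real>\<^sup>7\<close> and \<open>m\<close> with the adjoint action are the same representation.\<close>
lemma G2_rotation:
  assumes G: "G \<in> spingrp" and v: "G * vac = vac"
  obtains L adjL where "\<And>u w. L u \<bullet> w = u \<bullet> adjL w" "\<And>u. tp G * msp u * G = msp (adjL u)"
    "\<And>u i. (\<Sum>j\<in>UNIV. to_mat G $ Some i $ Some j * u $ j) = L u $ i"
    "\<And>s. to_mat G $ s $ None = (if s = None then 1 else 0)" "\<And>s. to_mat G $ None $ s = (if s = None then 1 else 0)"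
proof -
  have tG: "tp G \<in> spingrp" by (rule spingrp_tp[OF G])
  have gi: "tp G * G = 1" "G * tp G = 1" using spingrp_inverse[OF G] by auto
  have "\<forall>u. \<exists>w. G * cliff u * tp G = cliff w" "\<forall>u. \<exists>w. tp G * cliff u * G = cliff w"
    using spingrp_normaliser[OF G] spingrp_normaliser[OF tG] by (auto simp: normaliser_def tp_tp)
  then obtain L adjL where L: "\<And>u. G * cliff u * tp G = cliff (L u)" and A: "\<And>u. tp G * cliff u * G = cliff (adjL u)"
    by metis
  have v1: "tp G * vac = vac" using arg_cong[OF v, of "\<lambda>X. tp G * X"] by (simp add: gi mult.assoc[symmetric])
  have v2: "vac * G = vac" using arg_cong[OF v1, of tp] by (simp add: tp_mult tp_tp tp_vac)
  have adj: "L u \<bullet> w = u \<bullet> adjL w" for u w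
  proof -
    have "tr (cliff (L u) * cliff w) = tr (G * (cliff u * tp G * cliff w))" by (simp only: L[symmetric] mult.assoc)
    also have "\<dots> = tr (cliff u * tp G * cliff w * G)" by (rule tr_mult_commute)
    also have "\<dots> = tr (cliff u * cliff (adjL w))" by (simp only: A[symmetric] mult.assoc)
    finally show ?thesis by (simp add: tr_cliff_cliff)
  qed
  have m: "tp G * msp u * G = msp (adjL u)" for u
  proof -
    have "tp G * msp u * G = (1/3) *\<^sub>R (tp G * cliff u * G - 4 *\<^sub>R (tp G * cliff u * (vac * G) + (tp G * vac) * cliff u * G))"
      by (simp add: msp_def algebra_simps)
    also have "tp G * cliff u * (vac * G) = (tp G * cliff u * G) * (tp G * vac)"
    proof -
      have "(tp G * cliff u * G) * (tp G * vac) = tp G * cliff u * (G * tp G) * vac" by (simp only: mult.assoc)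
      then show ?thesis by (simp add: gi v2)
    qed
    also have "(tp G * vac) * cliff u * G = vac * (tp G * cliff u * G)"
    proof -
      have "vac * (tp G * cliff u * G) = (vac * G) * (tp G * cliff u * G)" by (simp only: v2)
      also have "\<dots> = vac * (G * tp G) * cliff u * G" by (simp only: mult.assoc)
      finally show ?thesis by (simp add: gi v1)
    qed
    finally show ?thesis by (simp add: A v1 msp_def)
  qed
  have c1: "to_mat G $ s $ None = (if s = None then 1 else 0)" for s
  proof -
    have "to_mat G $ s $ None = to_mat (G * vac) $ s $ None" by (simp add: vac_mult_entries)
    also have "\<dots> = (if s = None then 1 else 0)" unfolding v by (simp add: vac_def)
    finally show ?thesis .
  qed
  have c2: "to_mat G $ None $ s = (if s = None then 1 else 0)" for s
  proof -
    have "to_mat G $ None $ s = to_mat (vac * G) $ None $ s" by (simp add: vac_mult_entries)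
    also have "\<dots> = (if s = None then 1 else 0)" unfolding v2 by (simp add: vac_def)
    finally show ?thesis .
  qed
  have c3: "(\<Sum>j\<in>UNIV. to_mat G $ Some i $ Some j * u $ j) = L u $ i" for u i
  proof -
    have "G * cliff u * vac = G * cliff u * (tp G * G) * vac" by (simp add: gi)
    also have "\<dots> = cliff (L u) * vac" by (simp only: L[symmetric] mult.assoc v)
    finally have "to_mat (G * (cliff u * vac)) $ Some i $ None = to_mat (cliff (L u) * vac) $ Some i $ None"
      by (simp add: mult.assoc)
    then show ?thesis by (simp add: times_entries[of G] sum_option vac_mult_entries to_mat_cliff gam_simps sum_negf)
  qed
  show thesis by (rule that[OF adj m c3 c1 c2])
qed

lemma matrix_inv_spingrp: "G \<in> spingrp \<Longrightarrow> matrix_inv (to_mat G) = to_mat (tp G)"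
proof -
  assume G: "G \<in> spingrp"
  have e: "to_mat G ** to_mat (tp G) = mat 1" "to_mat (tp G) ** to_mat G = mat 1"
    using spingrp_inverse[OF G] by (simp_all add: times_sqmat.rep_eq[symmetric] one_sqmat.rep_eq[symmetric])
  have "to_mat G ** matrix_inv (to_mat G) = mat 1 \<and> matrix_inv (to_mat G) ** to_mat G = mat 1"
    unfolding matrix_inv_def by (rule someI) (use e in blast)
  then have "matrix_inv (to_mat G) ** (to_mat G ** to_mat (tp G)) = to_mat (tp G)"
    by (simp only: matrix_mul_assoc matrix_mul_lid)
  then show ?thesis by (simp only: e matrix_mul_rid)
qed

lemma spin_coords_delta_act:
  assumes G: "G \<in> spingrp" and v: "G * vac = vac"
  shows "spin_coords U (delta_act I (to_mat G) s) = rmul G (spin_coords U s)"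
proof -
  obtain L adjL where L: "\<And>u w. L u \<bullet> w = u \<bullet> adjL w" and m: "\<And>u. tp G * msp u * G = msp (adjL u)"
    and c: "\<And>u i. (\<Sum>j\<in>UNIV. to_mat G $ Some i $ Some j * u $ j) = L u $ i"
    "\<And>s. to_mat G $ s $ None = (if s = None then 1 else 0)" "\<And>s. to_mat G $ None $ s = (if s = None then 1 else 0)"
    by (rule G2_rotation[OF G v]) blast
  have ipe: "ip (matrix_inv (to_mat G) ** I b ** to_mat G) (I a) = L (U a) \<bullet> U b" for a b
  proof -
    have "matrix_inv (to_mat G) ** I b ** to_mat G = iso (adjL (U b))"
      by (simp add: matrix_inv_spingrp[OF G] I iso_def times_sqmat.rep_eq[symmetric] m)
    then show ?thesis by (simp add: I ip_iso L) (rule inner_commute)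
  qed
  have 2: "(\<Sum>b\<in>UNIV. (\<Sum>a\<in>UNIV. of_real (L (U a) \<bullet> U b) * x $ a) * of_real (U b $ i))
     = (\<Sum>j\<in>UNIV. of_real (to_mat G $ Some i $ Some j) * (\<Sum>a\<in>UNIV. x $ a * of_real (U a $ j)))" for x :: "complex^7" and i
  proof -
    have "(\<Sum>b\<in>UNIV. (\<Sum>a\<in>UNIV. of_real (L (U a) \<bullet> U b) * x $ a) * of_real (U b $ i))
      = (\<Sum>b\<in>UNIV. \<Sum>a\<in>UNIV. x $ a * of_real ((L (U a) \<bullet> U b) * U b $ i))"
      by (simp add: sum_distrib_left sum_distrib_right mult_ac)
    also have "\<dots> = (\<Sum>a\<in>UNIV. x $ a * of_real (\<Sum>b\<in>UNIV. (L (U a) \<bullet> U b) * U b $ i))"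
      by (subst sum.swap) (simp add: sum_distrib_left)
    also have "\<dots> = (\<Sum>a\<in>UNIV. \<Sum>j\<in>UNIV. of_real (to_mat G $ Some i $ Some j) * (x $ a * of_real (U a $ j)))"
      unfolding complete c(1)[symmetric] by (simp add: sum_distrib_left mult_ac)
    also have "\<dots> = (\<Sum>j\<in>UNIV. of_real (to_mat G $ Some i $ Some j) * (\<Sum>a\<in>UNIV. x $ a * of_real (U a $ j)))"
      by (subst sum.swap) (simp add: sum_distrib_left)
    finally show ?thesis .
  qed
  show ?thesis unfolding vec_eq_iff
  proof
    fix t
    show "spin_coords U (delta_act I (to_mat G) s) $ t = rmul G (spin_coords U s) $ t"
      using 2 by (cases t; cases s) (simp_all add: spin_coords_simps delta_act_def ipe rmul_def sum_option c(2,3))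
  qed
qed

definition gact :: "spinmat \<Rightarrow> spinor \<Rightarrow> spinor" where
  "gact G \<Psi> = (\<chi> s. \<Sum>t\<in>UNIV. to_mat G $ s $ t *\<^sub>R (G * \<Psi> $ t * tp G))"

lemma spinor_part_group_action:
  assumes l: "linear l" and G: "G \<in> spingrp" and v: "G * vac = vac"
  shows "spinor_part U l (tensor_map (delta_act I (to_mat G)) (Ad (to_mat G)) \<psi>) = gact G (spinor_part U l \<psi>)"
proof (rule spinor_eqI)
  fix s i j
  have ad: "Ad (to_mat G) (mat_unit k m) $ i $ j = of_real (to_mat G $ i $ k * to_mat (tp G) $ m $ j)" for k m
  proof -
    have "Ad (to_mat G) (mat_unit k m) $ i $ j = (\<Sum>b\<in>UNIV. (\<Sum>a\<in>UNIV. of_real (to_mat G $ i $ a) * (if a = k \<and> b = m then 1 else 0)) * of_real (to_mat (tp G) $ b $ j))"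
      by (simp add: Ad_def matrix_inv_spingrp[OF G] matrix_matrix_mult_def complex_mat_def mat_unit_def)
    also have "\<dots> = (\<Sum>b\<in>UNIV. (if b = m then of_real (to_mat G $ i $ k) else 0) * of_real (to_mat (tp G) $ b $ j))"
      by (intro sum.cong refl arg_cong2[of _ _ _ _ "(*)"]) (auto simp: if_distrib[of "\<lambda>x. _ * x"] cong: if_cong)
    also have "\<dots> = of_real (to_mat G $ i $ k * to_mat (tp G) $ m $ j)"
      by (simp add: if_distrib[of "\<lambda>x. x * _"] cong: if_cong)
    finally show ?thesis .
  qed
  have ls: "l (\<Sum>x\<in>A. of_real (f x) * y x) = (\<Sum>x\<in>A. f x * l (y x))" for f and y :: "'c \<Rightarrow> complex" and A
    using linear_scale[OF l] by (simp add: linear_sum[OF l] scaleR_conv_of_real[symmetric])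
  have l1: "l (of_real x * y) = x * l y" for x y
    using linear_scale[OF l, of x y] by (simp add: scaleR_conv_of_real)
  define h where "h k m t = l (spin_coords U (\<psi> $ k $ m) $ t)" for k m t
  have "spin_coords U (tensor_map (delta_act I (to_mat G)) (Ad (to_mat G)) \<psi> $ i $ j) $ s
     = (\<Sum>k\<in>UNIV. \<Sum>m\<in>UNIV. of_real (to_mat G $ i $ k * to_mat (tp G) $ m $ j) * (\<Sum>t\<in>UNIV. of_real (to_mat G $ s $ t) * spin_coords U (\<psi> $ k $ m) $ t))"
    by (simp add: tensor_map_def tensor_def spin_coords_sum spin_coords_linear spin_coords_delta_act[OF G v] ad rmul_def)
  then have "l (spin_coords U (tensor_map (delta_act I (to_mat G)) (Ad (to_mat G)) \<psi> $ i $ j) $ s)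
     = (\<Sum>k\<in>UNIV. \<Sum>m\<in>UNIV. (to_mat G $ i $ k * to_mat (tp G) $ m $ j) * (\<Sum>t\<in>UNIV. to_mat G $ s $ t * h k m t))"
    by (simp only: linear_sum[OF l] l1 h_def)
  also have "\<dots> = (\<Sum>k\<in>UNIV. \<Sum>m\<in>UNIV. \<Sum>t\<in>UNIV. to_mat G $ s $ t * (to_mat G $ i $ k * h k m t * to_mat (tp G) $ m $ j))"
    by (simp add: sum_distrib_left mult_ac)
  also have "\<dots> = (\<Sum>t\<in>UNIV. \<Sum>m\<in>UNIV. \<Sum>k\<in>UNIV. to_mat G $ s $ t * (to_mat G $ i $ k * h k m t * to_mat (tp G) $ m $ j))"
    by (rule trans[OF trans[OF sum.cong[OF refl sum.swap] sum.swap] sum.cong[OF refl sum.swap]])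
  also have "\<dots> = to_mat (gact G (spinor_part U l \<psi>) $ s) $ i $ j"
    by (simp add: gact_def entries_sum entries times_entries spinor_part_nth h_def sum_distrib_left sum_distrib_right)
  finally show "to_mat (spinor_part U l (tensor_map (delta_act I (to_mat G)) (Ad (to_mat G)) \<psi>) $ s) $ i $ j = to_mat (gact G (spinor_part U l \<psi>) $ s) $ i $ j"
    by (simp add: spinor_part_nth)
qed

lemma spinor_part_spin_action:
  assumes l: "linear l" and A: "\<And>s. spin_coords U (A s) = rmul M (spin_coords U s)"
  shows "spinor_part U l (tensor_map A id \<psi>) = sact M (spinor_part U l \<psi>)"
proof (rule spinor_eqI)
  fix s i j
  have ls: "l (\<Sum>x\<in>A. of_real (f x) * y x) = (\<Sum>x\<in>A. f x * l (y x))" for f and y :: "'c \<Rightarrow> complex" and A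
    using linear_scale[OF l] by (simp add: linear_sum[OF l] scaleR_conv_of_real[symmetric])
  show "to_mat (spinor_part U l (tensor_map A id \<psi>) $ s) $ i $ j = to_mat (sact M (spinor_part U l \<psi>) $ s) $ i $ j"
    by (simp add: spinor_part_nth tensor_map_id_nth A rmul_def ls sact_def entries_sum entries)
qed

lemma spinor_part_linear:
  assumes l: "linear l"
  shows "spinor_part U l (x + y) = spinor_part U l x + spinor_part U l y" "spinor_part U l (x - y) = spinor_part U l x - spinor_part U l y" "spinor_part U l (- x) = - spinor_part U l x"
    "spinor_part U l (r *\<^sub>R x) = r *\<^sub>R spinor_part U l x" "spinor_part U l (sum f A) = (\<Sum>a\<in>A. spinor_part U l (f a))"
proof -
  show 1: "spinor_part U l (x + y) = spinor_part U l x + spinor_part U l y" for x y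
    by (rule spinor_eqI) (simp add: spinor_part_nth entries spin_coords_linear linear_add[OF l])
  show 2: "spinor_part U l (x - y) = spinor_part U l x - spinor_part U l y"
    by (rule spinor_eqI) (simp add: spinor_part_nth entries spin_coords_linear linear_diff[OF l])
  show 3: "spinor_part U l (- x) = - spinor_part U l x"
    by (rule spinor_eqI) (simp add: spinor_part_nth entries spin_coords_linear linear_neg[OF l])
  show 4: "spinor_part U l (r *\<^sub>R x) = r *\<^sub>R spinor_part U l x" for r x
    by (rule spinor_eqI) (simp add: spinor_part_nth entries spin_coords_linear linear_scale[OF l])
  have "spinor_part U l 0 = 0" using 4[of 0 0] by simp
  then show "spinor_part U l (sum f A) = (\<Sum>a\<in>A. spinor_part U l (f a))"
    by (induction A rule: infinite_finite_induct) (simp_all add: 1)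
qed

text \<open>Tuples of matrices in \<open>spin(7)\<close> form a complex subspace that contains the pure tensors.\<close>
lemma delta_spin7C_spinor_part:
  assumes "\<psi> \<in> delta_spin7C"
  shows "spinor_part U Re \<psi> $ s \<in> spinalg \<and> spinor_part U Im \<psi> $ s \<in> spinalg"
proof -
  interpret T: vector_space tscale by (rule vector_space_tscale)
  define W where "W = {\<psi>. \<forall>s. spinor_part U Re \<psi> $ s \<in> spinalg \<and> spinor_part U Im \<psi> $ s \<in> spinalg}"
  have lin: "linear Re" "linear Im" by (auto intro!: linearI)
  have ts: "spinor_part U Re (tscale c \<psi>) $ s = Re c *\<^sub>R (spinor_part U Re \<psi> $ s) - Im c *\<^sub>R (spinor_part U Im \<psi> $ s)"
    "spinor_part U Im (tscale c \<psi>) $ s = Re c *\<^sub>R (spinor_part U Im \<psi> $ s) + Im c *\<^sub>R (spinor_part U Re \<psi> $ s)" for c \<psi> s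
    by (rule sqmat_eqI, simp add: spinor_part_nth entries tscale_def spin_coords_linear)+
  have z: "spinor_part U Re 0 = 0" "spinor_part U Im 0 = 0"
    using spinor_part_linear(4)[OF lin(1), of 0 0] spinor_part_linear(4)[OF lin(2), of 0 0] by simp_all
  have "T.subspace W"
    unfolding T.subspace_def W_def
    by (auto simp: z spinor_part_linear(1)[OF lin(1)] spinor_part_linear(1)[OF lin(2)] ts
      intro!: subspace_0[OF subspace_spinalg] subspace_add[OF subspace_spinalg] subspace_diff[OF subspace_spinalg] subspace_scale[OF subspace_spinalg])
  moreover have "{tensor s X | s X. X \<in> spin7C} \<subseteq> W"
  proof safe
    fix s X assume "X \<in> spin7C"
    then obtain A B where AB: "X = complex_mat A + mscale \<i> (complex_mat B)" "A \<in> spin7" "B \<in> spin7"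
      by (auto simp: spin7C_def)
    have "spinor_part U Re (tensor s X) $ t = Re (spin_coords U s $ t) *\<^sub>R of_mat A - Im (spin_coords U s $ t) *\<^sub>R of_mat B"
      "spinor_part U Im (tensor s X) $ t = Re (spin_coords U s $ t) *\<^sub>R of_mat B + Im (spin_coords U s $ t) *\<^sub>R of_mat A" for t
      by (rule sqmat_eqI, simp add: spinor_part_nth entries tensor_def spin_coords_linear AB complex_mat_def mscale_def)+
    then show "tensor s X \<in> W"
      using AB by (auto simp: W_def spin7_eq
        intro!: subspace_add[OF subspace_spinalg] subspace_diff[OF subspace_spinalg] subspace_scale[OF subspace_spinalg])
  qed
  ultimately have "T.span {tensor s X | s X. X \<in> spin7C} \<subseteq> W" by (intro T.span_minimal)
  then show ?thesis using assms unfolding delta_spin7C_def W_def by auto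
qed

lemma spinor_part_eq_0:
  assumes "spinor_part U Re \<psi> = 0" "spinor_part U Im \<psi> = 0" shows "\<psi> = 0"
proof -
  have "spin_coords U (\<psi> $ i $ j) = 0" for i j
  proof -
    have "Re (spin_coords U (\<psi> $ i $ j) $ s) = 0" "Im (spin_coords U (\<psi> $ i $ j) $ s) = 0" for s
      using assms spinor_part_nth[of U Re \<psi> s i j] spinor_part_nth[of U Im \<psi> s i j] by (simp_all add: entries)
    then show ?thesis by (simp add: vec_eq_iff complex_eq_iff)
  qed
  then show ?thesis using spin_coords_eq_0 by (simp add: vec_eq_iff)
qed

end

section \<open>The eigenvalue estimate\<close>

text \<open>The projection of \<open>spin(7)\<close> to \<open>m\<close> along \<open>g\<^sub>2\<close>: the element of \<open>m\<close> with the same value on the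
  distinguished spinor.\<close>
definition proj_msp :: "spinmat \<Rightarrow> spinmat" where "proj_msp Z = msp (\<chi> a. to_mat Z $ Some a $ None)"

lemma linear_proj_msp: "linear proj_msp"
proof -
  have "linear (\<lambda>Z::spinmat. (\<chi> a. to_mat Z $ Some a $ None) :: real^7)"
    by (rule linearI) (simp_all add: vec_eq_iff entries)
  from linear_compose[OF this linear_msp] show ?thesis by (simp add: proj_msp_def[abs_def] o_def)
qed

lemma proj_msp_msp: "proj_msp (msp u) = msp u"
proof -
  have "to_mat (msp u) $ Some a $ None = u $ a" for a
  proof -
    have "to_mat (msp u) $ Some a $ None = to_mat (msp u * vac) $ Some a $ None" by (simp add: vac_mult_entries)
    then show ?thesis unfolding msp_vac by (simp add: entries vac_mult_entries to_mat_cliff gam_simps)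
  qed
  then show ?thesis by (simp add: proj_msp_def)
qed

lemma proj_msp_g2: assumes "X \<in> g2alg" shows "proj_msp X = 0"
proof -
  have "to_mat X $ Some a $ None = to_mat (X * vac) $ Some a $ None" for a by (simp add: vac_mult_entries)
  then have "(\<chi> a. to_mat X $ Some a $ None) = (0::real^7)" by (simp add: g2alg_vac[OF assms] entries vec_eq_iff)
  then show ?thesis by (simp add: proj_msp_def msp_simps)
qed

lemma proj_msp_complement: "Z \<in> spinalg \<Longrightarrow> Z - proj_msp Z \<in> g2alg"
proof -
  assume "Z \<in> spinalg"
  then obtain u where u: "Z - msp u \<in> g2alg" by (rule spinalg_decomp)
  from proj_msp_g2[OF u] have "proj_msp Z = msp u" by (simp add: linear_diff[OF linear_proj_msp] proj_msp_msp)
  with u show ?thesis by simp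
qed

lemma brk_g2alg: "X \<in> g2alg \<Longrightarrow> Y \<in> g2alg \<Longrightarrow> brk X Y \<in> g2alg"
  using brk_spinalg[of X Y] g2alg_vac[of X] g2alg_vac[of Y] by (simp add: g2alg_def brk_def left_diff_distrib mult.assoc)

lemma proj_msp_brk: assumes X: "X \<in> g2alg" and Z: "Z \<in> spinalg" shows "proj_msp (brk X Z) = brk X (proj_msp Z)"
proof -
  have "brk X Z = brk X (proj_msp Z) + brk X (Z - proj_msp Z)" by (simp add: linear_diff[OF linear_brk])
  moreover have "proj_msp (brk X (Z - proj_msp Z)) = 0" by (rule proj_msp_g2[OF brk_g2alg[OF X proj_msp_complement[OF Z]]])
  moreover have "proj_msp (brk X (proj_msp Z)) = brk X (proj_msp Z)" unfolding proj_msp_def[of Z] brk_msp_g2[OF X] by (rule proj_msp_msp)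
  ultimately show ?thesis by (simp add: linear_add[OF linear_proj_msp])
qed

definition map_spinor :: "(spinmat \<Rightarrow> spinmat) \<Rightarrow> spinor \<Rightarrow> spinor" where "map_spinor p \<Psi> = (\<chi> s. p (\<Psi> $ s))"

lemma linear_map_spinor: "linear p \<Longrightarrow> linear (map_spinor p)"
  by (rule linearI) (simp_all add: map_spinor_def vec_eq_iff linear_add linear_scale)

lemma map_spinor_sact: "linear p \<Longrightarrow> map_spinor p (sact M \<Psi>) = sact M (map_spinor p \<Psi>)"
  by (simp add: map_spinor_def sact_def vec_eq_iff linear_sum linear_scale)

lemma tscale_of_real: "tscale (of_real r) \<psi> = r *\<^sub>R \<psi>"
  by (simp add: tscale_def dscale_def vec_eq_iff prod_eq_iff split_beta scaleR_conv_of_real[where ?'a=complex])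

lemma scaleR_matvec: "(r *\<^sub>R M) *v v = r *\<^sub>R ((M::complex^'n^'m) *v v)"
  by (simp add: vec_eq_iff matrix_vector_mult_def scaleR_sum_right)

context frame
begin

text \<open>The derivative of the action of \<open>G\<^sub>2\<close> on the tensor product, by the Leibniz rule.\<close>
lemma gact_derivative:
  assumes X: "X \<in> g2alg"
  shows "((\<lambda>t. gact (exp (t *\<^sub>R X)) \<Psi> $ s) has_vector_derivative (sact X \<Psi> + eact X \<Psi>) $ s) (at 0)"
proof -
  have t: "tp (exp (t *\<^sub>R X)) = exp (- (t *\<^sub>R X))" for t using X by (simp add: tp_exp tp_simps g2alg_def spinalg_def)
  have entry: "bounded_linear (\<lambda>M::spinmat. to_mat M $ s $ k)" for s k
    by (rule bounded_linear_sqmat, rule linearI) (simp_all add: entries)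
    have d: "((\<lambda>t. exp (t *\<^sub>R X) * (\<Psi> $ k * exp (- (t *\<^sub>R X)))) has_vector_derivative
        exp (0 *\<^sub>R X) * (\<Psi> $ k * - (X * exp (- (0 *\<^sub>R X)))) + X * exp (0 *\<^sub>R X) * (\<Psi> $ k * exp (- (0 *\<^sub>R X)))) (at 0)" for k
      by (intro has_vector_derivative_mult exp_scaleR_has_vector_derivative_left
          bounded_linear.has_vector_derivative[OF bounded_linear_mult_right] exp_neg_has_vector_derivative)
    have e: "((\<lambda>t. to_mat (exp (t *\<^sub>R X)) $ s $ k) has_vector_derivative to_mat (X * exp (0 *\<^sub>R X)) $ s $ k) (at 0)" for k
      by (rule bounded_linear.has_vector_derivative[OF entry exp_scaleR_has_vector_derivative_left])
    have "((\<lambda>t. \<Sum>k\<in>UNIV. to_mat (exp (t *\<^sub>R X)) $ s $ k *\<^sub>R (exp (t *\<^sub>R X) * (\<Psi> $ k * exp (- (t *\<^sub>R X))))) has_vector_derivative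
       (\<Sum>k\<in>UNIV. to_mat (exp (0 *\<^sub>R X)) $ s $ k *\<^sub>R (exp (0 *\<^sub>R X) * (\<Psi> $ k * - (X * exp (- (0 *\<^sub>R X)))) + X * exp (0 *\<^sub>R X) * (\<Psi> $ k * exp (- (0 *\<^sub>R X))))
         + to_mat (X * exp (0 *\<^sub>R X)) $ s $ k *\<^sub>R (exp (0 *\<^sub>R X) * (\<Psi> $ k * exp (- (0 *\<^sub>R X)))))) (at 0)"
      by (intro has_vector_derivative_sum has_vector_derivative_scaleR d)
        (use e in \<open>simp add: has_real_derivative_iff_has_vector_derivative\<close>)
    moreover have "(\<Sum>k\<in>UNIV. to_mat (exp (0 *\<^sub>R X)) $ s $ k *\<^sub>R (exp (0 *\<^sub>R X) * (\<Psi> $ k * - (X * exp (- (0 *\<^sub>R X)))) + X * exp (0 *\<^sub>R X) * (\<Psi> $ k * exp (- (0 *\<^sub>R X))))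
         + to_mat (X * exp (0 *\<^sub>R X)) $ s $ k *\<^sub>R (exp (0 *\<^sub>R X) * (\<Psi> $ k * exp (- (0 *\<^sub>R X))))) = (sact X \<Psi> + eact X \<Psi>) $ s"
      by (simp add: sact_def eact_def brk_def sum.distrib entries if_distrib[of "\<lambda>x. x *\<^sub>R _"] cong: if_cong)
    ultimately show ?thesis by (simp add: gact_def t mult.assoc)
qed

end

text \<open>The real and the imaginary part of \<open>\<eta>\<close> are projected to the \<open>G\<^sub>2\<close>-summands \<open>m\<close> and \<open>g\<^sub>2\<close> of the Lie
  algebra, on each of which the Casimir operator of \<open>g\<^sub>2\<close> is a scalar; \<open>no_small_eigenvalue\<close> shows that
  all four vanish.\<close>
lemma small_eigensection_zero:
  fixes \<rho> :: "ix rmat \<Rightarrow> complex^'n^'n"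
  assumes ob: "orthonormal_basis_m I" and irr: "irreducible_spin7_rep \<rho>"
    and hw: "\<forall>\<gamma>\<in>{(0,0,0), (1,0,0), (0,0,1)}. \<not> has_highest_weight \<rho> \<gamma>"
    and r: "- (5/2) < r" "r < 5/2" and \<eta>: "\<eta> \<in> Hom_G2 I \<rho>" and eig: "dirac I \<rho> \<eta> = (\<lambda>v. r *\<^sub>R \<eta> v)"
  shows "\<eta> v = 0"
proof -
  interpret spin_rep \<rho> using irr by unfold_locales (simp add: irreducible_spin7_rep_def)
  obtain U where Uf: "\<And>a. I a = iso (U a)" "\<And>a b. U a \<bullet> U b = (if a = b then 1 else 0)"
    using orthonormal_basis_m_iso[OF ob] by blast
  interpret frame U I using Uf by unfold_locales
  obtain v0 a b c where v0: "v0 \<noteq> 0" "has_highest_weight \<rho> (a, b, c)"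
    and cv: "(\<Sum>i\<in>UNIV. \<Sum>j\<in>UNIV. sq i j v0) = of_real (- 8 * ((real a + b + c / 2)\<^sup>2 + (real b + c / 2)\<^sup>2 + (c / 2)\<^sup>2
        + 5 * (real a + b + c / 2) + 3 * (real b + c / 2) + c / 2)) *s v0"
    by (rule highest_weight_casimir)
  define q where "q = (real a + b + c / 2)\<^sup>2 + (real b + c / 2)\<^sup>2 + (c / 2)\<^sup>2
        + 5 * (real a + b + c / 2) + 3 * (real b + c / 2) + c / 2"
  have q: "q \<ge> 37/4" unfolding q_def by (rule weight_bound) (use v0(2) hw in blast)
  have cas: "(\<Sum>i\<in>UNIV. \<Sum>j\<in>UNIV. op (Eg i j) (op (Eg i j) w)) = (- 6 * (4/3 * q)) *\<^sub>R w" for w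
    using casimir_scalar[OF irr v0(1) cv[folded q_def], of w] by (simp add: sq_def scaleR_vscale)
  have le: "Vector_Spaces.linear (*s) tscale \<eta>" and es: "\<And>v. \<eta> v \<in> delta_spin7C"
    and eg: "\<And>g v. g \<in> G2 \<Longrightarrow> \<eta> (\<rho> g *v v) = tensor_map (delta_act I g) (Ad g) (\<eta> v)"
    using \<eta> by (auto simp: Hom_G2_def)
  interpret E: Vector_Spaces.linear "(*s)" tscale \<eta> by (rule le)
  have \<eta>r: "\<eta> (x *\<^sub>R w) = x *\<^sub>R \<eta> w" for x w by (simp add: scaleR_vscale E.scale tscale_of_real)
  have zero: "spinor_part U l (\<eta> v) = 0" if lin: "linear l" and sp: "\<And>v s. spinor_part U l (\<eta> v) $ s \<in> spinalg" for l v
  proof -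
    define F where "F v = spinor_part U l (\<eta> v)" for v
    have lF: "linear F"
      by (rule linearI) (simp_all add: F_def E.add \<eta>r spinor_part_linear[OF lin])
    have Feq: "F (op X v) = sact X (F v) + eact X (F v)" if X: "X \<in> g2alg" for X v
      unfolding vec_eq_iff
    proof
      fix s
      have Xs: "X \<in> spinalg" using X by (simp add: g2alg_def)
      have G: "exp (t *\<^sub>R X) \<in> spingrp" "exp (t *\<^sub>R X) * vac = vac" for t
        using spinalg_exp[OF Xs] g2alg_exp[OF X] by auto
      have "F (to_mat (exp (t *\<^sub>R drho X)) *v v) = gact (exp (t *\<^sub>R X)) (F v)" for t
      proof -
        have "to_mat (exp (t *\<^sub>R X)) \<in> G2" using G by (simp add: G2_eq)
        from eg[OF this] spinor_part_group_action[OF lin G] show ?thesis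
          by (simp add: F_def rho_exp[OF Xs, symmetric] rho_def)
      qed
      then have e: "F (to_mat (exp (t *\<^sub>R drho X)) *v v) $ s = gact (exp (t *\<^sub>R X)) (F v) $ s" for t by simp
      have "linear (\<lambda>M. F (to_mat M *v v) $ s)"
        by (rule linearI)
          (simp_all add: plus_sqmat.rep_eq scaleR_sqmat.rep_eq matrix_vector_mult_add_rdistrib linear_add[OF lF] linear_scale[OF lF] scaleR_matvec)
      then have "((\<lambda>t. F (to_mat (exp (t *\<^sub>R drho X)) *v v) $ s) has_vector_derivative F (to_mat (drho X * exp (0 *\<^sub>R drho X)) *v v) $ s) (at 0)"
        by (rule bounded_linear.has_vector_derivative[OF bounded_linear_sqmat exp_scaleR_has_vector_derivative_left])
      then have "((\<lambda>t. gact (exp (t *\<^sub>R X)) (F v) $ s) has_vector_derivative F (op X v) $ s) (at 0)"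
        unfolding e by (simp add: op_def drho_ext_eq[OF Xs])
      then show "F (op X v) $ s = (sact X (F v) + eact X (F v)) $ s"
        using gact_derivative[OF X] by (rule vector_derivative_unique_at)
    qed
    have Fe: "- (\<Sum>k\<in>UNIV. sact (gm k) (F (op (msp (e7 k)) v))) - (1/2) *\<^sub>R sact phimat (F v) = r *\<^sub>R F v" for v
    proof -
      have "bilinear (\<lambda>x y. sact (cliff x) (F (op (msp y) v)))"
        unfolding bilinear_def
        by (auto intro!: linearI simp: cliff_simps msp_simps sact_simps sact_simps_left op_lin linear_add[OF lF] linear_scale[OF lF])
      from orthonormal_basis_trace[OF this Uf(2)]
      have t: "(\<Sum>a\<in>UNIV. sact (cliff (U a)) (F (op (msp (U a)) v))) = (\<Sum>k\<in>UNIV. sact (gm k) (F (op (msp (e7 k)) v)))" .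
      have o: "diff_rep \<rho> (I a) *v v = op (msp (U a)) v" for a
        by (simp add: op_def drho_ext_eq[OF msp_spinalg] drho_def Uf(1) iso_def)
      have h: "spin_coords U (clifford I (I a) s) = rmul (cliff (U a)) (spin_coords U s)" for a s using spin_coords_clifford[of "U a" s] by (simp only: Uf(1)[symmetric])
      have "spinor_part U l (dirac I \<rho> \<eta> v) = - (\<Sum>a\<in>UNIV. sact (cliff (U a)) (F (op (msp (U a)) v))) - (1/2) *\<^sub>R sact phimat (F v)"
        unfolding dirac_def spinor_part_linear[OF lin] spinor_part_spin_action[OF lin h] spinor_part_spin_action[OF lin spin_coords_clifford_phi] o F_def ..
      moreover have "spinor_part U l (dirac I \<rho> \<eta> v) = r *\<^sub>R F v" by (simp add: eig spinor_part_linear[OF lin] F_def)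
      ultimately show ?thesis using t by simp
    qed
    have Fs: "F v $ s \<in> spinalg" for v s by (simp add: F_def sp)
    have part: "map_spinor p (F v) = 0" if p: "linear p"
      and pb: "\<And>X Z. X \<in> g2alg \<Longrightarrow> Z \<in> spinalg \<Longrightarrow> p (brk X Z) = brk X (p Z)"
      and pe: "\<And>Z. Z \<in> spinalg \<Longrightarrow> (\<Sum>i\<in>UNIV. \<Sum>j\<in>UNIV. brk (Gg i j) (brk (Gg i j) (p Z))) = (- (8/3) * c) *\<^sub>R p Z"
      and c: "c \<le> 32/3" for p c
    proof -
      note lp = linear_map_spinor[OF p]
      have pce: "map_spinor p (eact X (F v)) = eact X (map_spinor p (F v))" if "X \<in> g2alg" for X v
        using that by (simp add: map_spinor_def eact_def pb Fs)
      show ?thesis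
      proof (rule no_small_eigenvalue[where F = "\<lambda>v. map_spinor p (F v)" and act = op and C = "4/3 * q" and c = c and r = r])
        show "linear (\<lambda>v. map_spinor p (F v))" using linear_compose[OF lF lp] by (simp add: o_def)
        show "linear (\<lambda>X. op X v)" for v by (rule linearI) (simp_all add: op_lin)
        show "linear (op X)" for X by (rule linearI) (simp_all add: op_vec scaleR_vscale)
        show "map_spinor p (F (op X v)) = sact X (map_spinor p (F v)) + eact X (map_spinor p (F v))" if "X \<in> g2alg" for X v
          using that by (simp add: Feq linear_add[OF lp] map_spinor_sact[OF p] pce)
        show "(\<Sum>i\<in>UNIV. \<Sum>j\<in>UNIV. eact (Gg i j) (eact (Gg i j) (map_spinor p (F v)))) = (- (8/3) * c) *\<^sub>R map_spinor p (F v)" for v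
          using pe[OF Fs] by (simp add: vec_eq_iff eact_def map_spinor_def)
        show "- (\<Sum>k\<in>UNIV. sact (gm k) (map_spinor p (F (op (msp (e7 k)) v)))) - (1/2) *\<^sub>R sact phimat (map_spinor p (F v)) = r *\<^sub>R map_spinor p (F v)" for v
          using arg_cong[OF Fe[of v], of "map_spinor p"]
          by (simp add: linear_diff[OF lp] linear_neg[OF lp] linear_scale[OF lp] linear_sum[OF lp] map_spinor_sact[OF p])
      qed (use op_brk cas q c r in auto)
    qed
    have "map_spinor proj_msp (F v) = 0"
      by (rule part[where c = "16/3"]) (simp_all add: linear_proj_msp proj_msp_brk, simp add: proj_msp_def sum_brk_Gg_msp)
    moreover have "map_spinor (\<lambda>Z. Z - proj_msp Z) (F v) = 0"
    proof (rule part[where c = "32/3"])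
      show "linear (\<lambda>Z. Z - proj_msp Z)" by (rule linearI) (simp_all add: linear_add[OF linear_proj_msp] linear_scale[OF linear_proj_msp] scaleR_right_diff_distrib)
      show "brk X Z - proj_msp (brk X Z) = brk X (Z - proj_msp Z)" if "X \<in> g2alg" "Z \<in> spinalg" for X Z
        using that by (simp add: proj_msp_brk linear_diff[OF linear_brk])
      show "(\<Sum>i\<in>UNIV. \<Sum>j\<in>UNIV. brk (Gg i j) (brk (Gg i j) (Z - proj_msp Z))) = (- (8/3) * (32/3)) *\<^sub>R (Z - proj_msp Z)" if "Z \<in> spinalg" for Z
        using sum_brk_Gg_g2[OF proj_msp_complement[OF that]] by simp
    qed simp
    ultimately have "F v = 0" by (simp add: map_spinor_def vec_eq_iff)
    then show ?thesis by (simp add: F_def)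
  qed
  show ?thesis
    by (rule spinor_part_eq_0; rule zero) (use delta_spin7C_spinor_part[OF es] in \<open>auto intro!: linearI\<close>)
qed

theorem corollary4p4:
  fixes I :: "7 \<Rightarrow> ix rmat" and \<rho> :: "ix rmat \<Rightarrow> complex^'n^'n"
  assumes "orthonormal_basis_m I"
    and "irreducible_spin7_rep \<rho>"
    and "\<forall>\<gamma>\<in>{(0,0,0), (1,0,0), (0,0,1), (0,1,0), (2,0,0), (1,0,1)}. \<not> has_highest_weight \<rho> \<gamma>"
  shows "\<forall>r\<in>{- (5/2)<..<5/2}. \<not> dirac_eigenvalue I \<rho> r"
proof (intro ballI notI)
  fix r :: real assume r: "r \<in> {- (5/2)<..<5/2}" and "dirac_eigenvalue I \<rho> r"
  then obtain \<eta> where \<eta>: "\<eta> \<in> Hom_G2 I \<rho>" "\<eta> \<noteq> (\<lambda>v. 0)" "dirac I \<rho> \<eta> = (\<lambda>v. r *\<^sub>R \<eta> v)"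
    by (auto simp: dirac_eigenvalue_def)
  have hw: "\<forall>\<gamma>\<in>{(0,0,0), (1,0,0), (0,0,1)}. \<not> has_highest_weight \<rho> \<gamma>" using assms(3) by blast
  have "\<eta> v = 0" for v
    using small_eigensection_zero[OF assms(1,2) hw _ _ \<eta>(1,3)] r by simp
  then show False using \<eta>(2) by auto
qed

end
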